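(* Let $x_1,x_2,\dots$ be random vectors in $\mathbb R^p$, $x_\tau=(x_\tau^1,\dots,x_\tau^p)$, and let $P(\tau)=\big(\tau,\sum_{t=1}^{\tau}x_t\big)\in\mathbb R^{p+1}$. Assume that all $x_\tau^d$ (with $d=1,\dots,p$) are independent and identically distributed with a continuous distribution. Then the expected number of faces (denoted $U_n^p$) and vertices (denoted $V_n^p$) of the convex hull of $\{P(\tau)\}_{\tau\in\{1,\dots,n-1\}}$ are $$\mathbb E(U_n^p)=\frac{2\,p!}{(n-1)!}\left[{n \atop p+1}\right],\qquad \mathbb E(V_n^p)=\frac{2}{(n-1)!}\sum_{l=0}^{\infty}\left[{n \atop p+1-2l}\right].$$
   Context: $\left[{n \atop m}\right]$ are the Stirling numbers of the first kind (unsigned, i.e. the number of permutations of $n$ elements with exactly $m$ cycles).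
   Formalization: The hull is taken over τ∈{0,…,n−1} with P(0)=0, since for {1,…,n−1} the formulas fail (p=1, n=3: two points, formula gives 3); n≥2 is assumed; faces are those of dimension p, and the face formula excludes n=p+1, where the hull is one p-simplex (1 face, formula gives 2). *)

theory Defs
  imports "HOL-Probability.Probability" "HOL-Combinatorics.Stirling"
begin

text \<open>
  \<open>\<real>\<^sup>p\<close> is \<open>real ^ 'p\<close>, so \<open>p = CARD('p)\<close>, and \<open>\<real>\<^sup>p\<^sup>+\<^sup>1\<close> is the product \<open>real \<times> (real ^ 'p)\<close>.
\<close>

definition path_point :: "(nat \<Rightarrow> 'a \<Rightarrow> real ^ 'p) \<Rightarrow> 'a \<Rightarrow> nat \<Rightarrow> real \<times> (real ^ 'p)" where
  "path_point x \<omega> \<tau> = (real \<tau>, \<Sum>t = 1..\<tau>. x t \<omega>)"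

text \<open>
  The time index starts at \<open>0\<close>, where the point is the origin. The expected values
  in terms of \<open>stirling n\<close> are those for \<open>n\<close> points; for the \<open>n - 1\<close> points with indices
  \<open>1, \<dots>, n - 1\<close> one would have to replace \<open>n\<close> by \<open>n - 1\<close> in both formulas. For example,
  with \<open>p = 1\<close> and \<open>n = 3\<close> the expected number of vertices below is \<open>3\<close>.
\<close>

definition path_hull ::
    "(nat \<Rightarrow> 'a \<Rightarrow> real ^ 'p) \<Rightarrow> nat \<Rightarrow> 'a \<Rightarrow> (real \<times> (real ^ 'p)) set" where
  "path_hull x n \<omega> = convex hull (path_point x \<omega> ` {0..n - 1})"

text \<open>
  The faces that are counted are those of codimension one in the ambient space, that is,
  of dimension \<open>p\<close> in \<open>\<real>\<^sup>p\<^sup>+\<^sup>1\<close>. If the hull is full-dimensional, they are its facets.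
  If \<open>n = p + 1\<close>, the hull is almost surely a \<open>p\<close>-simplex and itself the only such face.
\<close>

definition num_faces ::
    "(nat \<Rightarrow> 'a \<Rightarrow> real ^ 'p::finite) \<Rightarrow> nat \<Rightarrow> 'a \<Rightarrow> nat" where
  "num_faces x n \<omega> = card {F. F face_of path_hull x n \<omega> \<and> aff_dim F = int CARD('p)}"

definition num_vertices ::
    "(nat \<Rightarrow> 'a \<Rightarrow> real ^ 'p::finite) \<Rightarrow> nat \<Rightarrow> 'a \<Rightarrow> nat" where
  "num_vertices x n \<omega> = card {v. v extreme_point_of path_hull x n \<omega>}"

end

theory Submission
  imports Defs "HOL-Combinatorics.Multiset_Permutations"
begin

text \<open>
  Let \<open>X\<^sub>t = (1, x\<^sub>t)\<close> be the steps and put \<open>X\<^sub>0 = -(X\<^sub>1 + \<dots> + X\<^sub>N)\<close> with \<open>N = n - 1\<close>, so that the path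
  becomes a closed polygon whose steps form a cyclic word in the letters \<open>0, \<dots>, N\<close>. The law of
  the steps is invariant under permutations of \<open>1, \<dots>, N\<close>, so an expected number of vertices or
  facets is an average over all these words, and for steps in general position the total
  number over all words is a constant.

  A set of \<open>q + 1\<close> points is exposed by a functional \<open>f\<close> iff the \<open>q + 1\<close> arcs into which the points cut the
  cyclic word have \<open>f\<close>-sum zero and positive proper prefix sums. For \<open>q = 0\<close> such an \<open>f\<close> exists
  unless some nonconstant \<open>g\<close> with \<open>\<Sum>\<^sub>t g(t) X\<^sub>t = 0\<close> decreases along the word (Gordan), and removing one
  letter gives the Stirling recursion for the number of orderings along which a generic linear space
  contains a strictly decreasing \<open>g\<close>. For \<open>q = p\<close> the letters of the arcs determine \<open>f\<close> up
  to a scalar, and a set of \<open>b\<close> letters has exactly \<open>(b - 1)!\<close> positive orderings, as in the cycle lemma; the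
  sum of the products of these factorials over all labelled partitions into arcs is \<open>p! [n, p + 1]\<close>.
\<close>

section \<open>Alternating sums of Stirling numbers\<close>

text \<open>The steps 1, ..., N are exchangeable but the closing step is not, so the law alone
  yields an average over words in 1, ..., N. Recording the cuts as well repairs this: a word with
  one cut is a linear ordering of all N + 1 letters, and with more cuts it is a system of orderings
  of labelled blocks, in which the letter 0 merely marks one block. The counts of these objects hold
  for each fixed family of vectors in general position; probability enters through exchangeability,
  the division by N! and the almost sure general position. The factor 2 has two sources. For facets
  it stands for the two signs of the functional f. For vertices, the orderings missed by a generic
  space satisfy the recursion of twice the alternating Stirling sum, and the boundary values agree
  because half of all permutations are even. Time is deterministic, so continuity of the law says
  nothing about functionals that see time alone; these cause no degeneracy because each step
  advances time by 1.\<close>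

fun alt_stirling :: "nat \<Rightarrow> nat \<Rightarrow> nat" where
  "alt_stirling n 0 = stirling n 0"
| "alt_stirling n (Suc 0) = stirling n (Suc 0)"
| "alt_stirling n (Suc (Suc d)) = stirling n (Suc (Suc d)) + alt_stirling n d"

lemma alt_stirling_Suc_Suc:
  "alt_stirling (Suc n) (Suc d) = n * alt_stirling n (Suc d) + alt_stirling n d"
proof (induction n d rule: alt_stirling.induct)
  case (1 n)
  then show ?case by simp
next
  case (2 n)
  then show ?case by (cases n) auto
next
  case (3 n d)
  then show ?case by (simp add: algebra_simps)
qed

lemma alt_stirling_1: "alt_stirling (Suc 0) d + alt_stirling (Suc 0) (Suc d) = 1"
proof (induction d)
  case (Suc d)
  then show ?case by (cases d) (auto simp: algebra_simps)
qed auto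

text \<open>Once \<open>d \<ge> n\<close>, the sum covers every number of cycles that has the parity
  of \<open>d\<close>, that is, one sign class of the permutations of \<open>Suc n\<close> letters;
  the two classes are equally large for at least two letters. The induction starts from
  \<open>alt_stirling_1\<close>, where the two parities together give 1.\<close>

lemma two_alt_stirling_eq_fact: "n \<ge> 1 \<Longrightarrow> n \<le> d \<Longrightarrow> 2 * alt_stirling (Suc n) d = fact (Suc n)"
proof (induction n arbitrary: d rule: nat_induct_at_least)
  case base
  then obtain e where [simp]: "d = Suc e" by (cases d) auto
  show ?case
    using alt_stirling_1[of e] by (simp add: alt_stirling_Suc_Suc)
next
  case (Suc n)
  then obtain e where [simp]: "d = Suc e" by (cases d) auto
  have "2 * alt_stirling (Suc n) (Suc e) = fact (Suc n)" "2 * alt_stirling (Suc n) e = fact (Suc n)"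
    using Suc by auto
  then show ?case
    unfolding \<open>d = Suc e\<close> alt_stirling_Suc_Suc[of "Suc n"] distrib_left
    by (simp add: algebra_simps)
qed

lemma alt_stirling_sums:
  "(\<lambda>l. if 2 * l \<le> d then real (stirling n (d - 2 * l)) else 0) sums real (alt_stirling n d)"
proof (induction n d rule: alt_stirling.induct)
  case (1 n)
  show ?case using sums_single[of 0 "\<lambda>_. real (stirling n 0)"]
    by (simp add: if_distrib cong: if_cong)
next
  case (2 n)
  have "(\<lambda>l. if 2 * l \<le> Suc 0 then real (stirling n (Suc 0 - 2 * l)) else 0) =
      (\<lambda>l. if l = 0 then real (stirling n (Suc 0)) else 0)"
    by auto
  then show ?case using sums_single[of 0 "\<lambda>_. real (stirling n (Suc 0))"]
    by simp
next
  case (3 n d)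
  have "(\<lambda>l. if 2 * Suc l \<le> Suc (Suc d) then real (stirling n (Suc (Suc d) - 2 * Suc l)) else 0)
      sums real (alt_stirling n d)"
  proof -
    have "(\<lambda>l. if 2 * Suc l \<le> Suc (Suc d) then real (stirling n (Suc (Suc d) - 2 * Suc l)) else 0)
        = (\<lambda>l. if 2 * l \<le> d then real (stirling n (d - 2 * l)) else 0)"
      by (intro ext if_cong arg_cong[of _ _ real] arg_cong[of _ _ "stirling n"]) arith+
    with 3 show ?thesis by simp
  qed
  from sums_Suc[OF this] show ?case by (simp add: add.commute)
qed

section \<open>Orderings realised by a linear space\<close>

definition lin_closed :: "('b \<Rightarrow> real) set \<Rightarrow> bool" where
  "lin_closed W \<longleftrightarrow> (\<forall>g\<in>W. \<forall>\<mu>\<in>W. \<forall>a b. (\<lambda>t. a * g t + b * \<mu> t) \<in> W)"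

definition decr_along :: "('b \<Rightarrow> real) \<Rightarrow> 'b list \<Rightarrow> bool" where
  "decr_along g l \<longleftrightarrow> sorted_wrt (\<lambda>s t. g s > g t) l"

text \<open>An ordering of \<open>A\<close> is a chamber of the braid arrangement, so these are the
  chambers that the linear space \<open>W\<close> meets.\<close>

definition hits :: "'b set \<Rightarrow> ('b \<Rightarrow> real) set \<Rightarrow> 'b list set" where
  "hits A W = {l \<in> permutations_of_set A. \<exists>g\<in>W. decr_along g l}"

definition insert_at :: "'b \<Rightarrow> nat \<Rightarrow> 'b list \<Rightarrow> 'b list" where
  "insert_at z k l = take k l @ z # drop k l"

text \<open>Members have an arbitrary value at \<open>z\<close>, so the coordinate is forgotten
  without a change of type. The same holds for \<open>merge_into\<close>, which is the section of
  \<open>W\<close> by the hyperplane where \<open>z\<close> and \<open>i\<close> have equal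
  values.\<close>

definition project_out :: "'b \<Rightarrow> ('b \<Rightarrow> real) set \<Rightarrow> ('b \<Rightarrow> real) set" where
  "project_out z W = {g. \<exists>c. g(z := c) \<in> W}"

definition merge_into :: "'b \<Rightarrow> 'b \<Rightarrow> ('b \<Rightarrow> real) set \<Rightarrow> ('b \<Rightarrow> real) set" where
  "merge_into z i W = {g. g(z := g i) \<in> W}"

lemma lin_closedD:
  "lin_closed W \<Longrightarrow> g \<in> W \<Longrightarrow> \<mu> \<in> W \<Longrightarrow> (\<lambda>t. a * g t + b * \<mu> t) \<in> W"
  unfolding lin_closed_def by blast

lemma project_outI: "g(z := c) \<in> W \<Longrightarrow> g \<in> project_out z W"
  unfolding project_out_def by blast

lemma decr_along_cong: "(\<And>t. t \<in> set l \<Longrightarrow> g t = \<mu> t) \<Longrightarrow> decr_along g l \<longleftrightarrow> decr_along \<mu> l"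
  unfolding decr_along_def sorted_wrt_iff_nth_less by (auto simp: nth_mem)

lemma decr_along_upd: "z \<notin> set l \<Longrightarrow> decr_along (g(z := c)) l \<longleftrightarrow> decr_along g l"
  by (intro decr_along_cong) auto

lemma decr_along_insert_at:
  "decr_along g (insert_at z k l) \<longleftrightarrow>
     decr_along g l \<and> (\<forall>t\<in>set (take k l). g t > g z) \<and> (\<forall>t\<in>set (drop k l). g z > g t)"
proof -
  have "decr_along g (a @ z # b) \<longleftrightarrow>
     decr_along g (a @ b) \<and> (\<forall>t\<in>set a. g t > g z) \<and> (\<forall>t\<in>set b. g z > g t)" for a b
    unfolding decr_along_def sorted_wrt_append by force
  from this[of "take k l" "drop k l"] show ?thesis
    by (simp add: insert_at_def)
qed

lemma decr_along_nth: "decr_along g l \<longleftrightarrow> (\<forall>i j. i < j \<longrightarrow> j < length l \<longrightarrow> g (l ! i) > g (l ! j))"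
  unfolding decr_along_def sorted_wrt_iff_nth_less by auto

lemma decr_along_insert_at_nth:
  assumes "k \<le> length l"
  shows "decr_along g (insert_at z k l) \<longleftrightarrow> decr_along g l \<and>
     (0 < k \<longrightarrow> g (l ! (k - 1)) > g z) \<and> (k < length l \<longrightarrow> g z > g (l ! k))"
proof (cases "decr_along g l")
  case True
  have "(\<forall>t\<in>set (take k l). g t > g z) \<longleftrightarrow> (0 < k \<longrightarrow> g (l ! (k - 1)) > g z)" (is "?L \<longleftrightarrow> ?R")
  proof
    assume ?L
    then show ?R using assms nth_mem[of "k - 1" "take k l"] by auto
  next
    assume R: ?R
    show ?L
    proof
      fix t assume "t \<in> set (take k l)"
      then obtain i where i: "i < k" "t = l ! i" using assms by (auto simp: in_set_conv_nth)
      show "g t > g z"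
      proof (cases "i = k - 1")
        case False
        then have "g (l ! i) > g (l ! (k - 1))"
          using True i assms unfolding decr_along_nth by auto
        then show ?thesis using R i by simp
      qed (use R i in simp)
    qed
  qed
  moreover have "(\<forall>t\<in>set (drop k l). g z > g t) \<longleftrightarrow> (k < length l \<longrightarrow> g z > g (l ! k))" (is "?L \<longleftrightarrow> ?R")
  proof
    assume ?L
    then show ?R using nth_mem[of 0 "drop k l"] by auto
  next
    assume R: ?R
    show ?L
    proof
      fix t assume "t \<in> set (drop k l)"
      then obtain i where i: "k + i < length l" "t = l ! (k + i)"
        by (metis add.commute in_set_conv_nth length_drop less_diff_conv nth_drop nat_le_linear assms)
      show "g z > g t"
      proof (cases "i = 0")
        case False
        then have "g (l ! k) > g (l ! (k + i))"
          using True i assms unfolding decr_along_nth by auto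
        then show ?thesis using R i by simp
      qed (use R i in simp)
    qed
  qed
  ultimately show ?thesis using True by (simp add: decr_along_insert_at)
qed (simp add: decr_along_insert_at)

text \<open>The members of \<open>W\<close> that decrease along \<open>l\<close> form a convex cone,
  and a linear functional that changes sign on it has a zero there.\<close>

lemma lin_closed_interpolate:
  assumes "lin_closed W" "g \<in> W" "\<mu> \<in> W" "decr_along g l" "decr_along \<mu> l"
    and h: "\<And>a b. h (\<lambda>t. a * g t + b * \<mu> t) = a * h g + b * h \<mu>"
    and "h g \<ge> (0::real)" "h \<mu> \<le> 0"
  shows "\<exists>\<nu>\<in>W. decr_along \<nu> l \<and> h \<nu> = 0"
proof (cases "h g = 0")
  case True
  then show ?thesis using assms by auto
next
  case False
  then have pos: "h g > 0" using assms by simp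
  define \<nu> where "\<nu> = (\<lambda>t. (- h \<mu>) * g t + h g * \<mu> t)"
  have "\<nu> \<in> W" using assms unfolding lin_closed_def \<nu>_def by blast
  moreover have "h \<nu> = 0" unfolding \<nu>_def h by simp
  moreover have "decr_along \<nu> l"
    unfolding decr_along_nth
  proof (intro allI impI)
    fix i j assume "i < j" "j < length l"
    then have "g (l ! j) < g (l ! i)" "\<mu> (l ! j) < \<mu> (l ! i)"
      using assms unfolding decr_along_nth by auto
    then show "\<nu> (l ! j) < \<nu> (l ! i)"
      unfolding \<nu>_def using pos \<open>h \<mu> \<le> 0\<close> by (intro add_le_less_mono mult_left_mono) auto
  qed
  ultimately show ?thesis by auto
qed

text \<open>Strict decrease along a list consists of finitely many strict inequalities and is
  therefore an open condition.\<close>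

lemma decr_along_perturb:
  assumes "decr_along g l"
  shows "\<forall>\<^sub>F e in at_right (0::real). decr_along (\<lambda>t. g t + e * \<delta> t) l"
proof -
  have "\<forall>\<^sub>F e in at_right (0::real). \<forall>i\<in>{..<length l}. \<forall>j\<in>{..<length l}. i < j \<longrightarrow>
     g (l ! i) + e * \<delta> (l ! i) > g (l ! j) + e * \<delta> (l ! j)"
  proof (intro eventually_ball_finite ballI finite_lessThan)
    fix i j assume *: "i \<in> {..<length l}" "j \<in> {..<length l}"
    show "\<forall>\<^sub>F e in at_right (0::real). i < j \<longrightarrow>
     g (l ! i) + e * \<delta> (l ! i) > g (l ! j) + e * \<delta> (l ! j)"
    proof (cases "i < j")
      case True
      then have "g (l ! i) - g (l ! j) > 0" using assms * unfolding decr_along_nth by auto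
      moreover have "((\<lambda>e. (g (l ! i) + e * \<delta> (l ! i)) - (g (l ! j) + e * \<delta> (l ! j)))
          \<longlongrightarrow> (g (l ! i) + 0 * \<delta> (l ! i)) - (g (l ! j) + 0 * \<delta> (l ! j))) (at_right 0)"
        by (intro tendsto_intros)
      ultimately have "\<forall>\<^sub>F e in at_right (0::real). (g (l ! i) + e * \<delta> (l ! i)) - (g (l ! j) + e * \<delta> (l ! j)) > 0"
        by (intro order_tendstoD(1)) auto
      then show ?thesis by eventually_elim auto
    qed auto
  qed
  then show ?thesis by eventually_elim (auto simp: decr_along_nth)
qed

section \<open>Slots for a new letter in an ordering\<close>

lemma permutations_of_set_insert_at:
  assumes "finite A" "z \<notin> A"
  shows "bij_betw (\<lambda>(l, k). insert_at z k l) (permutations_of_set A \<times> {..card A})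
           (permutations_of_set (insert z A))"
proof -
  have len: "length l = card A" if "l \<in> permutations_of_set A" for l
    using that by (rule length_finite_permutations_of_set)
  have "inj_on (\<lambda>(l, k). insert_at z k l) (permutations_of_set A \<times> {..card A})"
  proof (rule inj_on_inverseI[where g = "\<lambda>l. (removeAll z l, length (takeWhile (\<lambda>t. t \<noteq> z) l))"])
    fix p assume "p \<in> permutations_of_set A \<times> {..card A}"
    then obtain l k where p: "p = (l, k)" "l \<in> permutations_of_set A" "k \<le> card A" by auto
    then have z: "z \<notin> set l" using assms by (auto dest: permutations_of_setD)
    then have zz: "z \<notin> set (take k l)" "z \<notin> set (drop k l)" by (auto dest: in_set_takeD in_set_dropD)
    then have "takeWhile (\<lambda>t. t \<noteq> z) (take k l @ z # drop k l) = take k l"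
      by (subst takeWhile_append2) auto
    then show "(removeAll z (case p of (l, k) \<Rightarrow> insert_at z k l),
          length (takeWhile (\<lambda>t. t \<noteq> z) (case p of (l, k) \<Rightarrow> insert_at z k l))) = p"
      using p zz len[of l] by (simp add: insert_at_def min_def)
  qed
  moreover have "(\<lambda>(l, k). insert_at z k l) ` (permutations_of_set A \<times> {..card A}) = permutations_of_set (insert z A)"
  proof (intro equalityI subsetI)
    fix x assume "x \<in> (\<lambda>(l, k). insert_at z k l) ` (permutations_of_set A \<times> {..card A})"
    then obtain l k where x: "x = insert_at z k l" "l \<in> permutations_of_set A" by auto
    then have l: "set l = A" "distinct l" by (auto dest: permutations_of_setD)
    define a b where "a = take k l" and "b = drop k l"
    have "set (a @ b) = A" "distinct (a @ b)" using l by (simp_all add: a_def b_def)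
    then have "set x = insert z A" "distinct x"
      unfolding x insert_at_def a_def[symmetric] b_def[symmetric] using assms by auto
    then show "x \<in> permutations_of_set (insert z A)" by auto
  next
    fix x assume x: "x \<in> permutations_of_set (insert z A)"
    then have x': "set x = insert z A" "distinct x" by (auto dest: permutations_of_setD)
    then obtain a b where ab: "x = a @ z # b" using split_list[of z x] by auto
    have "set (a @ b) = A" using x' assms unfolding ab by auto
    then have "a @ b \<in> permutations_of_set A" using x' unfolding ab by (intro permutations_of_setI) auto
    moreover have "length a \<le> card A" using len[OF calculation] by simp
    moreover have "x = insert_at z (length a) (a @ b)" using ab by (simp add: insert_at_def)
    ultimately show "x \<in> (\<lambda>(l, k). insert_at z k l) ` (permutations_of_set A \<times> {..card A})"
      by force
  qed
  ultimately show ?thesis unfolding bij_betw_def by blast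
qed

lemma card_slots:
  fixes T :: "nat set"
  assumes "T \<subseteq> {..m}" and conv: "\<And>i j k. i \<in> T \<Longrightarrow> k \<in> T \<Longrightarrow> i < j \<Longrightarrow> j < k \<Longrightarrow> j \<in> T"
  shows "card T = (if T = {} then 0 else 1) + card {k. k < m \<and> k \<in> T \<and> Suc k \<in> T}"
proof (cases "T = {}")
  case False
  have fin: "finite T" using assms finite_subset by blast
  define a b where "a = Min T" and "b = Max T"
  have ab: "a \<in> T" "b \<in> T" "\<And>t. t \<in> T \<Longrightarrow> a \<le> t \<and> t \<le> b"
    using False fin by (auto simp: a_def b_def)
  have T: "T = {a..b}"
  proof (intro equalityI subsetI)
    fix j assume "j \<in> {a..b}"
    then consider "j = a" | "j = b" | "a < j" "j < b" by force
    then show "j \<in> T" using ab conv[of a b j] by cases auto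
  qed (use ab in auto)
  have "b \<le> m" "a \<le> b" using ab assms(1) by auto
  then have "{k. k < m \<and> k \<in> T \<and> Suc k \<in> T} = {a..<b}" unfolding T by auto
  then show ?thesis using False \<open>a \<le> b\<close> unfolding T by simp
qed auto

text \<open>
  For a fixed order \<open>l\<close> of the remaining letters, the slots for \<open>z\<close> that are realised by \<open>W\<close> form an interval,
  and two neighbouring slots are both realised iff \<open>z\<close> can be given the value of the letter
  between them. An interval has one more element than it has pairs of neighbours.
\<close>

lemma card_hits_insert:
  assumes fin: "finite A" and z: "z \<notin> A" and lin: "lin_closed W"
    and sep: "\<And>i. i \<in> A \<Longrightarrow> \<exists>\<delta>\<in>W. \<delta> z \<noteq> \<delta> i"
  shows "card (hits (insert z A) W) =
    card (hits A (project_out z W)) + (\<Sum>i\<in>A. card (hits A (merge_into z i W)))"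
proof -
  \<comment> \<open>\<open>T l\<close> holds the realised slots of \<open>z\<close>. An element
    \<open>k\<close> of \<open>Ed l\<close> stands for the pair of slots \<open>k\<close> and
    \<open>Suc k\<close> on the two sides of the letter \<open>l ! k\<close>.\<close>
  define T where "T l = {k. k \<le> card A \<and> insert_at z k l \<in> hits (insert z A) W}" for l
  define Ed where "Ed l = {k. k < card A \<and> l \<in> hits A (merge_into z (l ! k) W)}" for l
  have slots: "card (T l) = (if l \<in> hits A (project_out z W) then 1 else 0) + card (Ed l)"
    if l: "l \<in> permutations_of_set A" for l
  proof -
    have ll: "set l = A" "distinct l" "length l = card A"
      using l by (auto dest: permutations_of_setD length_finite_permutations_of_set)
    have zl: "z \<notin> set l" using ll z by simp
    have mem: "k \<in> T l \<longleftrightarrow> k \<le> card A \<and> (\<exists>g\<in>W. decr_along g (insert_at z k l))" for k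
    proof -
      have "insert_at z k l \<in> permutations_of_set (insert z A)" if "k \<le> card A"
        using bij_betwE[OF permutations_of_set_insert_at[OF fin z]] l that by auto
      then show ?thesis unfolding T_def hits_def by auto
    qed
    have memE: "k \<in> Ed l \<longleftrightarrow> k < card A \<and> (\<exists>g\<in>W. decr_along g l \<and> g z = g (l ! k))" for k
    proof (cases "k < card A")
      case True
      then have k: "l ! k \<noteq> z" using ll z nth_mem[of k l] by auto
      have "(\<exists>g. g(z := g (l ! k)) \<in> W \<and> decr_along g l) \<longleftrightarrow> (\<exists>g\<in>W. decr_along g l \<and> g z = g (l ! k))"
      proof
        assume "\<exists>g. g(z := g (l ! k)) \<in> W \<and> decr_along g l"
        then obtain g where "g(z := g (l ! k)) \<in> W" "decr_along g l" by blast
        then show "\<exists>g\<in>W. decr_along g l \<and> g z = g (l ! k)"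
          by (intro bexI[of _ "g(z := g (l ! k))"]) (use k zl in \<open>auto simp: decr_along_upd\<close>)
      next
        assume "\<exists>g\<in>W. decr_along g l \<and> g z = g (l ! k)"
        then obtain g where g: "g \<in> W" "decr_along g l" "g z = g (l ! k)" by blast
        have "g(z := g (l ! k)) = g" using g(3) by auto
        then show "\<exists>g. g(z := g (l ! k)) \<in> W \<and> decr_along g l" using g(1,2) by (intro exI[of _ g]) simp
      qed
      moreover have "k \<in> Ed l \<longleftrightarrow> (\<exists>g. g(z := g (l ! k)) \<in> W \<and> decr_along g l)"
        using l True unfolding Ed_def hits_def merge_into_def by blast
      ultimately show ?thesis using True by simp
    qed (simp add: Ed_def)
    \<comment> \<open>A member in which \<open>z\<close> is tied with \<open>l ! k\<close> is pushed
      to either side by a small multiple of a separating function. Conversely, interpolation between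
      members for the two slots produces the tie.\<close>
    have edge: "k \<in> Ed l \<longleftrightarrow> k < card A \<and> k \<in> T l \<and> Suc k \<in> T l" for k
    proof
      assume "k \<in> Ed l"
      then obtain g where k: "k < card A" and g: "g \<in> W" "decr_along g l" "g z = g (l ! k)"
        unfolding memE by blast
      obtain \<delta>0 where \<delta>0: "\<delta>0 \<in> W" "\<delta>0 z \<noteq> \<delta>0 (l ! k)"
        using sep[of "l ! k"] k ll nth_mem[of k l] by auto
      have "\<exists>\<nu>\<in>W. decr_along \<nu> (insert_at z (if s then k else Suc k) l)" for s
      proof -
        \<comment> \<open>The sign makes \<open>z\<close> move above \<open>l ! k\<close> for slot
          \<open>k\<close> (when \<open>s\<close> holds) and below it for slot
          \<open>Suc k\<close>.\<close>
        define c where "c = (if (\<delta>0 z > \<delta>0 (l ! k)) = s then 1 else - 1 :: real)"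
        define \<delta> where "\<delta> = (\<lambda>t. c * \<delta>0 t + 0 * \<delta>0 t)"
        have \<delta>: "\<delta> \<in> W" using lin \<delta>0 unfolding lin_closed_def \<delta>_def by blast
        have sgn: "if s then \<delta> z > \<delta> (l ! k) else \<delta> z < \<delta> (l ! k)"
          using \<delta>0(2) unfolding \<delta>_def c_def by auto
        define \<nu> where "\<nu> e = (\<lambda>t. g t + e * \<delta> t)" for e
        have ev1: "\<forall>\<^sub>F e in at_right 0. decr_along (\<nu> e) l"
          unfolding \<nu>_def by (rule decr_along_perturb[OF g(2)])
        have ev2: "\<forall>\<^sub>F e in at_right 0. 0 < k \<longrightarrow> \<nu> e (l ! (k - 1)) > \<nu> e z"
        proof (cases "0 < k")
          case True
          then have "g (l ! k) < g (l ! (k - 1))"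
            using g(2) k ll unfolding decr_along_nth by auto
          then have "decr_along g [l ! (k - 1), z]"
            using g(3) by (simp add: decr_along_def)
          from decr_along_perturb[OF this, of \<delta>] show ?thesis
            by eventually_elim (simp add: decr_along_def \<nu>_def)
        qed auto
        have ev3: "\<forall>\<^sub>F e in at_right 0. Suc k < length l \<longrightarrow> \<nu> e z > \<nu> e (l ! Suc k)"
        proof (cases "Suc k < length l")
          case True
          then have "g (l ! Suc k) < g (l ! k)"
            using g(2) k ll unfolding decr_along_nth by auto
          then have "decr_along g [z, l ! Suc k]"
            using g(3) by (simp add: decr_along_def)
          from decr_along_perturb[OF this, of \<delta>] show ?thesis
            by eventually_elim (simp add: decr_along_def \<nu>_def)
        qed auto
        have ev4: "\<forall>\<^sub>F e in at_right (0::real). e > 0" by (simp add: eventually_at_right_less)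
        from eventually_conj[OF ev1 eventually_conj[OF ev2 eventually_conj[OF ev3 ev4]]]
        obtain e where e: "decr_along (\<nu> e) l" "0 < k \<longrightarrow> \<nu> e (l ! (k - 1)) > \<nu> e z"
           "Suc k < length l \<longrightarrow> \<nu> e z > \<nu> e (l ! Suc k)" "e > 0"
          using eventually_happens'[OF trivial_limit_at_right_real] by blast
        have "\<nu> e = (\<lambda>t. 1 * g t + e * \<delta> t)" unfolding \<nu>_def by simp
        then have "\<nu> e \<in> W" using lin g \<delta> unfolding lin_closed_def by metis
        moreover have "decr_along (\<nu> e) (insert_at z (if s then k else Suc k) l)"
        proof (cases s)
          case True
          then have "\<nu> e z > \<nu> e (l ! k)" using sgn e g(3) by (simp add: \<nu>_def)
          then show ?thesis using e True k ll by (subst decr_along_insert_at_nth) auto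
        next
          case False
          then have "\<nu> e z < \<nu> e (l ! k)" using sgn e g(3) by (simp add: \<nu>_def)
          then show ?thesis using e False k ll by (subst decr_along_insert_at_nth) auto
        qed
        ultimately show ?thesis by blast
      qed
      from this[of True] this[of False] show "k < card A \<and> k \<in> T l \<and> Suc k \<in> T l"
        using k by (auto simp: mem)
    next
      assume k: "k < card A \<and> k \<in> T l \<and> Suc k \<in> T l"
      then obtain g \<mu> where
        g: "g \<in> W" "decr_along g (insert_at z k l)" and \<mu>: "\<mu> \<in> W" "decr_along \<mu> (insert_at z (Suc k) l)"
        unfolding mem by blast
      have 1: "g z > g (l ! k)" "\<mu> z < \<mu> (l ! k)" "decr_along g l" "decr_along \<mu> l"
        using g(2) \<mu>(2) k ll by (auto simp: decr_along_insert_at_nth)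
      have "\<exists>\<nu>\<in>W. decr_along \<nu> l \<and> \<nu> z - \<nu> (l ! k) = 0"
        using lin_closed_interpolate[OF lin g(1) \<mu>(1) 1(3,4), of "\<lambda>\<nu>. \<nu> z - \<nu> (l ! k)"] 1(1,2)
        by (simp add: algebra_simps)
      then show "k \<in> Ed l" using k by (auto simp: memE)
    qed
    have nonempty: "l \<in> hits A (project_out z W) \<longleftrightarrow> T l \<noteq> {}"
    proof
      assume "l \<in> hits A (project_out z W)"
      then obtain g0 c where g0: "decr_along g0 l" "g0(z := c) \<in> W"
        by (auto simp: hits_def project_out_def)
      define g where "g = g0(z := c)"
      have g: "decr_along g l" "g \<in> W" using g0 zl by (auto simp: g_def decr_along_upd)
      define k where "k = length (takeWhile (\<lambda>t. g t > g z) l)"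
      have kl: "k \<le> length l" unfolding k_def by (rule length_takeWhile_le)
      have k1: "0 < k \<longrightarrow> g (l ! (k - 1)) > g z"
      proof
        let ?w = "takeWhile (\<lambda>t. g t > g z) l"
        assume "0 < k"
        then have "k - 1 < length ?w" by (simp add: k_def)
        from nth_mem[OF this] takeWhile_nth[OF this] show "g (l ! (k - 1)) > g z"
          by (metis set_takeWhileD)
      qed
      have k2: "k < length l \<longrightarrow> g (l ! k) \<le> g z"
        using nth_length_takeWhile[of "\<lambda>t. g t > g z" l] by (auto simp: k_def)
      show "T l \<noteq> {}"
      \<comment> \<open>If \<open>z\<close> is tied with a letter, \<open>g\<close> itself belongs
        to no slot, and the neighbouring slots come from \<open>edge\<close>.\<close>
      proof (cases "k < length l \<and> g (l ! k) = g z")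
        case True
        then have "k \<in> Ed l" using g ll by (auto simp: memE)
        then show ?thesis using edge by auto
      next
        case False
        then have "decr_along g (insert_at z k l)"
          using k1 k2 kl g by (subst decr_along_insert_at_nth) auto
        then have "k \<in> T l" using kl ll g by (auto simp: mem)
        then show ?thesis by auto
      qed
    next
      assume "T l \<noteq> {}"
      then obtain k g where "g \<in> W" "decr_along g (insert_at z k l)" by (auto simp: mem)
      then have "decr_along g l" "g \<in> project_out z W"
        by (auto simp: decr_along_insert_at intro!: project_outI[of g z "g z"])
      then show "l \<in> hits A (project_out z W)" using l by (auto simp: hits_def)
    qed
    have "card (T l) = (if T l = {} then 0 else 1) + card {k. k < card A \<and> k \<in> T l \<and> Suc k \<in> T l}"
    proof (rule card_slots)
      show "T l \<subseteq> {..card A}" by (auto simp: T_def)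
      fix i j k assume ijk: "i \<in> T l" "k \<in> T l" "i < j" "j < k"
      then obtain g \<mu> where kk: "k \<le> card A" and
        g: "g \<in> W" "decr_along g (insert_at z i l)" and \<mu>: "\<mu> \<in> W" "decr_along \<mu> (insert_at z k l)"
        unfolding mem by blast
      have mono: "\<nu> (l ! s) \<ge> \<nu> (l ! t)" if "decr_along \<nu> l" "s \<le> t" "t < card A" for \<nu> :: "'a \<Rightarrow> real" and s t
        using that ll unfolding decr_along_nth by (cases "s = t") (auto intro: less_imp_le)
      have 1: "decr_along g l" "decr_along \<mu> l" "g z > g (l ! i)" "\<mu> z < \<mu> (l ! (k - 1))"
        using g(2) \<mu>(2) ijk kk ll by (auto simp: decr_along_insert_at_nth)
      have "i \<le> j - 1" "j - 1 < card A" "j \<le> k - 1" "k - 1 < card A" "j - 1 \<le> j" "j < card A"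
        using ijk kk by auto
      then have m: "g (l ! (j - 1)) \<le> g (l ! i)" "\<mu> (l ! (k - 1)) \<le> \<mu> (l ! j)"
          "g (l ! j) \<le> g (l ! (j - 1))" "\<mu> (l ! j) \<le> \<mu> (l ! (j - 1))"
        using mono 1 by blast+
      have 2: "g z > g (l ! (j - 1))" "\<mu> z < \<mu> (l ! j)"
        using 1 m by linarith+
      have 3: "g z \<ge> g (l ! j)" "\<mu> z \<le> \<mu> (l ! (j - 1))"
        using 2 m by linarith+
      \<comment> \<open>The functional vanishes when the value at \<open>z\<close> is the mean of
        the values at \<open>l ! (j - 1)\<close> and \<open>l ! j\<close>; then \<open>z\<close>
        sits strictly between them, in slot \<open>j\<close>.\<close>
      have "\<exists>\<nu>\<in>W. decr_along \<nu> l \<and> 2 * \<nu> z - \<nu> (l ! j) - \<nu> (l ! (j - 1)) = 0"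
        using lin_closed_interpolate[OF lin g(1) \<mu>(1) 1(1,2), of "\<lambda>\<nu>. 2 * \<nu> z - \<nu> (l ! j) - \<nu> (l ! (j - 1))"] 2 3
        by (simp add: algebra_simps)
      then obtain \<nu> where \<nu>: "\<nu> \<in> W" "decr_along \<nu> l" "2 * \<nu> z - \<nu> (l ! j) - \<nu> (l ! (j - 1)) = 0" by blast
      have "\<nu> (l ! j) < \<nu> (l ! (j - 1))" using \<nu>(2) ijk kk ll unfolding decr_along_nth by auto
      then have "decr_along \<nu> (insert_at z j l)"
        using \<nu> ijk kk ll by (subst decr_along_insert_at_nth) auto
      then show "j \<in> T l" using \<nu> ijk kk by (auto simp: mem)
    qed
    also have "{k. k < card A \<and> k \<in> T l \<and> Suc k \<in> T l} = Ed l"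
      using edge by blast
    finally show ?thesis using nonempty by auto
  qed
  have "card (hits (insert z A) W) = card (SIGMA l:permutations_of_set A. T l)"
  proof (rule bij_betw_same_card[symmetric])
    have b: "bij_betw (\<lambda>(l, k). insert_at z k l) (permutations_of_set A \<times> {..card A})
           (permutations_of_set (insert z A))"
      by (rule permutations_of_set_insert_at[OF fin z])
    show "bij_betw (\<lambda>(l, k). insert_at z k l) (SIGMA l:permutations_of_set A. T l) (hits (insert z A) W)"
    proof (rule bij_betw_subset[OF b])
      show "(SIGMA l:permutations_of_set A. T l) \<subseteq> permutations_of_set A \<times> {..card A}"
        by (auto simp: T_def)
      have "hits (insert z A) W \<subseteq> (\<lambda>(l, k). insert_at z k l) ` (SIGMA l:permutations_of_set A. T l)"
      proof
        fix x assume x: "x \<in> hits (insert z A) W"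
        then have "x \<in> permutations_of_set (insert z A)" by (simp add: hits_def)
        then obtain l k where lk: "l \<in> permutations_of_set A" "k \<le> card A" "x = insert_at z k l"
          using bij_betw_imp_surj_on[OF b] by force
        then have "(l, k) \<in> (SIGMA l:permutations_of_set A. T l)" using x by (auto simp: T_def)
        then show "x \<in> (\<lambda>(l, k). insert_at z k l) ` (SIGMA l:permutations_of_set A. T l)"
          using lk by force
      qed
      then show "(\<lambda>(l, k). insert_at z k l) ` (SIGMA l:permutations_of_set A. T l) = hits (insert z A) W"
        by (auto simp: T_def)
    qed
  qed
  also have "\<dots> = (\<Sum>l\<in>permutations_of_set A. card (T l))"
    by (subst card_SigmaI) (auto simp: T_def)
  also have "\<dots> = (\<Sum>l\<in>permutations_of_set A. if l \<in> hits A (project_out z W) then 1 else 0)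
      + (\<Sum>l\<in>permutations_of_set A. card (Ed l))"
    by (simp add: slots sum.distrib)
  also have "(\<Sum>l\<in>permutations_of_set A. if l \<in> hits A (project_out z W) then 1 else 0) =
      card (hits A (project_out z W))"
  proof -
    have "permutations_of_set A \<inter> {l. l \<in> hits A (project_out z W)} = hits A (project_out z W)"
      by (auto simp: hits_def)
    then show ?thesis by (simp add: sum.If_cases)
  qed
  also have "(\<Sum>l\<in>permutations_of_set A. card (Ed l)) =
      (\<Sum>l\<in>permutations_of_set A. \<Sum>i\<in>A. if l \<in> hits A (merge_into z i W) then 1 else 0)"
  proof (rule sum.cong[OF refl])
    fix l assume l: "l \<in> permutations_of_set A"
    have ll: "set l = A" "distinct l" "length l = card A"
      using l by (auto dest: permutations_of_setD length_finite_permutations_of_set)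
    have "bij_betw ((!) l) {..<card A} A"
      using bij_betw_nth[OF ll(2)] ll by simp
    then have "(\<Sum>i\<in>A. if l \<in> hits A (merge_into z i W) then 1 else 0) =
       (\<Sum>k<card A. if l \<in> hits A (merge_into z (l ! k) W) then 1 else (0::nat))"
      by (subst sum.reindex_bij_betw[symmetric]) auto
    also have "\<dots> = card (Ed l)"
    proof -
      have "{..<card A} \<inter> {k. l \<in> hits A (merge_into z (l ! k) W)} = Ed l"
        by (auto simp: Ed_def)
      then show ?thesis by (simp add: sum.If_cases)
    qed
    finally show "card (Ed l) = (\<Sum>i\<in>A. if l \<in> hits A (merge_into z i W) then 1 else 0)" by simp
  qed
  also have "\<dots> = (\<Sum>i\<in>A. card (hits A (merge_into z i W)))"
  proof (subst sum.swap, rule sum.cong[OF refl])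
    fix i
    have "permutations_of_set A \<inter> {l. l \<in> hits A (merge_into z i W)} = hits A (merge_into z i W)"
      by (auto simp: hits_def)
    then show "(\<Sum>l\<in>permutations_of_set A. if l \<in> hits A (merge_into z i W) then 1 else 0) =
       card (hits A (merge_into z i W))" by (simp add: sum.If_cases)
  qed
  finally show ?thesis .
qed

section \<open>Generic spaces and the number of orderings they realise\<close>

text \<open>
  The second conjunct bounds the codimension of \<open>W\<close> by \<open>d\<close>. The third one is the genericity:
  for the relations of vectors \<open>X\<^sub>t\<close> it says that any \<open>d\<close> disjoint block sums, with one block left out, are independent.
\<close>

definition generic_space :: "'b set \<Rightarrow> nat \<Rightarrow> ('b \<Rightarrow> real) set \<Rightarrow> bool" where
  "generic_space A d W \<longleftrightarrow> lin_closed W \<and>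
     (\<forall>u. \<exists>a. (\<exists>i\<le>d. a i \<noteq> 0) \<and> (\<lambda>t. \<Sum>i\<le>d. a i * u i t) \<in> W) \<and>
     (\<forall>g\<in>W. card (g ` A) \<le> Suc d \<longrightarrow> card (g ` A) \<le> 1)"

lemma generic_spaceD:
  assumes "generic_space A d W"
  shows "lin_closed W"
    and "\<exists>a. (\<exists>i\<le>d. a i \<noteq> 0) \<and> (\<lambda>t. \<Sum>i\<le>d. a i * u i t) \<in> W"
    and "g \<in> W \<Longrightarrow> card (g ` A) \<le> Suc d \<Longrightarrow> card (g ` A) \<le> 1"
  using assms unfolding generic_space_def by auto

lemma card_image_le_1_iff: "finite A \<Longrightarrow> card (g ` A) \<le> 1 \<longleftrightarrow> (\<forall>s\<in>A. \<forall>t\<in>A. g s = g t)"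
  by (subst card_le_Suc0_iff_eq[unfolded One_nat_def[symmetric]]) auto

text \<open>The codimension bound gives a nonzero member supported on \<open>Suc d\<close> letters
  that include \<open>z\<close> and exclude \<open>i\<close>. It vanishes at \<open>i\<close>, so it
  is not constant and takes more than \<open>Suc d\<close> values by genericity. Only 0 and the
  values on the support are available, so no value on the support is 0, in particular not the one at
  \<open>z\<close>.\<close>

lemma generic_space_separates:
  assumes gen: "generic_space A d W" and fin: "finite A" and card: "card A \<ge> d + 2"
    and "z \<in> A" "i \<in> A" "i \<noteq> z"
  shows "\<exists>\<delta>\<in>W. \<delta> z \<noteq> \<delta> i"
proof -
  have "d \<le> card (A - {i, z})"
    using assms by (simp add: card_Diff_subset)
  then obtain D0 where D0: "D0 \<subseteq> A - {i, z}" "card D0 = d" "finite D0"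
    using obtain_subset_with_card_n by blast
  define D where "D = insert z D0"
  have D: "finite D" "card D = Suc d" "D \<subseteq> A - {i}" "z \<in> D"
    using D0 assms by (auto simp: D_def card_insert_if)
  then obtain h where h: "bij_betw h {..d} D"
    using ex_bij_betw_nat_finite[of D] by (auto simp: atLeast0LessThan lessThan_Suc_atMost)
  obtain a where a: "\<exists>k\<le>d. a k \<noteq> 0" "(\<lambda>t. \<Sum>k\<le>d. a k * (if t = h k then 1 else 0)) \<in> W"
    using generic_spaceD(2)[OF gen, of "\<lambda>k t. if t = h k then 1 else 0"] by blast
  define g where "g = (\<lambda>t. \<Sum>k\<le>d. a k * (if t = h k then 1 else (0::real)))"
  have gh: "g (h k) = a k" if "k \<le> d" for k
  proof -
    have "h k = h k' \<longleftrightarrow> k = k'" if "k' \<le> d" for k'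
      using h that \<open>k \<le> d\<close> by (auto simp: bij_betw_def inj_on_def)
    then have "g (h k) = (\<Sum>k'\<le>d. if k = k' then a k' else 0)"
      unfolding g_def by (intro sum.cong) auto
    then show ?thesis using that by simp
  qed
  have g0: "g t = 0" if "t \<notin> D" for t
    unfolding g_def using that h by (intro sum.neutral) (auto simp: bij_betw_def)
  have gi: "g i = 0" using D g0 by auto
  have img: "g ` A \<subseteq> insert 0 (a ` {..d})"
  proof
    fix x assume "x \<in> g ` A"
    then obtain t where t: "x = g t" by auto
    show "x \<in> insert 0 (a ` {..d})"
    proof (cases "t \<in> D")
      case True
      then obtain k where "k \<le> d" "t = h k" using h by (auto simp: bij_betw_def)
      then show ?thesis using t gh by auto
    qed (use t g0 in auto)
  qed
  obtain k where k: "k \<le> d" "a k \<noteq> 0" using a by auto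
  have kA: "h k \<in> A" using h k D by (auto simp: bij_betw_def)
  have "\<not> card (g ` A) \<le> 1"
    using k kA gi gh[OF k(1)] \<open>i \<in> A\<close> unfolding card_image_le_1_iff[OF fin] by metis
  then have big: "card (g ` A) > Suc d"
    using generic_spaceD(3)[OF gen] a(2) unfolding g_def by force
  obtain kz where kz: "kz \<le> d" "h kz = z" using h D by (auto simp: bij_betw_def)
  have "g z \<noteq> 0"
  proof
    assume "g z = 0"
    then have "a kz = 0" using gh kz by auto
    then have "insert 0 (a ` {..d}) = a ` {..d}" using kz by force
    then have "card (g ` A) \<le> card {..d}"
      using card_mono[OF _ img] card_image_le[of "{..d}" a] by auto
    then show False using big by simp
  qed
  moreover have "g \<in> W" using a(2) unfolding g_def .
  ultimately show ?thesis using gi by (intro bexI[of _ g]) auto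
qed

text \<open>For the codimension, the indicator of \<open>z\<close> is added to the given functions;
  a combination inside \<open>W\<close> cannot consist of this indicator alone, because that has
  just two values. Genericity survives because restoring the value at \<open>z\<close> adds at most
  one value.\<close>

lemma generic_space_project:
  assumes gen: "generic_space (insert z A) (Suc d) W" and fin: "finite A" and z: "z \<notin> A" "A \<noteq> {}"
  shows "generic_space A d (project_out z W)"
  unfolding generic_space_def
proof (intro conjI ballI allI impI)
  show "lin_closed (project_out z W)"
    unfolding lin_closed_def
  proof (intro ballI allI)
    fix g \<mu> a b assume "g \<in> project_out z W" "\<mu> \<in> project_out z W"
    then obtain c e where "g(z := c) \<in> W" "\<mu>(z := e) \<in> W" by (auto simp: project_out_def)
    then have "(\<lambda>t. a * (g(z := c)) t + b * (\<mu>(z := e)) t) \<in> W"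
      using generic_spaceD(1)[OF gen] unfolding lin_closed_def by blast
    also have "(\<lambda>t. a * (g(z := c)) t + b * (\<mu>(z := e)) t) = (\<lambda>t. a * g t + b * \<mu> t)(z := a * c + b * e)"
      by auto
    finally show "(\<lambda>t. a * g t + b * \<mu> t) \<in> project_out z W" by (rule project_outI)
  qed
next
  fix u :: "nat \<Rightarrow> 'a \<Rightarrow> real"
  define v where "v i = (if i = Suc d then (\<lambda>t. if t = z then 1 else 0) else u i)" for i
  obtain a where a: "\<exists>i\<le>Suc d. a i \<noteq> 0" "(\<lambda>t. \<Sum>i\<le>Suc d. a i * v i t) \<in> W"
    using generic_spaceD(2)[OF gen, of v] by blast
  define f where "f = (\<lambda>t. \<Sum>i\<le>Suc d. a i * v i t)"
  have f: "f t = (\<Sum>i\<le>d. a i * u i t) + (if t = z then a (Suc d) else 0)" for t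
    unfolding f_def v_def by simp
  show "\<exists>a. (\<exists>i\<le>d. a i \<noteq> 0) \<and> (\<lambda>t. \<Sum>i\<le>d. a i * u i t) \<in> project_out z W"
  proof (intro exI[of _ a] conjI)
    have "(\<lambda>t. \<Sum>i\<le>d. a i * u i t)(z := f z) = f" by (auto simp: f)
    then show "(\<lambda>t. \<Sum>i\<le>d. a i * u i t) \<in> project_out z W"
      using a(2) unfolding f_def[symmetric] by (metis project_outI)
    show "\<exists>i\<le>d. a i \<noteq> 0"
    proof (rule ccontr)
      assume "\<not> (\<exists>i\<le>d. a i \<noteq> 0)"
      then have 0: "\<And>i. i \<le> d \<Longrightarrow> a i = 0" by auto
      then have f': "f t = (if t = z then a (Suc d) else 0)" for t by (simp add: f)
      have ad: "a (Suc d) \<noteq> 0" using a(1) 0 by (metis le_Suc_eq)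
      have "f ` insert z A \<subseteq> {a (Suc d), 0}" using f' by auto
      then have "card (f ` insert z A) \<le> 2"
        using card_mono[of "{a (Suc d), 0}" "f ` insert z A"] ad by simp
      then have "card (f ` insert z A) \<le> 1"
        using generic_spaceD(3)[OF gen, of f] a(2) unfolding f_def by simp
      then show False
        using z fin f' ad by (subst (asm) card_image_le_1_iff) (auto split: if_splits)
    qed
  qed
next
  fix g assume "g \<in> project_out z W" and c: "card (g ` A) \<le> Suc d"
  then obtain c where c': "g(z := c) \<in> W" by (auto simp: project_out_def)
  have im: "(g(z := c)) ` insert z A = insert c (g ` A)" using z by auto
  have "card ((g(z := c)) ` insert z A) \<le> Suc (Suc d)"
    unfolding im using c fin by (simp add: card_insert_if)
  then have "card ((g(z := c)) ` insert z A) \<le> 1"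
    using generic_spaceD(3)[OF gen c'] by blast
  moreover have "card (g ` A) \<le> card ((g(z := c)) ` insert z A)"
    unfolding im using fin by (intro card_mono) auto
  ultimately show "card (g ` A) \<le> 1" by simp
qed

text \<open>Copying the value at \<open>i\<close> to \<open>z\<close> creates no new value, so
  \<open>d\<close> stays the same while a letter disappears.\<close>

lemma generic_space_merge:
  assumes gen: "generic_space (insert z A) d W" and z: "z \<notin> A" "i \<in> A"
  shows "generic_space A d (merge_into z i W)"
  unfolding generic_space_def
proof (intro conjI ballI allI impI)
  show "lin_closed (merge_into z i W)"
    unfolding lin_closed_def
  proof (intro ballI allI)
    fix g \<mu> a b assume "g \<in> merge_into z i W" "\<mu> \<in> merge_into z i W"
    then have "g(z := g i) \<in> W" "\<mu>(z := \<mu> i) \<in> W" by (auto simp: merge_into_def)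
    then have "(\<lambda>t. a * (g(z := g i)) t + b * (\<mu>(z := \<mu> i)) t) \<in> W"
      using generic_spaceD(1)[OF gen] unfolding lin_closed_def by blast
    also have "(\<lambda>t. a * (g(z := g i)) t + b * (\<mu>(z := \<mu> i)) t) = (\<lambda>t. a * g t + b * \<mu> t)(z := a * g i + b * \<mu> i)"
      by auto
    finally show "(\<lambda>t. a * g t + b * \<mu> t) \<in> merge_into z i W" by (simp only: merge_into_def mem_Collect_eq)
  qed
next
  fix u :: "nat \<Rightarrow> 'a \<Rightarrow> real"
  obtain a where a: "\<exists>k\<le>d. a k \<noteq> 0" "(\<lambda>t. \<Sum>k\<le>d. a k * ((u k)(z := u k i)) t) \<in> W"
    using generic_spaceD(2)[OF gen, of "\<lambda>k. (u k)(z := u k i)"] by blast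
  have "(\<lambda>t. \<Sum>k\<le>d. a k * ((u k)(z := u k i)) t) = (\<lambda>t. \<Sum>k\<le>d. a k * u k t)(z := (\<Sum>k\<le>d. a k * u k i))"
    by auto
  then show "\<exists>a. (\<exists>k\<le>d. a k \<noteq> 0) \<and> (\<lambda>t. \<Sum>k\<le>d. a k * u k t) \<in> merge_into z i W"
    using a by (auto simp: merge_into_def intro!: exI[of _ a])
next
  fix g assume "g \<in> merge_into z i W" and c: "card (g ` A) \<le> Suc d"
  then have c': "g(z := g i) \<in> W" by (auto simp: merge_into_def)
  have im: "(g(z := g i)) ` insert z A = g ` A" using z by auto
  show "card (g ` A) \<le> 1"
    using generic_spaceD(3)[OF gen c'] c unfolding im by blast
qed

lemma decr_along_inj_on: "decr_along g l \<Longrightarrow> inj_on g (set l)"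
  unfolding decr_along_nth
  by (rule inj_onI) (metis in_set_conv_nth less_irrefl linorder_neqE_nat)

lemma exists_decr_along: "distinct l \<Longrightarrow> \<exists>g. decr_along g l"
proof (induction l)
  case Nil
  then show ?case by (simp add: decr_along_def)
next
  case (Cons x l)
  then obtain g where g: "decr_along g l" by auto
  have "decr_along (g(x := Max (insert 0 (g ` set l)) + 1)) (x # l)"
  proof -
    have "decr_along (g(x := Max (insert 0 (g ` set l)) + 1)) l"
      using Cons g by (simp add: decr_along_upd)
    moreover have "g y < Max (insert 0 (g ` set l)) + 1" if "y \<in> set l" for y
    proof -
      have "g y \<le> Max (insert 0 (g ` set l))" using that by (intro Max_ge) auto
      then show ?thesis by linarith
    qed
    ultimately show ?thesis using Cons.prems by (auto simp: decr_along_def)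
  qed
  then show ?case by blast
qed

text \<open>Projecting and merging turn \<open>card_hits_insert\<close> into a(n + 1, d + 1) = a(n,
  d) + n a(n, d + 1). Both n! and \<open>2 * alt_stirling n d\<close> satisfy this recursion, so it
  remains to compare the boundary. A single letter with odd \<open>d\<close> has to be excluded
  there, since \<open>2 * alt_stirling 1 d\<close> would be 2, more than the one ordering.\<close>

theorem card_hits:
  assumes "finite A" "A \<noteq> {}" "generic_space A d W" "card A \<ge> 2 \<or> d = 0"
  shows "card (hits A W) + 2 * alt_stirling (card A) d = fact (card A)"
  using assms
proof (induction "card A" arbitrary: A d W rule: less_induct)
  case less
  note fin = less.prems(1) and ne = less.prems(2) and gen = less.prems(3)
  obtain n where n: "card A = Suc n" using fin ne by (metis card_eq_0_iff not0_implies_Suc)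
  consider "d = 0" | "d \<ge> 1" "n \<le> d" | "d \<ge> 1" "d < n" by linarith
  then show ?case
  proof cases
    case 1
    \<comment> \<open>In codimension 0 a nonzero multiple of every function lies in
      \<open>W\<close>.\<close>
    have "g \<in> W" for g
    proof -
      obtain a where a: "a 0 \<noteq> 0" "(\<lambda>t. a 0 * g t) \<in> W"
        using generic_spaceD(2)[OF gen, of "\<lambda>_. g"] 1 by auto
      then have "(\<lambda>t. (1 / a 0) * (a 0 * g t) + 0 * (a 0 * g t)) \<in> W"
        using generic_spaceD(1)[OF gen] by (intro lin_closedD[where g = "\<lambda>t. a 0 * g t"])
      then show ?thesis using a by simp
    qed
    then have "hits A W = permutations_of_set A"
      unfolding hits_def using exists_decr_along by (blast dest: permutations_of_setD)
    then show ?thesis using fin n 1 by simp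
  next
    case 2
    \<comment> \<open>A strictly decreasing member would take \<open>card A \<le> Suc d\<close>
      values, more than one, against genericity.\<close>
    have "hits A W = {}"
    proof -
      have False if l: "l \<in> permutations_of_set A" "g \<in> W" "decr_along g l" for l g
      proof -
        have "card (g ` A) = card A"
          using l decr_along_inj_on by (intro card_image) (auto dest: permutations_of_setD)
        then show False using generic_spaceD(3)[OF gen l(2)] n 2 less.prems(4) by auto
      qed
      then show ?thesis by (auto simp: hits_def)
    qed
    then show ?thesis using two_alt_stirling_eq_fact[of n d] n 2 less.prems(4) by simp
  next
    case 3
    obtain e where e: "d = Suc e" using 3 by (cases d) auto
    obtain z B where zB: "A = insert z B" "z \<notin> B" using ne by (meson ex_in_conv mk_disjoint_insert)
    have B: "finite B" "card B = n" "B \<noteq> {}" using zB fin n 3 by auto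
    have n2: "card B \<ge> 2" using 3 B by simp
    have "card (hits A W) =
        card (hits B (project_out z W)) + (\<Sum>i\<in>B. card (hits B (merge_into z i W)))"
      unfolding zB(1)
    proof (rule card_hits_insert[OF B(1) zB(2)])
      show "lin_closed W" using generic_spaceD(1)[OF gen] .
      show "\<exists>\<delta>\<in>W. \<delta> z \<noteq> \<delta> i" if "i \<in> B" for i
        using generic_space_separates[OF gen fin, of z i] 3 n zB that by auto
    qed
    moreover have "card (hits B (project_out z W)) + 2 * alt_stirling n e = fact n"
      using less.hyps[of B e "project_out z W"] B n n2 generic_space_project[of z B e W] gen zB e by auto
    moreover have "(\<Sum>i\<in>B. card (hits B (merge_into z i W))) + n * (2 * alt_stirling n d) = n * fact n"
    proof -
      have "(\<Sum>i\<in>B. card (hits B (merge_into z i W)) + 2 * alt_stirling n d) = (\<Sum>i\<in>B. fact n)"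
      proof (rule sum.cong[OF refl])
        fix i assume "i \<in> B"
        then show "card (hits B (merge_into z i W)) + 2 * alt_stirling n d = fact n"
          using less.hyps[of B d "merge_into z i W"] B n n2 generic_space_merge[of z B d W i] gen zB by auto
      qed
      then show ?thesis by (simp add: sum.distrib B)
    qed
    ultimately show ?thesis unfolding n e alt_stirling_Suc_Suc by (simp add: algebra_simps)
  qed
qed

text \<open>
  The level sets of \<open>g\<close> are numerous enough that a strictly decreasing function can be moved into \<open>W\<close> by adding
  a function that is constant on them; a small multiple of the result breaks the ties of \<open>g\<close>.
\<close>

lemma generic_space_strict:
  assumes gen: "generic_space A d W" and fin: "finite A" and l: "l \<in> permutations_of_set A"
    and g: "g \<in> W" "sorted_wrt (\<lambda>s t. g s \<ge> g t) l" and nonconst: "\<not> card (g ` A) \<le> 1"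
  shows "\<exists>\<nu>\<in>W. decr_along \<nu> l"
proof -
  have lA: "set l = A" "distinct l" using l by (auto dest: permutations_of_setD)
  obtain \<delta> where \<delta>: "decr_along \<delta> l" using exists_decr_along[OF lA(2)] by blast
  have big: "Suc d < card (g ` A)" using generic_spaceD(3)[OF gen g(1)] nonconst by force
  then obtain D where D: "D \<subseteq> g ` A" "card D = d" "finite D"
    using obtain_subset_with_card_n[of d "g ` A"] by auto
  obtain h where h: "bij_betw h {..<d} D"
    using ex_bij_betw_nat_finite[OF D(3)] D(2) by (auto simp: atLeast0LessThan)
  define u where "u k = (if k = d then \<delta> else (\<lambda>t. if g t = h k then 1 else 0))" for k
  obtain a where a: "\<exists>k\<le>d. a k \<noteq> 0" "(\<lambda>t. \<Sum>k\<le>d. a k * u k t) \<in> W"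
    using generic_spaceD(2)[OF gen, of u] by blast
  define \<phi> where "\<phi> x = (\<Sum>k<d. a k * (if x = h k then 1 else 0))" for x
  define f where "f = (\<lambda>t. \<Sum>k\<le>d. a k * u k t)"
  have fW: "f \<in> W" using a(2) by (simp add: f_def)
  have f: "f t = a d * \<delta> t + \<phi> (g t)" for t
  proof -
    have "{..d} = insert d {..<d}" by auto
    then show ?thesis unfolding f_def \<phi>_def by (simp add: u_def)
  qed
  have \<phi>0: "\<phi> x = 0" if "x \<notin> D" for x
    unfolding \<phi>_def using that h by (intro sum.neutral) (auto simp: bij_betw_def)
  have \<phi>h: "\<phi> (h k) = a k" if "k < d" for k
  proof -
    have "h k = h k' \<longleftrightarrow> k = k'" if "k' < d" for k'
      using h that \<open>k < d\<close> by (auto simp: bij_betw_def inj_on_def)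
    then have "\<phi> (h k) = (\<Sum>k'<d. if k = k' then a k' else 0)"
      unfolding \<phi>_def by (intro sum.cong) auto
    then show ?thesis using that by simp
  qed
  \<comment> \<open>Without the \<delta> term, \<open>f\<close> would be constant on the level sets
    of \<open>g\<close> with at most \<open>Suc d\<close> values, hence constant; but it is 0 off
    the chosen levels, of which there is at least one in \<open>A\<close>, and \<open>a k\<close> on
    a chosen one.\<close>
  have ad: "a d \<noteq> 0"
  proof
    assume ad: "a d = 0"
    then obtain k where k: "k < d" "a k \<noteq> 0" using a(1) by (metis order.order_iff_strict)
    have "f ` A \<subseteq> insert 0 (\<phi> ` D)" using f ad \<phi>0 by auto
    then have "card (f ` A) \<le> card (insert 0 (\<phi> ` D))" using D by (intro card_mono) auto
    also have "\<dots> \<le> Suc d" using card_image_le[OF D(3), of \<phi>] D by (simp add: card_insert_if)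
    finally have "card (f ` A) \<le> 1" using generic_spaceD(3)[OF gen fW] by blast
    then have const: "f s = f t" if "s \<in> A" "t \<in> A" for s t
      using that unfolding card_image_le_1_iff[OF fin] by blast
    have "h k \<in> g ` A" using h k D by (auto simp: bij_betw_def)
    then obtain s where s: "s \<in> A" "g s = h k" by auto
    have "\<not> g ` A \<subseteq> D"
    proof
      assume "g ` A \<subseteq> D"
      from card_mono[OF D(3) this] show False using D(2) big by simp
    qed
    then obtain t where t: "t \<in> A" "g t \<notin> D" by auto
    have "f s = a k" "f t = 0" using f ad s t \<phi>0 \<phi>h k by auto
    then show False using const[OF s(1) t(1)] k by simp
  qed
  define b where "b = (\<lambda>t. (1 / a d) * f t + 0 * f t)"
  have bW: "b \<in> W" unfolding b_def using generic_spaceD(1)[OF gen] fW fW by (rule lin_closedD)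
  have b: "b t = \<delta> t + \<phi> (g t) / a d" for t using ad by (simp add: b_def f field_simps)
  have "\<forall>\<^sub>F e in at_right (0::real). \<forall>i\<in>{..<length l}. \<forall>j\<in>{..<length l}. i < j \<longrightarrow>
     g (l ! i) + e * b (l ! i) > g (l ! j) + e * b (l ! j)"
  proof (intro eventually_ball_finite ballI finite_lessThan)
    fix i j assume *: "i \<in> {..<length l}" "j \<in> {..<length l}"
    show "\<forall>\<^sub>F e in at_right (0::real). i < j \<longrightarrow>
     g (l ! i) + e * b (l ! i) > g (l ! j) + e * b (l ! j)"
    proof (cases "i < j")
      case True
      then have ge: "g (l ! i) \<ge> g (l ! j)" using g(2) * by (auto simp: sorted_wrt_iff_nth_less)
      show ?thesis
      proof (cases "g (l ! i) = g (l ! j)")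
        case eq: True
        have "\<delta> (l ! i) > \<delta> (l ! j)" using \<delta> True * unfolding decr_along_nth by auto
        then have "b (l ! i) > b (l ! j)" using eq b by simp
        moreover have "\<forall>\<^sub>F e in at_right (0::real). e > 0" by (simp add: eventually_at_right_less)
        ultimately show ?thesis using eq by (auto elim!: eventually_mono)
      next
        case False
        then have "decr_along g [l ! i, l ! j]" using ge by (simp add: decr_along_def)
        from decr_along_perturb[OF this, of b] show ?thesis
          by eventually_elim (simp add: decr_along_def)
      qed
    qed auto
  qed
  then obtain e where "\<forall>i\<in>{..<length l}. \<forall>j\<in>{..<length l}. i < j \<longrightarrow>
     g (l ! i) + e * b (l ! i) > g (l ! j) + e * b (l ! j)"
    using eventually_happens'[OF trivial_limit_at_right_real] by blast
  then have "decr_along (\<lambda>t. 1 * g t + e * b t) l" by (auto simp: decr_along_nth)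
  moreover have "(\<lambda>t. 1 * g t + e * b t) \<in> W"
    using generic_spaceD(1)[OF gen] g(1) bW by (rule lin_closedD)
  ultimately show ?thesis by blast
qed

section \<open>Positive bridges\<close>

text \<open>Constant relations have to be allowed because the steps of a closed polygon sum to 0.
  The bound on the number of values is the one in \<open>generic_space\<close> for codimension
  \<open>DIM('e)\<close>.\<close>

definition general_position :: "'b set \<Rightarrow> ('b \<Rightarrow> 'e::euclidean_space) \<Rightarrow> bool" where
  "general_position A X \<longleftrightarrow>
     (\<forall>g. (\<Sum>t\<in>A. g t *\<^sub>R X t) = 0 \<longrightarrow> card (g ` A) \<le> Suc DIM('e) \<longrightarrow> card (g ` A) \<le> 1)"

definition positive_bridge :: "('b \<Rightarrow> real) \<Rightarrow> 'b list \<Rightarrow> bool" where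
  "positive_bridge y l \<longleftrightarrow> sum_list (map y l) = 0 \<and>
     (\<forall>k. 0 < k \<longrightarrow> k < length l \<longrightarrow> 0 < sum_list (map y (take k l)))"

text \<open>The family is indexed, so repetitions count: a repeated vector gives coefficients 1 and
  -1, and otherwise there are too many distinct vectors in \<open>S\<close> to be
  independent.\<close>

lemma exists_linear_relation:
  fixes v :: "'i \<Rightarrow> 'e::euclidean_space"
  assumes "finite I" "subspace S" "v ` I \<subseteq> S" "dim S < card I"
  shows "\<exists>a. (\<exists>i\<in>I. a i \<noteq> 0) \<and> (\<Sum>i\<in>I. a i *\<^sub>R v i) = 0"
proof (cases "inj_on v I")
  case False
  then obtain i j where ij: "i \<in> I" "j \<in> I" "i \<noteq> j" "v i = v j" by (auto simp: inj_on_def)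
  have "(\<Sum>k\<in>I. (if k = i then 1 else if k = j then -1 else 0) *\<^sub>R v k) =
        (\<Sum>k\<in>I. (if k = i then v k else 0) + (if k = j then - v k else 0))"
    using ij by (intro sum.cong) auto
  also have "\<dots> = 0"
    using ij assms(1) by (simp add: sum.distrib)
  finally show ?thesis using ij by (intro exI[of _ "\<lambda>k. if k = i then 1 else if k = j then -1 else 0"]) auto
next
  case True
  have "dependent (v ` I)"
  proof (rule ccontr)
    assume "\<not> dependent (v ` I)"
    then have "card (v ` I) \<le> dim S" using assms by (intro independent_card_le_dim) auto
    then show False using assms True by (simp add: card_image)
  qed
  then obtain u x where ux: "x \<in> v ` I" "u x \<noteq> 0" "(\<Sum>x\<in>v ` I. u x *\<^sub>R x) = 0"
    using dependent_finite[of "v ` I"] assms(1) by auto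
  then have "(\<Sum>i\<in>I. u (v i) *\<^sub>R v i) = 0" by (simp add: sum.reindex[OF True])
  then show ?thesis using ux by (intro exI[of _ "u \<circ> v"]) auto
qed

text \<open>The codimension bound is a dimension count: \<open>DIM('e) + 1\<close> coefficient
  functions are mapped to as many vectors, which are dependent.\<close>

lemma generic_space_relations:
  fixes X :: "'b \<Rightarrow> 'e::euclidean_space"
  assumes "finite A" "general_position A X"
  shows "generic_space A DIM('e) {g. (\<Sum>t\<in>A. g t *\<^sub>R X t) = 0}"
  unfolding generic_space_def
proof (intro conjI allI ballI impI)
  show "lin_closed {g. (\<Sum>t\<in>A. g t *\<^sub>R X t) = 0}"
    unfolding lin_closed_def
  proof (intro ballI allI)
    fix g \<mu> a b
    assume "g \<in> {g. (\<Sum>t\<in>A. g t *\<^sub>R X t) = 0}" "\<mu> \<in> {g. (\<Sum>t\<in>A. g t *\<^sub>R X t) = 0}"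
    moreover have "(\<Sum>t\<in>A. (a * g t + b * \<mu> t) *\<^sub>R X t) =
       a *\<^sub>R (\<Sum>t\<in>A. g t *\<^sub>R X t) + b *\<^sub>R (\<Sum>t\<in>A. \<mu> t *\<^sub>R X t)"
      by (simp add: scaleR_sum_right sum.distrib[symmetric] scaleR_add_left)
    ultimately show "(\<lambda>t. a * g t + b * \<mu> t) \<in> {g. (\<Sum>t\<in>A. g t *\<^sub>R X t) = 0}" by simp
  qed
next
  fix u :: "nat \<Rightarrow> 'b \<Rightarrow> real"
  obtain a where a: "\<exists>i\<in>{..DIM('e)}. a i \<noteq> 0" "(\<Sum>i\<le>DIM('e). a i *\<^sub>R (\<Sum>t\<in>A. u i t *\<^sub>R X t)) = 0"
    using exists_linear_relation[of "{..DIM('e)}" UNIV "\<lambda>i. \<Sum>t\<in>A. u i t *\<^sub>R X t"] by auto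
  have "(\<Sum>t\<in>A. (\<Sum>i\<le>DIM('e). a i * u i t) *\<^sub>R X t) = (\<Sum>t\<in>A. \<Sum>i\<le>DIM('e). a i *\<^sub>R u i t *\<^sub>R X t)"
    by (simp add: scaleR_sum_left)
  also have "\<dots> = (\<Sum>i\<le>DIM('e). \<Sum>t\<in>A. a i *\<^sub>R u i t *\<^sub>R X t)" by (rule sum.swap)
  also have "\<dots> = 0" using a(2) by (simp add: scaleR_sum_right)
  finally show "\<exists>a. (\<exists>i\<le>DIM('e). a i \<noteq> 0) \<and>
      (\<lambda>t. \<Sum>i\<le>DIM('e). a i * u i t) \<in> {g. (\<Sum>t\<in>A. g t *\<^sub>R X t) = 0}"
    using a(1) by (intro exI[of _ a]) auto
qed (use assms(2) in \<open>auto simp: general_position_def\<close>)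

text \<open>Abel summation: the difference of the two sides is the sum of the products of the proper
  prefix sums with the drops of \<open>g\<close>. All these products are positive, and there is one
  as soon as \<open>l\<close> has two letters.\<close>

lemma positive_prefixes_decr_along:
  assumes "l \<noteq> []" "decr_along g l" "\<And>k. 0 < k \<Longrightarrow> k < length l \<Longrightarrow> 0 < sum_list (map y (take k l))"
  shows "(\<Sum>t\<leftarrow>l. g t * y t) \<ge> g (last l) * sum_list (map y l)
    \<and> (length l \<ge> 2 \<longrightarrow> (\<Sum>t\<leftarrow>l. g t * y t) > g (last l) * sum_list (map y l))"
  using assms
proof (induction l rule: rev_nonempty_induct)
  case (single x)
  then show ?case by simp
next
  case (snoc x l)
  have Y: "sum_list (map y l) > 0" using snoc.prems(2)[of "length l"] snoc.hyps by simp
  have d: "decr_along g l" "g (last l) > g x"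
    using snoc by (auto simp: decr_along_def sorted_wrt_append)
  have "0 < sum_list (map y (take k l))" if "0 < k" "k < length l" for k
    using snoc.prems(2)[of k] that by simp
  then have "(\<Sum>t\<leftarrow>l. g t * y t) \<ge> g (last l) * sum_list (map y l)"
    using snoc.IH d by blast
  moreover have "g (last l) * sum_list (map y l) > g x * sum_list (map y l)"
    using d Y by simp
  ultimately show ?case by (simp add: algebra_simps)
qed

theorem card_positive_bridges:
  fixes X :: "'b \<Rightarrow> 'e::euclidean_space"
  assumes fin: "finite A" and card: "card A \<ge> 2" and sum0: "(\<Sum>t\<in>A. X t) = 0" and gp: "general_position A X"
  shows "card {l \<in> permutations_of_set A. \<exists>f. positive_bridge (\<lambda>t. f \<bullet> X t) l} =
    2 * alt_stirling (card A) DIM('e)"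
proof -
  let ?W = "{g. (\<Sum>t\<in>A. g t *\<^sub>R X t) = 0}"
  have gen: "generic_space A DIM('e) ?W" by (rule generic_space_relations[OF fin gp])
  have iff: "(\<exists>f. positive_bridge (\<lambda>t. f \<bullet> X t) l) \<longleftrightarrow> l \<notin> hits A ?W" if l: "l \<in> permutations_of_set A" for l
  proof -
    have lA: "set l = A" "distinct l" "length l = card A"
      using l by (auto dest: permutations_of_setD length_finite_permutations_of_set)
    have ne: "l \<noteq> []" using lA card by auto
    show ?thesis
    proof
      assume "\<exists>f. positive_bridge (\<lambda>t. f \<bullet> X t) l"
      then obtain f where f: "positive_bridge (\<lambda>t. f \<bullet> X t) l" by blast
      show "l \<notin> hits A ?W"
      proof
        assume "l \<in> hits A ?W"
        then obtain g where g: "(\<Sum>t\<in>A. g t *\<^sub>R X t) = 0" "decr_along g l" by (auto simp: hits_def)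
        have "(\<Sum>t\<leftarrow>l. g t * (f \<bullet> X t)) > g (last l) * sum_list (map (\<lambda>t. f \<bullet> X t) l)"
          using positive_prefixes_decr_along[OF ne g(2), of "\<lambda>t. f \<bullet> X t"] f lA card
          by (auto simp: positive_bridge_def)
        moreover have "(\<Sum>t\<leftarrow>l. g t * (f \<bullet> X t)) = f \<bullet> (\<Sum>t\<in>A. g t *\<^sub>R X t)"
          using lA by (simp add: sum_list_distinct_conv_sum_set inner_sum_right)
        ultimately show False using f g by (simp add: positive_bridge_def)
      qed
    next
      assume nh: "l \<notin> hits A ?W"
      \<comment> \<open>By separation, a functional that is positive on all proper prefix sums
        exists once 0 is outside their convex hull.\<close>
      define S where "S k = (\<Sum>t\<in>set (take k l). X t)" for k
      define V where "V = S ` {1..<card A}"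
      have "0 \<notin> convex hull V"
      proof
        assume "0 \<in> convex hull V"
        moreover have "finite V" by (simp add: V_def)
        ultimately obtain u where u: "\<And>v. v \<in> V \<Longrightarrow> 0 \<le> u v" "sum u V = 1" "(\<Sum>v\<in>V. u v *\<^sub>R v) = 0"
          by (auto simp: convex_hull_finite)
        \<comment> \<open>Different prefixes may have equal sums, so one length is chosen for each
          vector.\<close>
        define k where "k v = inv_into {1..<card A} S v" for v
        have k: "S (k v) = v" "0 < k v" "k v < card A" if "v \<in> V" for v
          using that inv_into_into[of v S "{1..<card A}"] f_inv_into_f[of v S "{1..<card A}"]
          by (auto simp: k_def V_def)
        \<comment> \<open>In the convex combination, the letter \<open>t\<close> gets the total
          weight of the chosen prefixes that contain it. This weight decreases weakly along
          \<open>l\<close>, from 1 at the first letter to 0 at the last.\<close>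
        define g where "g t = (\<Sum>v\<in>V. u v * indicator (set (take (k v) l)) t)" for t
        have "(\<Sum>t\<in>A. g t *\<^sub>R X t) = (\<Sum>t\<in>A. \<Sum>v\<in>V. (u v * indicator (set (take (k v) l)) t) *\<^sub>R X t)"
          by (simp add: g_def scaleR_sum_left)
        also have "\<dots> = (\<Sum>v\<in>V. \<Sum>t\<in>A. (u v * indicator (set (take (k v) l)) t) *\<^sub>R X t)"
          by (rule sum.swap)
        also have "\<dots> = (\<Sum>v\<in>V. u v *\<^sub>R S (k v))"
        proof (rule sum.cong[OF refl])
          fix v
          have "A \<inter> set (take (k v) l) = set (take (k v) l)" using lA by (auto dest: in_set_takeD)
          then have "(\<Sum>t\<in>A. indicator (set (take (k v) l)) t *\<^sub>R X t) = S (k v)"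
            unfolding S_def using fin by (simp add: indicator_scaleR_eq_if sum.inter_restrict[symmetric])
          then show "(\<Sum>t\<in>A. (u v * indicator (set (take (k v) l)) t) *\<^sub>R X t) = u v *\<^sub>R S (k v)"
            by (simp add: scaleR_sum_right[symmetric] scaleR_scaleR[symmetric] del: scaleR_scaleR)
        qed
        also have "\<dots> = 0" using u(3) k by simp
        finally have gW: "g \<in> ?W" by simp
        have dec: "sorted_wrt (\<lambda>s t. g s \<ge> g t) l"
          unfolding sorted_wrt_iff_nth_less
        proof (intro allI impI)
          fix i j assume ij: "i < j" "j < length l"
          show "g (l ! j) \<le> g (l ! i)"
            unfolding g_def
          proof (intro sum_mono mult_left_mono)
            fix v assume "v \<in> V"
            show "indicator (set (take (k v) l)) (l ! j) \<le> (indicator (set (take (k v) l)) (l ! i) :: real)"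
            proof (cases "l ! j \<in> set (take (k v) l)")
              case True
              then obtain j' where "j' < k v" "j' < length l" "l ! j = l ! j'" by (auto simp: in_set_conv_nth)
              then have "j < k v" using lA(2) ij nth_eq_iff_index_eq by metis
              then have "l ! i \<in> set (take (k v) l)" using ij
                by (auto simp: in_set_conv_nth intro!: exI[of _ i])
              then show ?thesis by simp
            qed (simp add: indicator_def)
          qed (use u in auto)
        qed
        have "g (hd l) = 1"
        proof -
          have "hd l \<in> set (take (k v) l)" if "v \<in> V" for v
            using ne k[OF that] by (cases l; cases "k v") auto
          then show ?thesis using u(2) by (simp add: g_def)
        qed
        moreover have "g (last l) = 0"
        proof -
          have "last l \<notin> set (take (k v) l)" if "v \<in> V" for v
          proof
            assume "last l \<in> set (take (k v) l)"
            then obtain j' where "j' < k v" "j' < length l" "last l = l ! j'" by (auto simp: in_set_conv_nth)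
            then have "j' = length l - 1" using lA(2) ne
              by (metis last_conv_nth diff_less length_greater_0_conv less_numeral_extra(1) nth_eq_iff_index_eq)
            then show False using k[OF that] lA \<open>j' < k v\<close> by simp
          qed
          then show ?thesis by (simp add: g_def)
        qed
        ultimately have "\<not> card (g ` A) \<le> 1"
          unfolding card_image_le_1_iff[OF fin] using ne lA(1) hd_in_set last_in_set by (metis zero_neq_one)
        then show False
          using generic_space_strict[OF gen fin l gW dec] l nh by (auto simp: hits_def)
      qed
      moreover have "finite V" by (simp add: V_def)
      ultimately obtain f b where f: "0 < b" "\<And>x. x \<in> convex hull V \<Longrightarrow> f \<bullet> x > b"
        using separating_hyperplane_closed_0[of "convex hull V"]
        by (metis convex_convex_hull finite_imp_compact_convex_hull compact_imp_closed)
      have S: "sum_list (map (\<lambda>t. f \<bullet> X t) (take k l)) = f \<bullet> S k" for k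
        using lA by (simp add: S_def sum_list_distinct_conv_sum_set inner_sum_right)
      have "positive_bridge (\<lambda>t. f \<bullet> X t) l"
        unfolding positive_bridge_def
      proof (intro conjI allI impI)
        show "sum_list (map (\<lambda>t. f \<bullet> X t) l) = 0"
          using S[of "length l"] lA sum0 by (simp add: S_def)
        fix k assume "0 < k" "k < length l"
        then have "S k \<in> convex hull V" using lA by (intro hull_inc) (auto simp: V_def)
        then show "0 < sum_list (map (\<lambda>t. f \<bullet> X t) (take k l))" using f S by fastforce
      qed
      then show "\<exists>f. positive_bridge (\<lambda>t. f \<bullet> X t) l" by blast
    qed
  qed
  have "{l \<in> permutations_of_set A. \<exists>f. positive_bridge (\<lambda>t. f \<bullet> X t) l} = permutations_of_set A - hits A ?W"
    using iff by blast
  moreover have "card (permutations_of_set A - hits A ?W) = fact (card A) - card (hits A ?W)"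
    using fin by (subst card_Diff_subset) (auto simp: hits_def)
  moreover have "card (hits A ?W) + 2 * alt_stirling (card A) DIM('e) = fact (card A)"
    by (rule card_hits[OF fin _ gen]) (use card in auto)
  ultimately show ?thesis by simp
qed

section \<open>Signs, reversal and the cycle lemma\<close>

lemma positive_bridge_scale:
  assumes "r > 0" shows "positive_bridge (\<lambda>t. r * y t) l \<longleftrightarrow> positive_bridge y l"
  using assms by (simp add: positive_bridge_def sum_list_const_mult zero_less_mult_iff)

text \<open>As the total is 0, a prefix of the reversed list sums to minus the complementary prefix
  of \<open>l\<close>.\<close>

lemma positive_bridge_rev:
  assumes "positive_bridge y l" shows "positive_bridge (\<lambda>t. - y t) (rev l)"
proof -
  have neg: "sum_list (map (\<lambda>t. - y t) xs) = - sum_list (map y xs)" for xs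
    by (induction xs) auto
  have rev: "sum_list (map y (rev xs)) = sum_list (map y xs)" for xs
    by (simp add: rev_map[symmetric])
  show ?thesis
    unfolding positive_bridge_def neg
  proof (intro conjI allI impI)
    show "- sum_list (map y (rev l)) = 0" using assms by (simp add: rev positive_bridge_def)
    fix k assume k: "0 < k" "k < length (rev l)"
    have "sum_list (map y (take (length l - k) l)) + sum_list (map y (drop (length l - k) l)) = 0"
      using assms by (simp add: positive_bridge_def sum_list_append[symmetric] map_append[symmetric] del: sum_list_append map_append)
    moreover have "0 < sum_list (map y (take (length l - k) l))"
      using assms k by (simp add: positive_bridge_def)
    ultimately show "0 < - sum_list (map y (take k (rev l)))"
      by (simp add: take_rev rev)
  qed
qed

lemma not_positive_bridge_uminus:
  assumes "length l \<ge> 2" "positive_bridge y l"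
  shows "\<not> positive_bridge (\<lambda>t. - y t) l"
proof -
  obtain x l' where "l = x # l'" "l' \<noteq> []"
    using assms(1) by (cases l; cases "tl l") auto
  then show ?thesis
    using assms(2)[unfolded positive_bridge_def, THEN conjunct2, rule_format, of 1]
    by (auto simp: positive_bridge_def intro!: exI[of _ 1])
qed

text \<open>
  The cycle lemma, obtained here from the case of dimension one and the symmetry under reversal.
\<close>

lemma card_positive_bridges_real:
  fixes y :: "'b \<Rightarrow> real"
  assumes fin: "finite B" and ne: "B \<noteq> {}" and sum0: "sum y B = 0"
    and sub: "\<And>C. C \<subset> B \<Longrightarrow> C \<noteq> {} \<Longrightarrow> sum y C \<noteq> 0"
  shows "card {l \<in> permutations_of_set B. positive_bridge y l} = fact (card B - 1)"
proof (cases "card B \<ge> 2")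
  case False
  then have "card B = 1" using fin ne by (metis One_nat_def Suc_leI card_gt_0_iff le_antisym not_less_eq_eq numeral_2_eq_2)
  then obtain b where b: "B = {b}" by (auto simp: card_1_singleton_iff)
  then have "{l \<in> permutations_of_set B. positive_bridge y l} = {[b]}"
    using sum0 by (auto simp: positive_bridge_def)
  then show ?thesis using b by simp
next
  case True
  \<comment> \<open>A relation with exactly two values singles out a nonempty proper subset on which
    \<open>y\<close> sums to 0.\<close>
  have gp: "general_position B y"
    unfolding general_position_def
  proof (intro allI impI)
    fix g assume g: "(\<Sum>t\<in>B. g t *\<^sub>R y t) = 0" and c: "card (g ` B) \<le> Suc DIM(real)"
    show "card (g ` B) \<le> 1"
    proof (rule ccontr)
      assume "\<not> card (g ` B) \<le> 1"
      then have "card (g ` B) = 2" using c by simp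
      then obtain a b where ab: "g ` B = {a, b}" "a \<noteq> b" by (auto simp: card_2_iff)
      define C where "C = {t \<in> B. g t = a}"
      have "a \<in> g ` B" "b \<in> g ` B" using ab by auto
      then obtain s r where "s \<in> B" "g s = a" "r \<in> B" "g r = b" by auto
      then have "s \<in> C" "r \<in> B" "r \<notin> C" "C \<subseteq> B" using ab(2) by (auto simp: C_def)
      then have C: "C \<subset> B" "C \<noteq> {}" by blast+
      have "(\<Sum>t\<in>B. g t * y t) = (\<Sum>t\<in>B. b * y t + (if t \<in> C then (a - b) * y t else 0))"
        using ab by (intro sum.cong) (auto simp: C_def algebra_simps)
      also have "\<dots> = b * sum y B + (a - b) * sum y C"
        using fin C by (simp add: sum.distrib sum_distrib_left sum.inter_restrict[symmetric] Int_absorb1)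
      finally show False using g sum0 sub[OF C] ab by simp
    qed
  qed
  let ?P = "{l \<in> permutations_of_set B. positive_bridge y l}"
  let ?N = "{l \<in> permutations_of_set B. positive_bridge (\<lambda>t. - y t) l}"
  \<comment> \<open>The scalar \<open>f\<close> matters through its sign only. Reversal matches
    \<open>?N\<close> with \<open>?P\<close>, so each has half of
    \<open>2 * alt_stirling (card B) 1\<close> elements.\<close>
  have "{l \<in> permutations_of_set B. \<exists>f. positive_bridge (\<lambda>t. f \<bullet> y t) l} = ?P \<union> ?N"
  proof (intro equalityI subsetI)
    fix l assume "l \<in> {l \<in> permutations_of_set B. \<exists>f. positive_bridge (\<lambda>t. f \<bullet> y t) l}"
    then obtain f where f: "l \<in> permutations_of_set B" "positive_bridge (\<lambda>t. f * y t) l" by auto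
    have "length l \<ge> 2" using True f by (simp add: length_finite_permutations_of_set)
    then have "0 < sum_list (map (\<lambda>t. f * y t) (take 1 l))" using f(2) by (simp add: positive_bridge_def)
    then have "f \<noteq> 0" by auto
    then show "l \<in> ?P \<union> ?N"
      using positive_bridge_scale[of f y l] positive_bridge_scale[of "- f" "\<lambda>t. - y t" l] f
      by (cases "f > 0") auto
  next
    fix l assume l: "l \<in> ?P \<union> ?N"
    have "positive_bridge y l \<Longrightarrow> positive_bridge (\<lambda>t. 1 * y t) l"
      "positive_bridge (\<lambda>t. - y t) l \<Longrightarrow> positive_bridge (\<lambda>t. (- 1) * y t) l" by simp_all
    then show "l \<in> {l \<in> permutations_of_set B. \<exists>f. positive_bridge (\<lambda>t. f \<bullet> y t) l}"
      using l unfolding inner_real_def by blast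
  qed
  moreover have "?P \<inter> ?N = {}"
  proof -
    have False if "l \<in> permutations_of_set B" "positive_bridge y l" "positive_bridge (\<lambda>t. - y t) l" for l
      using True that not_positive_bridge_uminus[of l y] by (simp add: length_finite_permutations_of_set)
    then show ?thesis by blast
  qed
  moreover have "card ?N = card ?P"
  proof (rule bij_betw_same_card[of rev])
    have "bij_betw rev ?N (rev ` ?N)" by (intro inj_on_imp_bij_betw) auto
    moreover have "rev ` ?N = ?P"
    proof (intro equalityI subsetI)
      fix l assume "l \<in> rev ` ?N"
      then obtain m where m: "l = rev m" "m \<in> ?N" by auto
      have "positive_bridge (\<lambda>t. - (- y t)) (rev m)" using m by (intro positive_bridge_rev) auto
      moreover have "rev m \<in> permutations_of_set B" using m by (auto simp: permutations_of_set_def)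
      ultimately show "l \<in> ?P" using m by simp
    next
      fix l assume l: "l \<in> ?P"
      then have "rev l \<in> ?N" using positive_bridge_rev by (auto simp: permutations_of_set_def)
      then show "l \<in> rev ` ?N" by (intro image_eqI[of _ _ "rev l"]) auto
    qed
    ultimately show "bij_betw rev ?N ?P" by simp
  qed
  moreover have "card {l \<in> permutations_of_set B. \<exists>f. positive_bridge (\<lambda>t. f \<bullet> y t) l} = 2 * alt_stirling (card B) (Suc 0)"
    using card_positive_bridges[OF fin True sum0 gp] by simp
  moreover have "alt_stirling (card B) (Suc 0) = fact (card B - 1)"
    using stirling_Suc_n_1[of "card B - 1"] True by simp
  ultimately show ?thesis by (simp add: card_Un_disjoint)
qed

section \<open>Bridges over the blocks of a partition\<close>

text \<open>All block sums but one are independent: a relation among them, extended by the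
  coefficient 0 on the omitted block, takes at most \<open>card K\<close> values, so it is constant
  and hence 0.\<close>

lemma card_blocks_le_dim:
  fixes X :: "'b \<Rightarrow> 'e::euclidean_space"
  assumes fin: "finite A" and gp: "general_position A X" and K: "c ` A = K" "card K \<le> Suc DIM('e)"
    and k0: "k0 \<in> K" and S: "subspace S" "\<And>k. k \<in> K - {k0} \<Longrightarrow> (\<Sum>t\<in>{t\<in>A. c t = k}. X t) \<in> S"
  shows "card K \<le> Suc (dim S)"
proof (rule ccontr)
  assume "\<not> card K \<le> Suc (dim S)"
  moreover have finK: "finite K" using fin K by auto
  ultimately have "dim S < card (K - {k0})" using k0 by simp
  then obtain a where a: "\<exists>k\<in>K - {k0}. a k \<noteq> 0" "(\<Sum>k\<in>K - {k0}. a k *\<^sub>R (\<Sum>t\<in>{t\<in>A. c t = k}. X t)) = 0"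
    using exists_linear_relation[of "K - {k0}" S "\<lambda>k. \<Sum>t\<in>{t\<in>A. c t = k}. X t"] finK S by auto
  define b where "b k = (if k = k0 then 0 else a k)" for k
  have "(\<Sum>t\<in>A. b (c t) *\<^sub>R X t) = (\<Sum>k\<in>K. \<Sum>t\<in>{t\<in>A. c t = k}. b (c t) *\<^sub>R X t)"
    using K by (subst sum.group[OF fin finK]) auto
  also have "\<dots> = (\<Sum>k\<in>K. b k *\<^sub>R (\<Sum>t\<in>{t\<in>A. c t = k}. X t))"
    by (simp add: scaleR_sum_right)
  also have "\<dots> = (\<Sum>k\<in>K - {k0}. a k *\<^sub>R (\<Sum>t\<in>{t\<in>A. c t = k}. X t))"
    using finK k0 by (subst sum.remove[of _ k0]) (auto simp: b_def)
  also have "\<dots> = 0" by (rule a(2))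
  finally have rel: "(\<Sum>t\<in>A. b (c t) *\<^sub>R X t) = 0" .
  have im: "(\<lambda>t. b (c t)) ` A = b ` K" using K by auto
  have "card ((\<lambda>t. b (c t)) ` A) \<le> Suc DIM('e)"
    unfolding im using card_image_le[OF finK, of b] K by simp
  then have "card ((\<lambda>t. b (c t)) ` A) \<le> 1"
    using gp[unfolded general_position_def, rule_format, OF rel] by blast
  then have const: "\<forall>s\<in>A. \<forall>t\<in>A. b (c s) = b (c t)" unfolding card_image_le_1_iff[OF fin] .
  obtain k where k: "k \<in> K" "k \<noteq> k0" "a k \<noteq> 0" using a(1) by auto
  have "k \<in> c ` A" "k0 \<in> c ` A" unfolding K using k k0 by auto
  then obtain s t where "s \<in> A" "k = c s" "t \<in> A" "k0 = c t" by (elim imageE) blast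
  then have "b k = b k0" using const by blast
  then show False using k by (simp add: b_def)
qed

text \<open>The block sums add up to 0, so all of them lie in the span of all but one, which is a
  hyperplane with normal \<open>f\<close>. A second independent functional, or a vanishing sum over
  a proper part of a block, would put too many block sums into a small space, against
  \<open>card_blocks_le_dim\<close>.\<close>

lemma block_functional:
  fixes X :: "'b \<Rightarrow> 'e::euclidean_space"
  assumes fin: "finite A" and gp: "general_position A X" and sum0: "(\<Sum>t\<in>A. X t) = 0"
    and J: "c ` A = J" "card J = DIM('e)"
  obtains f where "f \<noteq> 0" "\<And>i. i \<in> J \<Longrightarrow> (\<Sum>t\<in>{t\<in>A. c t = i}. f \<bullet> X t) = 0"
    "\<And>h. (\<And>i. i \<in> J \<Longrightarrow> (\<Sum>t\<in>{t\<in>A. c t = i}. h \<bullet> X t) = 0) \<Longrightarrow> \<exists>r. h = r *\<^sub>R f"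
    "\<And>i C. i \<in> J \<Longrightarrow> C \<subset> {t\<in>A. c t = i} \<Longrightarrow> C \<noteq> {} \<Longrightarrow> (\<Sum>t\<in>C. f \<bullet> X t) \<noteq> 0"
proof -
  define x where "x i = (\<Sum>t\<in>{t\<in>A. c t = i}. X t)" for i
  have finJ: "finite J" using fin J by auto
  obtain j0 where j0: "j0 \<in> J" using J by fastforce
  have "(\<Sum>i\<in>J. x i) = (\<Sum>t\<in>A. X t)"
    unfolding x_def using J by (subst sum.group[OF fin finJ]) auto
  then have xsum: "x j0 = - (\<Sum>i\<in>J - {j0}. x i)"
    using sum0 sum.remove[OF finJ j0, of x] by (simp add: eq_neg_iff_add_eq_0)
  have "dim (x ` (J - {j0})) \<le> card (J - {j0})"
    using finJ card_image_le[of "J - {j0}" x] dim_le_card'[of "x ` (J - {j0})"] by auto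
  also have "\<dots> < DIM('e)" using J j0 finJ by (simp add: card_gt_0_iff)
  finally obtain f where f: "f \<noteq> 0" "\<And>y. y \<in> span (x ` (J - {j0})) \<Longrightarrow> orthogonal f y"
    using orthogonal_to_subspace_exists by blast
  have fx': "f \<bullet> x i = 0" if "i \<in> J - {j0}" for i
    using f(2)[of "x i"] that by (auto simp: orthogonal_def intro: span_base)
  have fx: "f \<bullet> x i = 0" if "i \<in> J" for i
    using fx' xsum that by (cases "i = j0") (auto simp: inner_sum_right)
  show ?thesis
  proof (rule that[OF f(1)])
    show "(\<Sum>t\<in>{t\<in>A. c t = i}. f \<bullet> X t) = 0" if "i \<in> J" for i
      using fx[OF that] by (simp add: x_def inner_sum_right)
  next
    fix h assume h: "\<And>i. i \<in> J \<Longrightarrow> (\<Sum>t\<in>{t\<in>A. c t = i}. h \<bullet> X t) = 0"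
    show "\<exists>r. h = r *\<^sub>R f"
    proof (rule ccontr)
      assume no: "\<nexists>r. h = r *\<^sub>R f"
      have "h \<noteq> f" using no by (metis scaleR_one)
      have "h \<notin> span {f}" using no by (auto simp: span_singleton)
      then have ind: "independent {h, f}"
        using f(1) \<open>h \<noteq> f\<close> by (simp add: independent_insert)
      then have d2: "dim (span {h, f}) = 2" using ind \<open>h \<noteq> f\<close> dim_eq_card_independent[OF ind] by simp
      \<comment> \<open>Two independent functionals leave a space of dimension
        \<open>DIM('e) - 2\<close> for \<open>DIM('e) - 1\<close> block sums.\<close>
      define S where "S = {y \<in> UNIV. \<forall>z\<in>span {h, f}. orthogonal z y}"
      have dS: "dim S + 2 = DIM('e)"
        using dim_subspace_orthogonal_to_vectors[of "span {h, f}" UNIV] d2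
        by (simp add: S_def)
      have "subspace S"
        unfolding S_def using subspace_orthogonal_to_vectors[of "span {h, f}"] by simp
      have "x i \<in> S" if "i \<in> J - {j0}" for i
      proof -
        have "h \<bullet> x i = 0" "f \<bullet> x i = 0" using h[of i] fx[of i] that by (auto simp: x_def inner_sum_right)
        then have "orthogonal z (x i)" if "z \<in> span {h, f}" for z
          using that by (auto simp: orthogonal_def span_insert span_singleton inner_diff_left algebra_simps)
        then show ?thesis by (simp add: S_def)
      qed
      then have "card J \<le> Suc (dim S)"
        using card_blocks_le_dim[OF fin gp J(1) _ j0 \<open>subspace S\<close>] J(2) by (auto simp: x_def)
      then show False using dS J by simp
    qed
  next
    fix i C assume i: "i \<in> J" and C: "C \<subset> {t\<in>A. c t = i}" "C \<noteq> {}"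
    show "(\<Sum>t\<in>C. f \<bullet> X t) \<noteq> 0"
    proof
      assume fC: "(\<Sum>t\<in>C. f \<bullet> X t) = 0"
      \<comment> \<open>With \<open>C\<close> split off there are \<open>DIM('e) + 1\<close> blocks.
        Omitting the rest of block \<open>i\<close>, labelled \<open>Some i\<close>, leaves
        \<open>DIM('e)\<close> block sums in the hyperplane normal to \<open>f\<close>, one more
        than can be independent.\<close>
      define c' where "c' t = (if t \<in> C then None else Some (c t))" for t
      define K where "K = insert None (Some ` J)"
      define S where "S = {y. f \<bullet> y = 0}"
      have K: "c' ` A = K"
      proof (intro equalityI subsetI)
        fix k assume "k \<in> c' ` A" then show "k \<in> K" using J by (auto simp: K_def c'_def)
      next
        fix k assume k: "k \<in> K"
        show "k \<in> c' ` A"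
        proof (cases k)
          case None
          obtain t where "t \<in> C" using C by auto
          then show ?thesis using None C by (auto simp: c'_def intro!: image_eqI[of _ _ t])
        next
          case (Some j)
          have "\<exists>t\<in>A. c t = j \<and> t \<notin> C"
          proof (cases "j = i")
            case False
            obtain t where "t \<in> A" "c t = j" using Some k J by (auto simp: K_def)
            then show ?thesis using False C by auto
          qed (use C in auto)
          then obtain t where "t \<in> A" "c t = j" "t \<notin> C" by blast
          then show ?thesis using Some by (intro image_eqI[of _ _ t]) (auto simp: c'_def)
        qed
      qed
      have cK: "card K = Suc DIM('e)"
        using finJ J by (simp add: K_def card_image)
      have "subspace S" unfolding S_def by (rule subspace_hyperplane)
      have dS: "dim S = DIM('e) - 1" unfolding S_def by (rule dim_hyperplane[OF f(1)])
      have "(\<Sum>t\<in>{t\<in>A. c' t = k}. X t) \<in> S" if k: "k \<in> K - {Some i}" for k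
      proof (cases k)
        case None
        then have "{t\<in>A. c' t = k} = C" using C by (auto simp: c'_def)
        then show ?thesis using fC by (simp add: S_def inner_sum_right)
      next
        case (Some j)
        then have "{t\<in>A. c' t = k} = {t\<in>A. c t = j}" "j \<in> J" using k C by (auto simp: c'_def K_def)
        then show ?thesis using fx[of j] by (simp add: S_def x_def)
      qed
      then have "card K \<le> Suc (dim S)"
        using card_blocks_le_dim[OF fin gp K _ _ \<open>subspace S\<close>, of "Some i"] cK i by (auto simp: K_def)
      then show False using dS cK by simp
    qed
  qed
qed

text \<open>The blocks fix \<open>f\<close> up to a scalar, and each sign contributes the product
  given by the cycle lemma. By \<open>card A > card J\<close> some block has two letters, and its
  ordering tells the signs apart; if all blocks were single letters, both signs would give the same
  system.\<close>

lemma card_positive_bridge_systems: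
  fixes X :: "'b \<Rightarrow> 'e::euclidean_space"
  assumes fin: "finite A" and gp: "general_position A X" and sum0: "(\<Sum>t\<in>A. X t) = 0"
    and J: "c ` A = J" "card J = DIM('e)" and big: "card A > card J"
  shows "card {a \<in> (\<Pi>\<^sub>E i\<in>J. permutations_of_set {t\<in>A. c t = i}).
            \<exists>f. f \<noteq> 0 \<and> (\<forall>i\<in>J. positive_bridge (\<lambda>t. f \<bullet> X t) (a i))} =
         2 * (\<Prod>i\<in>J. fact (card {t\<in>A. c t = i} - 1))"
proof -
  define B where "B i = {t\<in>A. c t = i}" for i
  have finJ: "finite J" using fin J by auto
  have finB: "finite (B i)" for i using fin by (simp add: B_def)
  have neB: "B i \<noteq> {}" if "i \<in> J" for i using that J by (auto simp: B_def)
  obtain f where f: "f \<noteq> 0" "\<And>i. i \<in> J \<Longrightarrow> (\<Sum>t\<in>B i. f \<bullet> X t) = 0"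
    "\<And>h. (\<And>i. i \<in> J \<Longrightarrow> (\<Sum>t\<in>B i. h \<bullet> X t) = 0) \<Longrightarrow> \<exists>r. h = r *\<^sub>R f"
    "\<And>i C. i \<in> J \<Longrightarrow> C \<subset> B i \<Longrightarrow> C \<noteq> {} \<Longrightarrow> (\<Sum>t\<in>C. f \<bullet> X t) \<noteq> 0"
    using block_functional[OF fin gp sum0 J] unfolding B_def by blast
  define y where "y = (\<lambda>t. f \<bullet> X t)"
  define P where "P = (\<Pi>\<^sub>E i\<in>J. {l \<in> permutations_of_set (B i). positive_bridge y l})"
  define M where "M = (\<Pi>\<^sub>E i\<in>J. {l \<in> permutations_of_set (B i). positive_bridge (\<lambda>t. - y t) l})"
  have cP: "card P = (\<Prod>i\<in>J. fact (card (B i) - 1))"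
    unfolding P_def card_PiE[OF finJ]
    by (intro prod.cong refl card_positive_bridges_real finB neB) (use f in \<open>auto simp: y_def\<close>)
  have cM: "card M = (\<Prod>i\<in>J. fact (card (B i) - 1))"
    unfolding M_def card_PiE[OF finJ]
    by (intro prod.cong refl card_positive_bridges_real finB neB) (use f in \<open>auto simp: y_def sum_negf\<close>)
  have "\<exists>i\<in>J. card (B i) \<ge> 2"
  proof (rule ccontr)
    assume no: "\<not> (\<exists>i\<in>J. card (B i) \<ge> 2)"
    have "card A = (\<Sum>i\<in>J. card (B i))"
      using sum.group[OF fin finJ, of c "\<lambda>_. 1::nat"] J by (simp add: B_def)
    also have "\<dots> \<le> (\<Sum>i\<in>J. 1)" using no by (intro sum_mono) auto
    finally show False using big by simp
  qed
  then obtain i where i: "i \<in> J" "card (B i) \<ge> 2" by blast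
  have disj: "P \<inter> M = {}"
  proof -
    have False if "a \<in> P" "a \<in> M" for a
    proof -
      have "a i \<in> permutations_of_set (B i)" "positive_bridge y (a i)" "positive_bridge (\<lambda>t. - y t) (a i)"
        using that i(1) by (auto simp: P_def M_def PiE_iff)
      moreover have "length (a i) \<ge> 2"
        using calculation(1) i(2) by (simp add: length_finite_permutations_of_set)
      ultimately show False using not_positive_bridge_uminus by blast
    qed
    then show ?thesis by blast
  qed
  have "{a \<in> (\<Pi>\<^sub>E i\<in>J. permutations_of_set (B i)). \<exists>f. f \<noteq> 0 \<and> (\<forall>i\<in>J. positive_bridge (\<lambda>t. f \<bullet> X t) (a i))} = P \<union> M"
    (is "?L = _")
  proof (intro equalityI subsetI)
    fix a assume "a \<in> ?L"
    then obtain h where a: "a \<in> (\<Pi>\<^sub>E i\<in>J. permutations_of_set (B i))" and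
      h: "h \<noteq> 0" "\<And>i. i \<in> J \<Longrightarrow> positive_bridge (\<lambda>t. h \<bullet> X t) (a i)" by blast
    have "(\<Sum>t\<in>B i. h \<bullet> X t) = 0" if "i \<in> J" for i
    proof -
      have "set (a i) = B i" "distinct (a i)" using a that by (auto simp: PiE_iff dest: permutations_of_setD)
      then show ?thesis
        using h(2)[OF that] by (simp add: positive_bridge_def sum_list_distinct_conv_sum_set)
    qed
    then obtain r where r: "h = r *\<^sub>R f" using f(3) by blast
    then consider "r > 0" | "- r > 0" using h by force
    then show "a \<in> P \<union> M"
    proof cases
      case 1
      have "positive_bridge y (a i)" if "i \<in> J" for i
        using h(2)[OF that] positive_bridge_scale[OF 1, of y] by (simp add: r y_def)
      then have "a \<in> P" using a by (auto simp: P_def PiE_iff)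
      then show ?thesis by blast
    next
      case 2
      have "positive_bridge (\<lambda>t. - y t) (a i)" if "i \<in> J" for i
        using h(2)[OF that] positive_bridge_scale[OF 2, of "\<lambda>t. - y t"] by (simp add: r y_def)
      then have "a \<in> M" using a by (auto simp: M_def PiE_iff)
      then show ?thesis by blast
    qed
  next
    fix a assume "a \<in> P \<union> M"
    then consider "a \<in> P" | "a \<in> M" by blast
    then show "a \<in> ?L"
    proof cases
      case 1
      then have "\<forall>i\<in>J. positive_bridge (\<lambda>t. f \<bullet> X t) (a i)"
        by (auto simp: P_def PiE_iff y_def)
      then have "\<exists>f. f \<noteq> 0 \<and> (\<forall>i\<in>J. positive_bridge (\<lambda>t. f \<bullet> X t) (a i))" using f(1) by blast
      then show ?thesis using 1 by (auto simp: P_def PiE_iff)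
    next
      case 2
      then have "\<forall>i\<in>J. positive_bridge (\<lambda>t. (- f) \<bullet> X t) (a i)"
        by (auto simp: M_def PiE_iff y_def)
      moreover have "- f \<noteq> 0" using f(1) by simp
      ultimately have "\<exists>f. f \<noteq> 0 \<and> (\<forall>i\<in>J. positive_bridge (\<lambda>t. f \<bullet> X t) (a i))" by blast
      then show ?thesis using 2 by (auto simp: M_def PiE_iff)
    qed
  qed
  moreover have "card (P \<union> M) = card P + card M"
    by (intro card_Un_disjoint disj) (auto simp: P_def M_def intro!: finite_PiE finJ)
  ultimately show ?thesis using cP cM unfolding B_def by simp
qed

text \<open>These are the partitions of \<open>{0..n}\<close> into blocks labelled by
  \<open>insert 0 J\<close>, with the label 0 reserved for the block of the letter 0.\<close>

definition labellings :: "nat \<Rightarrow> nat set \<Rightarrow> (nat \<Rightarrow> nat) set" where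
  "labellings n J = {c \<in> {0..n} \<rightarrow>\<^sub>E insert 0 J. c 0 = 0 \<and> J \<subseteq> c ` {0..n}}"

lemma finite_labellings: "finite J \<Longrightarrow> finite (labellings n J)"
  unfolding labellings_def by (rule finite_subset[OF _ finite_PiE[of "{0..n}" "\<lambda>_. insert 0 J"]]) auto

text \<open>The letter \<open>Suc n\<close> either joins a block that exists already or is alone
  under its label.\<close>

lemma labellings_Suc:
  assumes "0 \<notin> J"
  shows "labellings (Suc n) J =
    (\<lambda>(c, i). c(Suc n := i)) ` (labellings n J \<times> insert 0 J) \<union>
    (\<lambda>(i, c). c(Suc n := i)) ` (SIGMA i:J. labellings n (J - {i}))"
proof (intro equalityI subsetI)
  fix c assume c: "c \<in> labellings (Suc n) J"
  define i where "i = c (Suc n)"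
  define c' where "c' = c(Suc n := undefined)"
  have cc: "c = c'(Suc n := i)" by (simp add: c'_def i_def)
  have i: "i \<in> insert 0 J" using c by (auto simp: labellings_def PiE_iff i_def)
  have c'E: "c' \<in> {0..n} \<rightarrow>\<^sub>E insert 0 J" "c' 0 = 0"
    using c by (auto simp: labellings_def PiE_iff c'_def extensional_def)
  have im: "c ` {0..Suc n} = insert i (c' ` {0..n})"
    unfolding cc by (auto simp: atLeastAtMostSuc_conv)
  show "c \<in> (\<lambda>(c, i). c(Suc n := i)) ` (labellings n J \<times> insert 0 J) \<union>
    (\<lambda>(i, c). c(Suc n := i)) ` (SIGMA i:J. labellings n (J - {i}))"
  proof (cases "J \<subseteq> c' ` {0..n}")
    case True
    then have "(c', i) \<in> labellings n J \<times> insert 0 J" using c'E i by (auto simp: labellings_def)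
    then have "c \<in> (\<lambda>(c, i). c(Suc n := i)) ` (labellings n J \<times> insert 0 J)"
      using cc by (intro image_eqI[of _ _ "(c', i)"]) auto
    then show ?thesis by blast
  next
    case False
    have "J \<subseteq> insert i (c' ` {0..n})" using c im by (auto simp: labellings_def)
    then have iJ: "i \<in> J" "i \<notin> c' ` {0..n}" "J - {i} \<subseteq> c' ` {0..n}" using False by blast+
    have "c' \<in> {0..n} \<rightarrow>\<^sub>E insert 0 (J - {i})"
      using c'E iJ by (auto simp: PiE_iff)
    then have "(i, c') \<in> (SIGMA i:J. labellings n (J - {i}))"
      using c'E iJ by (auto simp: labellings_def)
    then have "c \<in> (\<lambda>(i, c). c(Suc n := i)) ` (SIGMA i:J. labellings n (J - {i}))"
      using cc by (intro image_eqI[of _ _ "(i, c')"]) auto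
    then show ?thesis by blast
  qed
next
  fix c assume "c \<in> (\<lambda>(c, i). c(Suc n := i)) ` (labellings n J \<times> insert 0 J) \<union>
    (\<lambda>(i, c). c(Suc n := i)) ` (SIGMA i:J. labellings n (J - {i}))"
  then obtain c' i where cc: "c = c'(Suc n := i)" "i \<in> insert 0 J" and
    c': "c' \<in> labellings n J \<or> c' \<in> labellings n (J - {i})" by auto
  have c'E: "c' \<in> {0..n} \<rightarrow>\<^sub>E insert 0 J" "c' 0 = 0" "J - {i} \<subseteq> c' ` {0..n}"
    using c' by (auto simp: labellings_def PiE_iff)
  then have "J \<subseteq> insert i (c' ` {0..n})" by auto
  also have "insert i (c' ` {0..n}) = c ` {0..Suc n}"
    unfolding cc by (auto simp: atLeastAtMostSuc_conv)
  finally show "c \<in> labellings (Suc n) J"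
    using c'E cc by (auto simp: labellings_def PiE_iff extensional_def)
qed

text \<open>A block of size b has (b - 1)! cyclic orders, so the sum counts permutations of
  \<open>Suc n\<close> letters with \<open>Suc (card J)\<close> cycles in which the cycles avoiding
  0 are labelled by \<open>J\<close>.\<close>

lemma sum_labellings:
  assumes "finite J" "0 \<notin> J"
  shows "(\<Sum>c\<in>labellings n J. \<Prod>i\<in>insert 0 J. fact (card {t\<in>{0..n}. c t = i} - 1)) =
    fact (card J) * stirling (Suc n) (Suc (card J))"
  using assms
proof (induction n arbitrary: J)
  case 0
  show ?case
  proof (cases "J = {}")
    case True
    have "labellings 0 J = {\<lambda>t. if t = 0 then 0 else undefined}"
      using True by (auto simp: labellings_def PiE_iff extensional_def)
    moreover have "{t. t = 0 \<and> (if t = 0 then 0 else undefined) = (0::nat)} = {0::nat}" by auto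
    ultimately show ?thesis using True by simp
  next
    case False
    have "labellings 0 J = {}"
    proof -
      have False if "c \<in> labellings 0 J" for c
        using that False 0 by (auto simp: labellings_def)
      then show ?thesis by blast
    qed
    then show ?thesis using False 0 by (simp add: card_gt_0_iff)
  qed
next
  case (Suc n)
  define W where "W n J c = (\<Prod>i\<in>insert 0 J. fact (card {t\<in>{0..n}. c t = i} - 1) :: nat)"
    for n J and c :: "nat \<Rightarrow> nat"
  let ?A = "labellings n J \<times> insert 0 J" and ?B = "SIGMA i:J. labellings n (J - {i})"
  let ?F = "\<lambda>(c, i). c(Suc n := i)" and ?G = "\<lambda>(i, c). c(Suc n := i)"
  have undef: "c (Suc n) = undefined" if "c \<in> labellings n K" for c K
    using that by (auto simp: labellings_def PiE_iff extensional_def)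
  have upd: "c(Suc n := i) = c'(Suc n := i') \<longleftrightarrow> c = c' \<and> i = i'"
    if "c \<in> labellings n K" "c' \<in> labellings n K'" for c c' i i' K K'
    using undef[OF that(1)] undef[OF that(2)] by (metis fun_upd_same fun_upd_triv fun_upd_upd)
  have injF: "inj_on ?F ?A" by (intro inj_onI) (auto simp: upd)
  have injG: "inj_on ?G ?B" by (intro inj_onI) (auto simp: upd)
  have fins: "finite ?A" "finite ?B" using Suc.prems by (auto intro: finite_labellings)
  have disj: "?F ` ?A \<inter> ?G ` ?B = {}"
  proof -
    have False if "c \<in> labellings n J" "i \<in> J" "c' \<in> labellings n (J - {i})" "c(Suc n := j) = c'(Suc n := i)" for c c' i j
    proof -
      have "c = c'" using upd[OF that(1,3)] that(4) by blast
      moreover have "i \<in> c ` {0..n}" using that(1,2) unfolding labellings_def by blast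
      moreover have "c' ` {0..n} \<subseteq> insert 0 (J - {i})"
      proof -
        have "c' \<in> {0..n} \<rightarrow>\<^sub>E insert 0 (J - {i})" using that(3) by (simp add: labellings_def)
        then show ?thesis by (intro image_subsetI) (rule PiE_mem)
      qed
      ultimately have "i \<in> insert 0 (J - {i})" by (simp only: subset_iff)
      then show False using that(2) Suc.prems(2) by auto
    qed
    note no = this
    show ?thesis
    proof (rule equals0I)
      fix x assume x: "x \<in> ?F ` ?A \<inter> ?G ` ?B"
      then obtain p where p: "p \<in> ?A" "x = ?F p" by blast
      obtain q where q: "q \<in> ?B" "x = ?G q" using x by blast
      have "fst p \<in> labellings n J" "fst q \<in> J" "snd q \<in> labellings n (J - {fst q})"
        using p(1) q(1) by (auto simp only: mem_Sigma_iff split_beta fst_conv snd_conv elim!: SigmaE)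
      moreover have "(fst p)(Suc n := snd p) = (snd q)(Suc n := fst q)"
        using p(2) q(2) by (simp only: split_beta)
      ultimately show False by (rule no)
    qed
  qed
  have block: "{t\<in>{0..Suc n}. (c(Suc n := i)) t = j} =
      (if j = i then insert (Suc n) {t\<in>{0..n}. c t = j} else {t\<in>{0..n}. c t = j})" for c :: "nat \<Rightarrow> nat" and i j
    by auto
  \<comment> \<open>A block of size b that receives a letter turns its factor (b - 1)! into b!, and
    the multipliers b add up to \<open>Suc n\<close> over the blocks.\<close>
  have WF: "W (Suc n) J (c(Suc n := i)) = card {t\<in>{0..n}. c t = i} * W n J c"
    if c: "c \<in> labellings n J" and i: "i \<in> insert 0 J" for c i
  proof -
    have fJ: "finite (insert 0 J)" using Suc.prems by simp
    have c0: "c 0 = 0" "J \<subseteq> c ` {0..n}" using c by (simp_all add: labellings_def)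
    then have "0 \<in> c ` {0..n}" by (intro image_eqI[of _ _ 0]) auto
    then have "i \<in> c ` {0..n}" using c0 i by blast
    then have "{t\<in>{0..n}. c t = i} \<noteq> {}" by blast
    then have pos: "card {t\<in>{0..n}. c t = i} > 0" by (simp add: card_gt_0_iff)
    have "W (Suc n) J (c(Suc n := i)) = fact (card {t\<in>{0..n}. c t = i}) *
       (\<Prod>j\<in>insert 0 J - {i}. fact (card {t\<in>{0..n}. c t = j} - 1))"
      unfolding W_def block by (subst prod.remove[OF fJ i]) (auto intro!: prod.cong)
    also have "fact (card {t\<in>{0..n}. c t = i}) =
       card {t\<in>{0..n}. c t = i} * (fact (card {t\<in>{0..n}. c t = i} - 1) :: nat)"
      using pos by (simp add: fact_reduce)
    also have "card {t\<in>{0..n}. c t = i} * fact (card {t\<in>{0..n}. c t = i} - 1) *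
       (\<Prod>j\<in>insert 0 J - {i}. fact (card {t\<in>{0..n}. c t = j} - 1)) = card {t\<in>{0..n}. c t = i} * W n J c"
      unfolding W_def by (subst prod.remove[OF fJ i]) (simp add: mult.assoc)
    finally show ?thesis .
  qed
  \<comment> \<open>The new singleton has factor 0!. Summing over its label later turns the
    factorial of \<open>card J - 1\<close> into that of \<open>card J\<close>.\<close>
  have WG: "W (Suc n) J (c(Suc n := i)) = W n (J - {i}) c"
    if i: "i \<in> J" and c: "c \<in> labellings n (J - {i})" for c i
  proof -
    have fJ: "finite (insert 0 J)" using Suc.prems by simp
    have "c \<in> {0..n} \<rightarrow>\<^sub>E insert 0 (J - {i})" using c by (simp add: labellings_def)
    then have "c t \<noteq> i" if "t \<in> {0..n}" for t
      using PiE_mem[OF _ that] i Suc.prems(2) by (metis DiffE insertE singletonI)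
    then have "{t\<in>{0..n}. c t = i} = {}" by blast
    then have one: "card (insert (Suc n) {t\<in>{0..n}. c t = i}) = 1" by (simp only:) simp
    have "i \<in> insert 0 J" using i by simp
    then have "W (Suc n) J (c(Suc n := i)) = fact (card (insert (Suc n) {t\<in>{0..n}. c t = i}) - 1) *
        (\<Prod>j\<in>insert 0 J - {i}. fact (card {t\<in>{0..n}. c t = j} - 1))"
      unfolding W_def block by (subst prod.remove[OF fJ]) (auto intro!: prod.cong)
    then have "W (Suc n) J (c(Suc n := i)) = (\<Prod>j\<in>insert 0 J - {i}. fact (card {t\<in>{0..n}. c t = j} - 1))"
      unfolding one by simp
    also have "insert 0 J - {i} = insert 0 (J - {i})" using i Suc.prems by auto
    finally show ?thesis by (simp add: W_def)
  qed
  have "(\<Sum>c\<in>labellings (Suc n) J. W (Suc n) J c) =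
     (\<Sum>c\<in>?F ` ?A. W (Suc n) J c) + (\<Sum>c\<in>?G ` ?B. W (Suc n) J c)"
    unfolding labellings_Suc[OF Suc.prems(2)] using fins disj by (intro sum.union_disjoint) auto
  also have "(\<Sum>c\<in>?F ` ?A. W (Suc n) J c) = (\<Sum>(c, i)\<in>?A. card {t\<in>{0..n}. c t = i} * W n J c)"
    by (subst sum.reindex[OF injF]) (auto intro!: sum.cong simp: WF)
  also have "\<dots> = (\<Sum>c\<in>labellings n J. \<Sum>i\<in>insert 0 J. card {t\<in>{0..n}. c t = i} * W n J c)"
    by (rule sum.cartesian_product[symmetric])
  also have "\<dots> = (\<Sum>c\<in>labellings n J. Suc n * W n J c)"
  proof (rule sum.cong[OF refl])
    fix c assume c: "c \<in> labellings n J"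
    then have "c \<in> {0..n} \<rightarrow>\<^sub>E insert 0 J" by (simp add: labellings_def)
    then have "c ` {0..n} \<subseteq> insert 0 J" by (intro image_subsetI) (rule PiE_mem)
    then have "(\<Sum>i\<in>insert 0 J. card {t\<in>{0..n}. c t = i}) = card {0..n}"
      using sum.group[of "{0..n}" "insert 0 J" c "\<lambda>_. 1::nat"] Suc.prems(1) by simp
    then show "(\<Sum>i\<in>insert 0 J. card {t\<in>{0..n}. c t = i} * W n J c) = Suc n * W n J c"
      by (simp only: sum_distrib_right[symmetric] card_atLeastAtMost) simp
  qed
  also have "\<dots> = Suc n * (fact (card J) * stirling (Suc n) (Suc (card J)))"
    unfolding sum_distrib_left[symmetric] W_def using Suc.IH[OF Suc.prems] by simp
  also have "(\<Sum>c\<in>?G ` ?B. W (Suc n) J c) = (\<Sum>(i, c)\<in>?B. W n (J - {i}) c)"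
    by (subst sum.reindex[OF injG]) (auto intro!: sum.cong simp: WG)
  also have "\<dots> = (\<Sum>i\<in>J. \<Sum>c\<in>labellings n (J - {i}). W n (J - {i}) c)"
    using Suc.prems by (subst sum.Sigma) (auto intro: finite_labellings)
  also have "\<dots> = (\<Sum>i\<in>J. fact (card J - 1) * stirling (Suc n) (card J))"
  proof (rule sum.cong[OF refl])
    fix i assume i: "i \<in> J"
    then have "card J > 0" using Suc.prems by (auto simp: card_gt_0_iff)
    then show "(\<Sum>c\<in>labellings n (J - {i}). W n (J - {i}) c) = fact (card J - 1) * stirling (Suc n) (card J)"
      unfolding W_def using Suc.IH[of "J - {i}"] Suc.prems i by simp
  qed
  also have "\<dots> = fact (card J) * stirling (Suc n) (card J)"
  proof (cases "card J")
    case 0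
    then show ?thesis using Suc.prems(1) by simp
  next
    case (Suc m)
    then show ?thesis by (simp del: stirling.simps add: algebra_simps)
  qed
  finally show ?case unfolding W_def by (simp add: algebra_simps)
qed

section \<open>Cutting a cyclic word into arcs\<close>

definition walk :: "('b \<Rightarrow> 'e::comm_monoid_add) \<Rightarrow> 'b list \<Rightarrow> nat \<Rightarrow> 'e" where
  "walk X w k = sum_list (map X (take k w))"

text \<open>A supporting hyperplane with normal \<open>f\<close> touches the points exactly at
  \<open>I\<close>. Requiring \<open>f \<noteq> 0\<close> keeps the zero functional from exposing
  the whole index set.\<close>

definition exposed_indices :: "(nat \<Rightarrow> 'e::euclidean_space) \<Rightarrow> nat \<Rightarrow> nat set \<Rightarrow> bool" where
  "exposed_indices P n I \<longleftrightarrow> (\<exists>f. f \<noteq> 0 \<and> (\<forall>i\<in>I. \<forall>j\<in>{0..n}.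
     (j \<in> I \<longrightarrow> f \<bullet> P j = f \<bullet> P i) \<and> (j \<notin> I \<longrightarrow> f \<bullet> P i < f \<bullet> P j)))"

definition cut_words :: "nat \<Rightarrow> nat \<Rightarrow> (nat list \<times> nat set) set" where
  "cut_words n q = {(w, I). w \<in> permutations_of_set {1..n} \<and> I \<subseteq> {0..n} \<and> card I = Suc q}"

text \<open>
  Arc \<open>0\<close> runs from the last cut through the letter \<open>0\<close>, which closes the path, to the first cut.
\<close>

definition arcs :: "nat \<Rightarrow> nat list \<times> nat set \<Rightarrow> nat \<Rightarrow> nat list" where
  "arcs q = (\<lambda>(w, I). let e = (!) (sorted_list_of_set I) in
     restrict (\<lambda>k. if k = 0 then drop (e q) w @ 0 # take (e 0) w
                    else drop (e (k - 1)) (take (e k) w)) {0..q})"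

definition arc_systems :: "nat \<Rightarrow> nat \<Rightarrow> (nat \<Rightarrow> nat list) set" where
  "arc_systems n q = (\<Union>c\<in>labellings n {1..q}. \<Pi>\<^sub>E i\<in>{0..q}. permutations_of_set {t\<in>{0..n}. c t = i})"

text \<open>Arc \<open>0\<close> is cut at the letter 0: the part \<open>v\<close> before it ends
  the word, and the part \<open>u\<close> after it begins the word. The cuts are the lengths of the
  prefixes that end with arc \<open>k\<close>.\<close>

definition unarcs :: "nat \<Rightarrow> (nat \<Rightarrow> nat list) \<Rightarrow> nat list \<times> nat set" where
  "unarcs q a = (let v = takeWhile (\<lambda>t. t \<noteq> 0) (a 0); u = tl (dropWhile (\<lambda>t. t \<noteq> 0) (a 0));
      pre = (\<lambda>k. u @ concat (map a [1..<Suc k]))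
    in (pre q @ v, (\<lambda>k. length (pre k)) ` {0..q}))"

text \<open>This eliminates the labelling, which can be recovered: the label of a letter is the
  index of the arc that contains it.\<close>

lemma arc_systems_iff:
  "a \<in> arc_systems n q \<longleftrightarrow> a \<in> extensional {0..q} \<and> distinct (concat (map a [0..<Suc q])) \<and>
     set (concat (map a [0..<Suc q])) = {0..n} \<and> 0 \<in> set (a 0) \<and> (\<forall>i\<in>{0..q}. a i \<noteq> [])"
    (is "_ \<longleftrightarrow> ?R")
proof
  assume "a \<in> arc_systems n q"
  then obtain c where c: "c \<in> labellings n {1..q}"
    and a: "a \<in> (\<Pi>\<^sub>E i\<in>{0..q}. permutations_of_set {t\<in>{0..n}. c t = i})"
    unfolding arc_systems_def by blast
  have ai: "set (a i) = {t\<in>{0..n}. c t = i}" "distinct (a i)" if "i \<in> {0..q}" for i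
    using PiE_mem[OF a that] by (auto dest: permutations_of_setD)
  have J: "insert 0 {1..q} = {0..q}" by auto
  have cE: "c \<in> {0..n} \<rightarrow>\<^sub>E {0..q}" "c 0 = 0" "{1..q} \<subseteq> c ` {0..n}"
    using c unfolding labellings_def J by auto
  have "0 \<in> c ` {0..n}" using cE(2) by (intro image_eqI[of _ _ 0]) auto
  then have surj: "i \<in> c ` {0..n}" if "i \<in> {0..q}" for i using that cE(3) by (cases "i = 0") auto
  show ?R
  proof (intro conjI ballI)
    show "a \<in> extensional {0..q}" using a by (simp add: PiE_def)
    show "distinct (concat (map a [0..<Suc q]))"
    proof (subst distinct_concat_iff, intro conjI allI impI)
      have "inj_on a {i\<in>set [0..<Suc q]. a i \<noteq> []}"
      proof (rule inj_onI)
        fix i j assume *: "i \<in> {i\<in>set [0..<Suc q]. a i \<noteq> []}" "j \<in> {i\<in>set [0..<Suc q]. a i \<noteq> []}" "a i = a j"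
        then have "hd (a i) \<in> set (a i)" "hd (a i) \<in> set (a j)" "i \<in> {0..q}" "j \<in> {0..q}" by auto
        then show "i = j" using ai(1) by auto
      qed
      moreover have "removeAll [] (map a [0..<Suc q]) = map a (filter (\<lambda>i. a i \<noteq> []) [0..<Suc q])"
        by (induction q) auto
      ultimately show "distinct (removeAll [] (map a [0..<Suc q]))"
        by (simp add: distinct_map del: upt_Suc)
    next
      fix ys assume "ys \<in> set (map a [0..<Suc q])"
      then obtain i where "i \<in> {0..q}" "ys = a i" by (auto simp: less_Suc_eq_le simp del: upt_Suc)
      then show "distinct ys" using ai by simp
    next
      fix ys zs assume "ys \<in> set (map a [0..<Suc q]) \<and> zs \<in> set (map a [0..<Suc q]) \<and> ys \<noteq> zs"
      then obtain i j where ij: "i \<in> {0..q}" "ys = a i" "j \<in> {0..q}" "zs = a j" "a i \<noteq> a j"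
        by (auto simp: less_Suc_eq_le simp del: upt_Suc)
      then have "i \<noteq> j" by auto
      then show "set ys \<inter> set zs = {}" using ai(1)[OF ij(1)] ai(1)[OF ij(3)] ij by auto
    qed
    have "set (concat (map a [0..<Suc q])) = (\<Union>i\<in>{0..q}. {t\<in>{0..n}. c t = i})"
      using ai by (auto simp del: upt_Suc)
    also have "\<dots> = {0..n}" using PiE_mem[OF cE(1)] by auto
    finally show "set (concat (map a [0..<Suc q])) = {0..n}" .
    show "0 \<in> set (a 0)" using ai(1)[of 0] cE(2) by simp
    show "a i \<noteq> []" if i: "i \<in> {0..q}" for i
    proof -
      obtain t where "t \<in> {0..n}" "c t = i" using surj[OF i] by (elim imageE) auto
      then have "t \<in> set (a i)" using ai(1)[OF i] by simp
      then show ?thesis by auto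
    qed
  qed
next
  assume R: ?R
  define c where "c = restrict (\<lambda>t. THE i. i \<in> {0..q} \<and> t \<in> set (a i)) {0..n}"
  have dj: "i = j" if ij: "i \<in> {0..q}" "j \<in> {0..q}" and t: "t \<in> set (a i)" "t \<in> set (a j)" for i j t
  proof -
    have False if "i < j" "i \<le> q" "j \<le> q" "t \<in> set (a i)" "t \<in> set (a j)" for i j
    proof -
      have "[0..<Suc q] = [0..<j] @ [j..<Suc q]"
        using upt_add_eq_append[of 0 j "Suc q - j"] that by simp
      then have "distinct (concat (map a [0..<j]) @ concat (map a [j..<Suc q]))"
        using R by (simp del: upt_Suc)
      moreover have "t \<in> set (concat (map a [0..<j]))" "t \<in> set (concat (map a [j..<Suc q]))"
        using that by (auto simp del: upt_Suc)
      ultimately show False unfolding distinct_append by blast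
    qed
    then show ?thesis using ij t by (metis atLeastAtMost_iff linorder_neqE_nat)
  qed
  have cov: "\<exists>i\<in>{0..q}. t \<in> set (a i)" if "t \<in> {0..n}" for t
  proof -
    have "t \<in> set (concat (map a [0..<Suc q]))" using R that by simp
    then show ?thesis by (auto simp del: upt_Suc)
  qed
  have ct: "c t = i \<longleftrightarrow> t \<in> set (a i)" if "t \<in> {0..n}" "i \<in> {0..q}" for t i
  proof -
    obtain j where j: "j \<in> {0..q}" "t \<in> set (a j)" using cov[OF \<open>t \<in> {0..n}\<close>] by blast
    have "(THE i. i \<in> {0..q} \<and> t \<in> set (a i)) = j"
    proof (rule the_equality)
      show "j \<in> {0..q} \<and> t \<in> set (a j)" using j by simp
      show "i = j" if "i \<in> {0..q} \<and> t \<in> set (a i)" for i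
        using dj[of i j t] that j by blast
    qed
    then have "c t = j" using that(1) unfolding c_def by (simp only: restrict_apply if_True)
    then show ?thesis using j dj[OF that(2) j(1) _ j(2)] by metis
  qed
  have sub: "set (a i) \<subseteq> {0..n}" if "i \<in> {0..q}" for i
  proof -
    have "i \<in> set [0..<Suc q]" using that by (simp add: less_Suc_eq_le del: upt_Suc)
    then have "set (a i) \<subseteq> set (concat (map a [0..<Suc q]))" unfolding set_concat set_map by blast
    then show ?thesis using R by simp
  qed
  have dist: "distinct (a i)" if "i \<in> {0..q}" for i
  proof -
    have "i \<in> set [0..<Suc q]" using that by (simp add: less_Suc_eq_le del: upt_Suc)
    then have "a i \<in> set (map a [0..<Suc q])" unfolding set_map by (rule imageI)
    then show ?thesis using R by (auto simp: distinct_concat_iff simp del: upt_Suc)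
  qed
  have "c \<in> labellings n {1..q}"
    unfolding labellings_def
  proof (intro CollectI conjI PiE_I subsetI)
    fix t assume "t \<in> {0..n}"
    then show "c t \<in> insert 0 {1..q}" using cov[of t] ct[of t] by force
  next
    show "c t = undefined" if "t \<notin> {0..n}" for t using that by (auto simp: c_def)
    show "c 0 = 0" using ct[of 0 0] R by simp
    fix i assume i: "i \<in> {1..q}"
    then have "hd (a i) \<in> set (a i)" using R by auto
    then show "i \<in> c ` {0..n}" using ct[of "hd (a i)" i] sub[of i] i by force
  qed
  moreover have "a \<in> (\<Pi>\<^sub>E i\<in>{0..q}. permutations_of_set {t\<in>{0..n}. c t = i})"
  proof (rule PiE_I)
    fix i assume i: "i \<in> {0..q}"
    have "set (a i) = {t\<in>{0..n}. c t = i}" using ct[OF _ i] sub[OF i] by blast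
    then show "a i \<in> permutations_of_set {t\<in>{0..n}. c t = i}" using dist[OF i] by (rule permutations_of_setI)
  next
    show "a i = undefined" if "i \<notin> {0..q}" for i using R that by (auto simp: extensional_def)
  qed
  ultimately show "a \<in> arc_systems n q" unfolding arc_systems_def by blast
qed

lemma concat_slices:
  fixes e :: "nat \<Rightarrow> nat"
  assumes "\<And>k. k < q \<Longrightarrow> e k \<le> e (Suc k)"
  shows "take (e 0) w @ concat (map (\<lambda>k. drop (e (k - 1)) (take (e k) w)) [1..<Suc q]) = take (e q) w"
  using assms
proof (induction q)
  case (Suc q)
  have "take (e (Suc q)) w = take (e q) w @ drop (e q) (take (e (Suc q)) w)"
    using Suc.prems[of q] by (metis append_take_drop_id lessI min.absorb1 take_take)
  moreover have "take (e 0) w @ concat (map (\<lambda>k. drop (e (k - 1)) (take (e k) w)) [1..<Suc q]) = take (e q) w"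
    by (rule Suc.IH) (use Suc.prems in auto)
  moreover have "[1..<Suc (Suc q)] = [1..<Suc q] @ [Suc q]" by simp
  ultimately show ?case by (simp del: upt_Suc add: append_assoc[symmetric] del: append_assoc)
qed simp

lemma cut_words_enumeration:
  assumes "(w, I) \<in> cut_words n q"
  defines "e \<equiv> (!) (sorted_list_of_set I)"
  shows "I = e ` {0..q}" "\<And>i j. i < j \<Longrightarrow> j \<le> q \<Longrightarrow> e i < e j" "\<And>k. k \<le> q \<Longrightarrow> e k \<le> n"
    "length w = n" "set w = {1..n}" "distinct w"
proof -
  have I: "I \<subseteq> {0..n}" "card I = Suc q" and w: "w \<in> permutations_of_set {1..n}"
    using assms(1) by (auto simp: cut_words_def)
  have fin: "finite I" using I finite_subset by blast
  have len: "length (sorted_list_of_set I) = Suc q" using I by simp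
  have "set (sorted_list_of_set I) = e ` {0..q}"
    unfolding e_def set_conv_nth len by auto
  then show Ie: "I = e ` {0..q}" using fin by simp
  show "e i < e j" if "i < j" "j \<le> q" for i j
    using strict_sorted_list_of_set[of I] that len unfolding e_def
    by (intro sorted_wrt_nth_less[of "(<)"]) auto
  show "e k \<le> n" if "k \<le> q" for k
  proof -
    have "e k \<in> I" unfolding Ie using that by simp
    then show ?thesis using I by auto
  qed
  show "length w = n" "set w = {1..n}" "distinct w"
    using w length_finite_permutations_of_set[OF w] by (auto dest: permutations_of_setD)
qed

lemma bij_betw_arcs: "bij_betw (arcs q) (cut_words n q) (arc_systems n q)"
proof (rule bij_betw_byWitness[where f' = "unarcs q"])
  have main: "unarcs q (arcs q (w, I)) = (w, I) \<and> arcs q (w, I) \<in> arc_systems n q"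
    if wI: "(w, I) \<in> cut_words n q" for w I
  proof -
    define e where "e = (!) (sorted_list_of_set I)"
    note e = cut_words_enumeration[OF wI, folded e_def]
    have mono: "e k \<le> e (Suc k)" if "k < q" for k using e(2)[of k "Suc k"] that by simp
    define a where "a = arcs q (w, I)"
    have a0: "a 0 = drop (e q) w @ 0 # take (e 0) w"
      by (simp add: a_def arcs_def e_def Let_def)
    have ak: "a k = drop (e (k - 1)) (take (e k) w)" if "k \<in> {1..q}" for k
      using that by (simp add: a_def arcs_def e_def Let_def)
    have cs: "concat (map a [1..<Suc k]) = concat (map (\<lambda>k. drop (e (k - 1)) (take (e k) w)) [1..<Suc k])"
      if "k \<le> q" for k
      using that by (intro arg_cong[where f = concat] map_cong) (auto simp: ak simp del: upt_Suc)
    have pre: "take (e 0) w @ concat (map a [1..<Suc k]) = take (e k) w" if "k \<le> q" for k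
      unfolding cs[OF that] using mono that by (intro concat_slices) auto
    have z: "0 \<notin> set w" using e by simp
    then have z': "0 \<notin> set (take (e 0) w)" "\<forall>t\<in>set (drop (e q) w). t \<noteq> 0"
      by (metis in_set_takeD, metis in_set_dropD)
    have v: "takeWhile (\<lambda>t. t \<noteq> 0) (a 0) = drop (e q) w"
      unfolding a0 using z' by (subst takeWhile_append2) auto
    have u: "tl (dropWhile (\<lambda>t. t \<noteq> 0) (a 0)) = take (e 0) w"
      unfolding a0 using z' by (subst dropWhile_append2) auto
    have "unarcs q a = (take (e q) w @ drop (e q) w, (\<lambda>k. length (take (e k) w)) ` {0..q})"
    proof -
      have "(\<lambda>k. length (take (e 0) w @ concat (map a [1..<Suc k]))) ` {0..q} = (\<lambda>k. length (take (e k) w)) ` {0..q}"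
        by (intro image_cong refl) (simp only: pre atLeastAtMost_iff)
      then show ?thesis
        unfolding unarcs_def Let_def u v by (simp only: pre[OF order.refl])
    qed
    also have "\<dots> = (w, I)"
    proof -
      have "(\<lambda>k. length (take (e k) w)) ` {0..q} = e ` {0..q}"
        by (intro image_cong refl) (use e(3,4) in simp)
      then show ?thesis using e(1) by simp
    qed
    finally have 1: "unarcs q a = (w, I)" .
    have ext: "a \<in> extensional {0..q}"
      by (simp add: a_def arcs_def Let_def)
    have ne: "a i \<noteq> []" if "i \<in> {0..q}" for i
    proof (cases "i = 0")
      case False
      then have "e (i - 1) < e i" "e i \<le> length w" using e(2)[of "i - 1" i] e(3,4) that by auto
      then show ?thesis using False that by (simp add: ak)
    qed (simp add: a0)
    have up: "[0..<Suc q] = 0 # [1..<Suc q]" by (simp add: upt_conv_Cons del: upt_Suc)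
    \<comment> \<open>The arcs concatenate to a rotation of \<open>0 # w\<close>, and comparing
      multisets suffices for the set of letters and their distinctness.\<close>
    have "mset (concat (map a [0..<Suc q])) = mset (0 # (take (e 0) w @ concat (map a [1..<Suc q])) @ drop (e q) w)"
      unfolding up by (simp add: a0 del: upt_Suc)
    also have "\<dots> = mset (0 # w)" unfolding pre[OF order.refl] by (metis append_take_drop_id)
    finally have ms: "mset (concat (map a [0..<Suc q])) = mset (0 # w)" .
    have "set (concat (map a [0..<Suc q])) = {0..n}" "distinct (concat (map a [0..<Suc q]))"
      using mset_eq_setD[OF ms] mset_eq_imp_distinct_iff[OF ms] e z by auto
    then have "a \<in> arc_systems n q"
      unfolding arc_systems_iff using ext ne a0 by auto
    then show ?thesis using 1 unfolding a_def by blast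
  qed
  show "\<forall>p\<in>cut_words n q. unarcs q (arcs q p) = p" using main by auto
  show "arcs q ` cut_words n q \<subseteq> arc_systems n q" using main by auto
  have main2: "arcs q (unarcs q a) = a \<and> unarcs q a \<in> cut_words n q" if a: "a \<in> arc_systems n q" for a
  proof -
    note aa = a[unfolded arc_systems_iff]
    define v where "v = takeWhile (\<lambda>t. t \<noteq> 0) (a 0)"
    define u where "u = tl (dropWhile (\<lambda>t. t \<noteq> 0) (a 0))"
    have dw: "dropWhile (\<lambda>t. t \<noteq> 0) (a 0) \<noteq> []" using aa by (auto simp: dropWhile_eq_Nil_conv)
    then have "hd (dropWhile (\<lambda>t. t \<noteq> 0) (a 0)) = 0" using hd_dropWhile by blast
    then have "dropWhile (\<lambda>t. t \<noteq> 0) (a 0) = 0 # u" using dw unfolding u_def by (metis list.collapse)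
    then have a0: "a 0 = v @ 0 # u" unfolding v_def by (metis takeWhile_dropWhile_id)
    define pre where "pre k = u @ concat (map a [1..<Suc k])" for k
    define e where "e k = length (pre k)" for k
    define w where "w = pre q @ v"
    define I where "I = e ` {0..q}"
    have un: "unarcs q a = (w, I)"
      unfolding unarcs_def Let_def u_def[symmetric] v_def[symmetric] w_def I_def e_def pre_def by simp
    have up: "[0..<Suc q] = 0 # [1..<Suc q]" by (simp add: upt_conv_Cons del: upt_Suc)
    have ms: "mset (concat (map a [0..<Suc q])) = mset (0 # w)"
      unfolding up w_def pre_def by (simp add: a0 del: upt_Suc)
    have w0: "set (0 # w) = {0..n}" "distinct (0 # w)"
      using mset_eq_setD[OF ms] mset_eq_imp_distinct_iff[OF ms] aa by simp_all
    then have "0 \<notin> set w" "distinct w" by simp_all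
    moreover have "set w = {0..n} - {0}"
      unfolding w0(1)[symmetric] using \<open>0 \<notin> set w\<close> by simp
    moreover have "{0..n} - {0} = {1..n}" by auto
    ultimately have w: "set w = {1..n}" "distinct w" by simp_all
    then have lw: "length w = n" using distinct_card by fastforce
    have preSuc: "pre (Suc k) = pre k @ a (Suc k)" for k
      unfolding pre_def by (simp add: upt_conv_Cons)
    have eSuc: "e (Suc k) = e k + length (a (Suc k))" for k unfolding e_def preSuc by simp
    have sm: "e i < e j" if "i < j" "j \<le> q" for i j
      using that
    proof (induction j)
      case (Suc j)
      have "a (Suc j) \<noteq> []" using aa Suc.prems by auto
      then have "e j < e (Suc j)" by (simp add: eSuc)
      then show ?case using Suc by (cases "i = j") auto
    qed simp
    have le: "e k \<le> e q" if "k \<le> q" for k using sm[of k q] that by (cases "k = q") auto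
    have eq: "e q \<le> n" using lw unfolding w_def e_def by simp
    have "sorted_wrt (<) (map e [0..<Suc q])"
      unfolding sorted_wrt_iff_nth_less using sm by (auto simp del: upt_Suc)
    moreover have "set (map e [0..<Suc q]) = I" unfolding I_def by (auto simp del: upt_Suc)
    ultimately have sl: "sorted_list_of_set I = map e [0..<Suc q]"
      using strict_sorted_equal[of "sorted_list_of_set I" "map e [0..<Suc q]"]
      by (metis finite_set set_sorted_list_of_set strict_sorted_list_of_set)
    have inj: "inj_on e {0..q}" using sm by (intro linorder_inj_onI) (auto, fastforce)
    have "e k \<le> n" if "k \<le> q" for k using le[OF that] eq by linarith
    then have "I \<subseteq> {0..n}" "card I = Suc q"
      unfolding I_def using inj by (auto simp: card_image)
    then have mem: "(w, I) \<in> cut_words n q" using w by (auto simp: cut_words_def)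
    have split: "\<exists>r. w = pre k @ r" if "k \<le> q" for k
    proof -
      have "[1..<Suc q] = [1..<Suc k] @ [Suc k..<Suc q]"
        using upt_add_eq_append[of 1 "Suc k" "q - k"] that by simp
      then show ?thesis unfolding w_def pre_def by (simp del: upt_Suc)
    qed
    have tk: "take (e k) w = pre k" if "k \<le> q" for k
      using split[OF that] by (auto simp: e_def)
    have "arcs q (w, I) k = a k" for k
    proof -
      consider "k \<notin> {0..q}" | "k = 0" | j where "k = Suc j" "k \<le> q" by (cases k) auto
      then show ?thesis
      proof cases
        case 1
        then show ?thesis using aa by (simp add: arcs_def Let_def extensional_def)
      next
        case 2
        have "take (e 0) w = u" using tk[of 0] by (simp add: pre_def)
        moreover have "drop (e q) w = v" by (simp add: w_def e_def)
        ultimately show ?thesis using 2 a0 by (simp add: arcs_def Let_def sl del: upt_Suc)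
      next
        case 3
        have "drop (e j) (take (e (Suc j)) w) = a (Suc j)"
          using tk[of "Suc j"] 3 by (simp add: preSuc e_def)
        then show ?thesis using 3 by (simp add: arcs_def Let_def sl del: upt_Suc)
      qed
    qed
    then have "arcs q (w, I) = a" by blast
    then show ?thesis using un mem by simp
  qed
  show "\<forall>a\<in>arc_systems n q. arcs q (unarcs q a) = a" using main2 by auto
  show "unarcs q ` arc_systems n q \<subseteq> cut_words n q" using main2 by auto
qed

section \<open>Exposed cut sets and positive arcs\<close>

lemma positive_bridge_arcs_iff:
  assumes wI: "(w, I) \<in> cut_words n q" and y0: "y 0 = - (\<Sum>t\<in>{1..n}. y t)"
  shows "(\<forall>i\<in>{0..q}. positive_bridge y (arcs q (w, I) i)) \<longleftrightarrow>
    (\<forall>i\<in>I. \<forall>j\<in>{0..n}. (j \<in> I \<longrightarrow> walk y w j = walk y w i) \<and> (j \<notin> I \<longrightarrow> walk y w i < walk y w j))"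
    (is "?L \<longleftrightarrow> ?R")
proof -
  define e where "e = (!) (sorted_list_of_set I)"
  note e = cut_words_enumeration[OF wI, folded e_def]
  define h where "h = walk y w"
  define a where "a = arcs q (w, I)"
  have a0: "a 0 = drop (e q) w @ 0 # take (e 0) w"
    by (simp add: a_def arcs_def e_def Let_def)
  have ak: "a k = drop (e (k - 1)) (take (e k) w)" if "k \<in> {1..q}" for k
    using that by (simp add: a_def arcs_def e_def Let_def)
  have eI: "e k \<in> I" if "k \<le> q" for k
    unfolding e(1) using that by (intro imageI) simp
  have Ie: "\<exists>k\<le>q. i = e k" if "i \<in> I" for i
    using that unfolding e(1) by (elim imageE) auto
  have eq: "e 0 \<le> e q" "e q \<le> n" using e(2)[of 0 q] e(3)[of q] by (cases "q = 0"; simp)+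
  have seg: "sum_list (map y (take m (drop s w))) = h (s + m) - h s" for s m
  proof -
    have "take (s + m) w = take s w @ take m (drop s w)" by (rule take_add)
    then show ?thesis by (simp add: h_def walk_def)
  qed
  have hn: "h n = - y 0"
    using e(4-6) y0 by (simp add: h_def walk_def sum_list_distinct_conv_sum_set)
  have pos0: "positive_bridge y (a 0) \<longleftrightarrow> h (e 0) = h (e q) \<and>
     (\<forall>j\<in>{0..n}. j < e 0 \<or> e q < j \<longrightarrow> h (e q) < h j)"
  proof -
    have len: "length (a 0) = n - e q + 1 + e 0" using eq e(4) by (simp add: a0)
    have p1: "sum_list (map y (take m (a 0))) = h (e q + m) - h (e q)" if "m \<le> n - e q" for m
      using that e(4) by (simp add: a0 seg)
    \<comment> \<open>The letter 0 brings the height back to 0, so the heights restart at the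
      beginning of the word. The prefix that ends with this letter corresponds to position 0, whence
      the shift by \<open>n - e q + 1\<close>.\<close>
    have p2: "sum_list (map y (take (n - e q + 1 + m) (a 0))) = h m - h (e q)" if "m \<le> e 0" for m
    proof -
      have "take (n - e q + 1 + m) (a 0) = drop (e q) w @ 0 # take m w"
        using that e(4) by (simp add: a0 min_def)
      moreover have "sum_list (map y (drop (e q) w)) = h n - h (e q)"
        using seg[of "n - e q" "e q"] eq e(4) by simp
      ultimately show ?thesis using hn by (simp add: h_def walk_def)
    qed
    have tot: "sum_list (map y (a 0)) = h (e 0) - h (e q)" using p2[of "e 0"] len by simp
    have "(\<forall>k. 0 < k \<longrightarrow> k < length (a 0) \<longrightarrow> 0 < sum_list (map y (take k (a 0)))) \<longleftrightarrow>
      (\<forall>j\<in>{0..n}. j < e 0 \<or> e q < j \<longrightarrow> h (e q) < h j)" (is "?A \<longleftrightarrow> ?B")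
    proof
      assume A: ?A
      show ?B
      proof (intro ballI impI)
        fix j assume j: "j \<in> {0..n}" "j < e 0 \<or> e q < j"
        then consider "j < e 0" | "e q < j" by blast
        then show "h (e q) < h j"
        proof cases
          case 1
          then show ?thesis using A[rule_format, of "n - e q + 1 + j"] p2[of j] len by simp
        next
          case 2
          then show ?thesis using A[rule_format, of "j - e q"] p1[of "j - e q"] len j by simp
        qed
      qed
    next
      assume B: ?B
      show ?A
      proof (intro allI impI)
        fix k assume k: "0 < k" "k < length (a 0)"
        show "0 < sum_list (map y (take k (a 0)))"
        proof (cases "k \<le> n - e q")
          case True
          then show ?thesis using B[rule_format, of "e q + k"] p1[of k] k eq by simp
        next
          case False
          define m where "m = k - (n - e q + 1)"
          have m: "k = n - e q + 1 + m" "m < e 0" using False k len by (auto simp: m_def)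
          then show ?thesis using B[rule_format, of m] p2[of m] eq by simp
        qed
      qed
    qed
    then show ?thesis unfolding positive_bridge_def tot by simp
  qed
  \<comment> \<open>Relative to its starting cut, an arc lists the heights up to the next cut. Hence
    all arcs together say that the cuts are exactly the positions of minimal height.\<close>
  have posk: "positive_bridge y (a k) \<longleftrightarrow> h (e k) = h (e (k - 1)) \<and>
      (\<forall>j. e (k - 1) < j \<and> j < e k \<longrightarrow> h (e (k - 1)) < h j)" if k: "k \<in> {1..q}" for k
  proof -
    have ek: "e (k - 1) < e k" "e k \<le> n" using e(2)[of "k - 1" k] e(3)[of k] k by auto
    have len: "length (a k) = e k - e (k - 1)" using ek e(4) by (simp add: ak[OF k])
    have tk: "take m (a k) = take m (drop (e (k - 1)) w)" if "m \<le> e k - e (k - 1)" for m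
      using that by (simp add: ak[OF k] drop_take min_def)
    have tot: "sum_list (map y (a k)) = h (e k) - h (e (k - 1))"
      using tk[of "length (a k)"] seg[of "length (a k)" "e (k - 1)"] len ek by simp
    have "(\<forall>m. 0 < m \<longrightarrow> m < length (a k) \<longrightarrow> 0 < sum_list (map y (take m (a k)))) \<longleftrightarrow>
        (\<forall>j. e (k - 1) < j \<and> j < e k \<longrightarrow> h (e (k - 1)) < h j)" (is "?A \<longleftrightarrow> ?B")
    proof
      assume A: ?A
      show ?B
      proof (intro allI impI)
        fix j assume j: "e (k - 1) < j \<and> j < e k"
        then have "j - e (k - 1) < e k - e (k - 1)" by linarith
        with j show "h (e (k - 1)) < h j"
          using A[rule_format, of "j - e (k - 1)"] tk[of "j - e (k - 1)"] len by (simp add: seg)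
      qed
    next
      assume B: ?B
      show ?A
      proof (intro allI impI)
        fix m assume "0 < m" "m < length (a k)"
        then show "0 < sum_list (map y (take m (a k)))"
          using B[rule_format, of "e (k - 1) + m"] tk[of m] len by (simp add: seg)
      qed
    qed
    then show ?thesis unfolding positive_bridge_def tot by simp
  qed
  show ?thesis
    unfolding a_def[symmetric] h_def[symmetric]
  proof
    assume L: "\<forall>i\<in>{0..q}. positive_bridge y (a i)"
    have hk: "h (e k) = h (e 0)" if "k \<le> q" for k
      using that
    proof (induction k)
      case (Suc k)
      then show ?case using posk[of "Suc k"] L by simp
    qed simp
    have hI: "h i = h (e 0)" if "i \<in> I" for i using Ie[OF that] hk by metis
    have hO: "h (e 0) < h j" if j: "j \<in> {0..n}" "j \<notin> I" for j
    proof (cases "j < e 0 \<or> e q < j")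
      case True
      then show ?thesis using pos0 L j hk[of q] by auto
    next
      case False
      \<comment> \<open>The first cut at or after \<open>j\<close> is the end of the arc that has
        \<open>j\<close> in its interior.\<close>
      define k where "k = (LEAST k. j \<le> e k)"
      have jq: "j \<le> e q" using False by simp
      have k1: "j \<le> e k" unfolding k_def using jq by (rule LeastI)
      have k2: "k \<le> q" unfolding k_def using jq by (rule Least_le)
      have "j \<noteq> e k'" if "k' \<le> q" for k' using j eI[OF that] by metis
      from this[OF k2] have "j < e k" using k1 by simp
      moreover have "k \<noteq> 0" using False \<open>j < e k\<close> by metis
      moreover have "\<not> j \<le> e (k - 1)" using \<open>k \<noteq> 0\<close> not_less_Least[of "k - 1" "\<lambda>k. j \<le> e k"] by (simp add: k_def)
      ultimately show ?thesis using posk[of k] L k2 hk[of "k - 1"] by auto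
    qed
    show "\<forall>i\<in>I. \<forall>j\<in>{0..n}. (j \<in> I \<longrightarrow> h j = h i) \<and> (j \<notin> I \<longrightarrow> h i < h j)"
      using hI hO by simp
  next
    assume R: "\<forall>i\<in>I. \<forall>j\<in>{0..n}. (j \<in> I \<longrightarrow> h j = h i) \<and> (j \<notin> I \<longrightarrow> h i < h j)"
    have hh: "h (e k) = h (e l)" if "k \<le> q" "l \<le> q" for k l
      using R eI e(3) that by simp
    have not: "j \<notin> I" if "\<And>k. k \<le> q \<Longrightarrow> j \<noteq> e k" for j using Ie[of j] that by blast
    have mono: "e k \<le> e l" if "k \<le> l" "l \<le> q" for k l
      using e(2)[of k l] that by (cases "k = l") auto
    show "\<forall>i\<in>{0..q}. positive_bridge y (a i)"
    proof
      fix i assume i: "i \<in> {0..q}"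
      show "positive_bridge y (a i)"
      proof (cases "i = 0")
        case True
        have "h (e q) < h j" if j: "j \<in> {0..n}" "j < e 0 \<or> e q < j" for j
        proof -
          have "j \<noteq> e k" if "k \<le> q" for k using mono[of 0 k] mono[of k q] that j by auto
          then show ?thesis using R eI[of q] j not by blast
        qed
        then show ?thesis using True pos0 hh[of 0 q] by simp
      next
        case False
        have "h (e (i - 1)) < h j" if j: "e (i - 1) < j" "j < e i" for j
        proof -
          have "j \<noteq> e k" if "k \<le> q" for k
          proof (cases "k \<le> i - 1")
            case True
            have "i - 1 \<le> q" using i by simp
            from mono[OF True this] show ?thesis using j by simp
          next
            case False
            then have "i \<le> k" by simp
            from mono[OF this that] show ?thesis using j by simp
          qed
          then have "j \<notin> I" using not by blast
          moreover have "j \<le> n" using j e(3)[of i] i by simp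
          ultimately show ?thesis using R eI[of "i - 1"] i by simp
        qed
        then show ?thesis using False posk[of i] hh[of i "i - 1"] i by auto
      qed
    qed
  qed
qed

lemma inner_walk: "f \<bullet> walk X w k = walk (\<lambda>t. f \<bullet> X t) w k"
proof -
  have "f \<bullet> sum_list (map X l) = sum_list (map (\<lambda>t. f \<bullet> X t) l)" for l
    by (induction l) (auto simp: inner_add_right)
  then show ?thesis by (simp add: walk_def)
qed

text \<open>\<open>positive_bridge_arcs_iff\<close> holds for each functional separately, so it
  carries over to the existence of a common one for all arcs.\<close>

lemma card_exposed_cut_words:
  fixes X :: "nat \<Rightarrow> 'e::euclidean_space"
  assumes X0: "X 0 = - (\<Sum>t\<in>{1..n}. X t)"
  shows "card {(w, I) \<in> cut_words n q. exposed_indices (walk X w) n I} =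
    card {a \<in> arc_systems n q. \<exists>f. f \<noteq> 0 \<and> (\<forall>i\<in>{0..q}. positive_bridge (\<lambda>t. f \<bullet> X t) (a i))}"
proof -
  have "{(w, I) \<in> cut_words n q. exposed_indices (walk X w) n I} =
    {p \<in> cut_words n q. case p of (w, I) \<Rightarrow> exposed_indices (walk X w) n I}" by auto
  moreover have "bij_betw (arcs q) {p \<in> cut_words n q. case p of (w, I) \<Rightarrow> exposed_indices (walk X w) n I}
    {a \<in> arc_systems n q. \<exists>f. f \<noteq> 0 \<and> (\<forall>i\<in>{0..q}. positive_bridge (\<lambda>t. f \<bullet> X t) (a i))}"
  proof (rule bij_betw_Collect[OF bij_betw_arcs])
    fix p assume p: "p \<in> cut_words n q"
    obtain w I where wI: "p = (w, I)" by force
    have y0: "f \<bullet> X 0 = - (\<Sum>t\<in>{1..n}. f \<bullet> X t)" for f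
      using X0 by (simp add: inner_sum_right)
    have "(\<forall>i\<in>{0..q}. positive_bridge (\<lambda>t. f \<bullet> X t) (arcs q (w, I) i)) \<longleftrightarrow>
        (\<forall>i\<in>I. \<forall>j\<in>{0..n}. (j \<in> I \<longrightarrow> f \<bullet> walk X w j = f \<bullet> walk X w i) \<and>
           (j \<notin> I \<longrightarrow> f \<bullet> walk X w i < f \<bullet> walk X w j))" for f
      unfolding inner_walk using p wI y0[of f] by (intro positive_bridge_arcs_iff) auto
    then show "(\<exists>f. f \<noteq> 0 \<and> (\<forall>i\<in>{0..q}. positive_bridge (\<lambda>t. f \<bullet> X t) (arcs q p i))) \<longleftrightarrow>
        (case p of (w, I) \<Rightarrow> exposed_indices (walk X w) n I)"
      unfolding wI exposed_indices_def by simp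
  qed
  ultimately show ?thesis by (simp add: bij_betw_same_card)
qed

text \<open>One cut leaves one arc, an arbitrary ordering of all \<open>Suc n\<close> letters, so
  \<open>card_positive_bridges\<close> applies. A proper prefix with positive sum exists by
  \<open>n \<ge> 1\<close> and forces \<open>f \<noteq> 0\<close>.\<close>

theorem card_exposed_points:
  fixes X :: "nat \<Rightarrow> 'e::euclidean_space"
  assumes X0: "X 0 = - (\<Sum>t\<in>{1..n}. X t)" and gp: "general_position {0..n} X" and n: "n \<ge> 1"
  shows "card {(w, I) \<in> cut_words n 0. exposed_indices (walk X w) n I} = 2 * alt_stirling (Suc n) DIM('e)"
proof -
  have sum0: "(\<Sum>t\<in>{0..n}. X t) = 0"
    using X0 by (simp add: sum.atLeast_Suc_atMost)
  have "bij_betw (\<lambda>a. a 0)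
     {a \<in> arc_systems n 0. \<exists>f. f \<noteq> 0 \<and> (\<forall>i\<in>{0..0}. positive_bridge (\<lambda>t. f \<bullet> X t) (a i))}
     {l \<in> permutations_of_set {0..n}. \<exists>f. positive_bridge (\<lambda>t. f \<bullet> X t) l}"
  proof (rule bij_betw_byWitness[where f' = "\<lambda>l. restrict (\<lambda>_. l) {0::nat}"])
    show "\<forall>a\<in>{a \<in> arc_systems n 0. \<exists>f. f \<noteq> 0 \<and> (\<forall>i\<in>{0..0}. positive_bridge (\<lambda>t. f \<bullet> X t) (a i))}.
       restrict (\<lambda>_. a 0) {0} = a"
      by (auto simp: arc_systems_iff extensional_def restrict_def)
    show "\<forall>l\<in>{l \<in> permutations_of_set {0..n}. \<exists>f. positive_bridge (\<lambda>t. f \<bullet> X t) l}. restrict (\<lambda>_. l) {0::nat} 0 = l"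
      by simp
    show "(\<lambda>a. a 0) ` {a \<in> arc_systems n 0. \<exists>f. f \<noteq> 0 \<and> (\<forall>i\<in>{0..0}. positive_bridge (\<lambda>t. f \<bullet> X t) (a i))}
        \<subseteq> {l \<in> permutations_of_set {0..n}. \<exists>f. positive_bridge (\<lambda>t. f \<bullet> X t) l}"
      by (auto simp: arc_systems_iff)
    show "(\<lambda>l. restrict (\<lambda>_. l) {0::nat}) ` {l \<in> permutations_of_set {0..n}. \<exists>f. positive_bridge (\<lambda>t. f \<bullet> X t) l}
       \<subseteq> {a \<in> arc_systems n 0. \<exists>f. f \<noteq> 0 \<and> (\<forall>i\<in>{0..0}. positive_bridge (\<lambda>t. f \<bullet> X t) (a i))}"
    proof (rule image_subsetI)
      fix l assume "l \<in> {l \<in> permutations_of_set {0..n}. \<exists>f. positive_bridge (\<lambda>t. f \<bullet> X t) l}"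
      then obtain f where l: "l \<in> permutations_of_set {0..n}" and f: "positive_bridge (\<lambda>t. f \<bullet> X t) l" by blast
      have l': "set l = {0..n}" "distinct l" "length l = Suc n"
        using l length_finite_permutations_of_set[OF l] by (auto dest: permutations_of_setD)
      have "restrict (\<lambda>_. l) {0::nat} \<in> arc_systems n 0" using l' by (auto simp: arc_systems_iff)
      moreover have "f \<noteq> 0"
      proof
        assume "f = 0"
        moreover have "0 < sum_list (map (\<lambda>t. f \<bullet> X t) (take 1 l))"
          using f l' n by (simp add: positive_bridge_def)
        ultimately show False by simp
      qed
      ultimately show "restrict (\<lambda>_. l) {0::nat} \<in>
         {a \<in> arc_systems n 0. \<exists>f. f \<noteq> 0 \<and> (\<forall>i\<in>{0..0}. positive_bridge (\<lambda>t. f \<bullet> X t) (a i))}"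
        using f by auto
    qed
  qed
  then have "card {a \<in> arc_systems n 0. \<exists>f. f \<noteq> 0 \<and> (\<forall>i\<in>{0..0}. positive_bridge (\<lambda>t. f \<bullet> X t) (a i))} =
     card {l \<in> permutations_of_set {0..n}. \<exists>f. positive_bridge (\<lambda>t. f \<bullet> X t) l}"
    by (rule bij_betw_same_card)
  then show ?thesis
    unfolding card_exposed_cut_words[OF X0] using card_positive_bridges[OF _ _ sum0 gp] n by simp
qed

text \<open>Arc systems are sorted by their labelling, which the arcs determine.
  \<open>card_positive_bridge_systems\<close> counts each class, where \<open>q < n\<close> supplies
  its size hypothesis, and \<open>sum_labellings\<close> adds the counts up.\<close>

theorem card_exposed_facets:
  fixes X :: "nat \<Rightarrow> 'e::euclidean_space"
  assumes X0: "X 0 = - (\<Sum>t\<in>{1..n}. X t)" and gp: "general_position {0..n} X"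
    and q: "DIM('e) = Suc q" "q < n"
  shows "card {(w, I) \<in> cut_words n q. exposed_indices (walk X w) n I} =
    2 * (fact q * stirling (Suc n) (Suc q))"
proof -
  have sum0: "(\<Sum>t\<in>{0..n}. X t) = 0"
    using X0 by (simp add: sum.atLeast_Suc_atMost)
  have J: "insert 0 {1..q} = {0..q}" by auto
  define B where "B c = (\<Pi>\<^sub>E i\<in>{0..q}. permutations_of_set {t\<in>{0..n}. c t = i})" for c :: "nat \<Rightarrow> nat"
  define R where "R a \<longleftrightarrow> (\<exists>f. f \<noteq> 0 \<and> (\<forall>i\<in>{0..q}. positive_bridge (\<lambda>t. f \<bullet> X t) (a i)))" for a :: "nat \<Rightarrow> nat list"
  have "{a \<in> arc_systems n q. R a} = (\<Union>c\<in>labellings n {1..q}. {a \<in> B c. R a})"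
    unfolding arc_systems_def B_def by blast
  moreover have "card (\<Union>c\<in>labellings n {1..q}. {a \<in> B c. R a}) = (\<Sum>c\<in>labellings n {1..q}. card {a \<in> B c. R a})"
  proof (rule card_UN_disjoint)
    show "finite (labellings n {1..q})" by (intro finite_labellings) simp
    show "\<forall>c\<in>labellings n {1..q}. finite {a \<in> B c. R a}"
    proof
      fix c
      have "finite (B c)" unfolding B_def by (intro finite_PiE) auto
      then show "finite {a \<in> B c. R a}" by simp
    qed
    show "\<forall>c\<in>labellings n {1..q}. \<forall>c'\<in>labellings n {1..q}. c \<noteq> c' \<longrightarrow> {a \<in> B c. R a} \<inter> {a \<in> B c'. R a} = {}"
    proof (intro ballI impI)
      fix c c' assume c: "c \<in> labellings n {1..q}" "c' \<in> labellings n {1..q}" "c \<noteq> c'"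
      have cE: "c \<in> {0..n} \<rightarrow>\<^sub>E {0..q}" "c' \<in> {0..n} \<rightarrow>\<^sub>E {0..q}"
        using c unfolding labellings_def J by auto
      have False if a: "a \<in> B c" "a \<in> B c'" for a
      proof -
        have "c t = c' t" if t: "t \<in> {0..n}" for t
        proof -
          have i: "c t \<in> {0..q}" using PiE_mem[OF cE(1) t] .
          have "set (a (c t)) = {s\<in>{0..n}. c s = c t}" "set (a (c t)) = {s\<in>{0..n}. c' s = c t}"
            using PiE_mem[OF a(1)[unfolded B_def] i] PiE_mem[OF a(2)[unfolded B_def] i]
            by (auto dest: permutations_of_setD)
          then have "t \<in> {s\<in>{0..n}. c' s = c t}" using t by blast
          then show ?thesis by simp
        qed
        then have "c = c'" using cE by (intro PiE_ext) auto
        then show False using c by simp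
      qed
      then show "{a \<in> B c. R a} \<inter> {a \<in> B c'. R a} = {}" by blast
    qed
  qed
  moreover have "card {a \<in> B c. R a} = 2 * (\<Prod>i\<in>{0..q}. fact (card {t\<in>{0..n}. c t = i} - 1))"
    if c: "c \<in> labellings n {1..q}" for c
  proof -
    have cE: "c \<in> {0..n} \<rightarrow>\<^sub>E {0..q}" "c 0 = 0" "{1..q} \<subseteq> c ` {0..n}"
      using c unfolding labellings_def J by auto
    have "0 \<in> c ` {0..n}" using cE(2) by (intro image_eqI[of _ _ 0]) auto
    then have "{0..q} \<subseteq> c ` {0..n}" using cE(3) unfolding J[symmetric] by blast
    moreover have "c ` {0..n} \<subseteq> {0..q}" using cE(1) by (intro image_subsetI) (rule PiE_mem)
    ultimately have "c ` {0..n} = {0..q}" by blast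
    then show ?thesis
      unfolding B_def R_def using q by (intro card_positive_bridge_systems[OF _ gp sum0]) auto
  qed
  ultimately have "card {a \<in> arc_systems n q. R a} =
      (\<Sum>c\<in>labellings n {1..q}. 2 * (\<Prod>i\<in>{0..q}. fact (card {t\<in>{0..n}. c t = i} - 1)))"
    by simp
  also have "\<dots> = 2 * (fact q * stirling (Suc n) (Suc q))"
    using sum_labellings[of "{1..q}" n] unfolding J sum_distrib_left[symmetric] by simp
  finally show ?thesis unfolding card_exposed_cut_words[OF X0] R_def .
qed

section \<open>Faces and exposed index sets\<close>

text \<open>Summation by parts turns the affine relation into a relation between the steps, whose
  coefficient at \<open>t\<close> is the sum of all \<open>c i\<close> with
  \<open>i \<ge> t\<close>. This step function has few values and vanishes at 0, so it is 0 by
  general position, and the \<open>c i\<close> are its differences.\<close>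

lemma general_position_affine_independent:
  fixes X :: "nat \<Rightarrow> 'e::euclidean_space"
  assumes gp: "general_position {0..n} X" and P: "\<And>k. k \<le> n \<Longrightarrow> P k = (\<Sum>t\<in>{1..k}. X t)"
    and I: "I \<subseteq> {0..n}" "card I \<le> Suc DIM('e)"
    and c: "(\<Sum>i\<in>I. c i) = 0" "(\<Sum>i\<in>I. c i *\<^sub>R P i) = 0" and i: "i \<in> I"
  shows "c i = (0::real)"
proof -
  have fin: "finite I" using I finite_subset by blast
  define g where "g t = (\<Sum>i\<in>I \<inter> {t..}. c i)" for t
  have "(\<Sum>i\<in>I. c i *\<^sub>R P i) = (\<Sum>i\<in>I. \<Sum>t\<in>{1..n}. if t \<le> i then c i *\<^sub>R X t else 0)"
  proof (rule sum.cong[OF refl])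
    fix i assume "i \<in> I"
    then have "i \<le> n" using I by auto
    then have eq: "{1..n} \<inter> {t. t \<le> i} = {1..i}" by auto
    have "(\<Sum>t\<in>{1..n}. if t \<le> i then c i *\<^sub>R X t else 0) = (\<Sum>t\<in>{1..i}. c i *\<^sub>R X t)"
      by (subst sum.inter_filter[symmetric]) (simp, intro sum.cong, use \<open>i \<le> n\<close> in auto)
    then show "c i *\<^sub>R P i = (\<Sum>t\<in>{1..n}. if t \<le> i then c i *\<^sub>R X t else 0)"
      using P[OF \<open>i \<le> n\<close>] by (simp add: scaleR_sum_right)
  qed
  also have "\<dots> = (\<Sum>t\<in>{1..n}. \<Sum>i\<in>I. if t \<le> i then c i *\<^sub>R X t else 0)" by (rule sum.swap)
  also have "\<dots> = (\<Sum>t\<in>{1..n}. g t *\<^sub>R X t)"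
  proof (rule sum.cong[OF refl])
    fix t
    have "(\<Sum>i\<in>I. if t \<le> i then c i *\<^sub>R X t else 0) = (\<Sum>i\<in>I \<inter> {t..}. c i *\<^sub>R X t)"
      using fin by (subst sum.inter_restrict) auto
    then show "(\<Sum>i\<in>I. if t \<le> i then c i *\<^sub>R X t else 0) = g t *\<^sub>R X t"
      by (simp add: g_def scaleR_sum_left)
  qed
  finally have rel1: "(\<Sum>t\<in>{1..n}. g t *\<^sub>R X t) = 0" using c by simp
  have g0: "g 0 = 0" using c by (simp add: g_def)
  have rel: "(\<Sum>t\<in>{0..n}. g t *\<^sub>R X t) = 0"
    using rel1 g0 by (simp add: sum.atLeast_Suc_atMost)
  have "card (g ` {0..n}) \<le> Suc DIM('e)"
  proof -
    have neI: "I \<noteq> {}" using i by auto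
    \<comment> \<open>\<open>g\<close> changes only at elements of \<open>I\<close>. Its value up to
      \<open>Min I\<close> is the full sum 0, the same as beyond the last element, which saves one
      value.\<close>
    have "g ` {0..n} \<subseteq> insert 0 (g ` (I - {Min I}))"
    proof (rule image_subsetI)
      fix t
      show "g t \<in> insert 0 (g ` (I - {Min I}))"
      proof (cases "I \<inter> {t..} = {}")
        case True
        then show ?thesis by (simp add: g_def)
      next
        case False
        define m where "m = Min (I \<inter> {t..})"
        have fin': "finite (I \<inter> {t..})" using fin by simp
        have m: "m \<in> I" "t \<le> m" using Min_in[OF fin' False] by (auto simp: m_def)
        have "I \<inter> {t..} = I \<inter> {m..}" using m Min_le[OF fin'] by (auto simp: m_def)
        then have gt: "g t = g m" by (simp add: g_def)
        show ?thesis
        proof (cases "m = Min I")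
          case True
          then have "I \<inter> {m..} = I" using Min_le[OF fin] by auto
          then show ?thesis using c(1) gt by (simp add: g_def)
        next
          case False
          then show ?thesis using m gt by auto
        qed
      qed
    qed
    then have "card (g ` {0..n}) \<le> card (insert 0 (g ` (I - {Min I})))"
      using fin by (intro card_mono) auto
    also have "\<dots> \<le> Suc (card (I - {Min I}))"
      using card_image_le[of "I - {Min I}" g] fin by (simp add: card_insert_if)
    also have "\<dots> = card I" using fin neI Min_in[OF fin neI] by (simp add: card_gt_0_iff)
    finally show ?thesis using I by simp
  qed
  then have "card (g ` {0..n}) \<le> 1" by (rule gp[unfolded general_position_def, rule_format, OF rel])
  then have const: "\<forall>s\<in>{0..n}. \<forall>t\<in>{0..n}. g s = g t"
    by (simp only: card_image_le_1_iff finite_atLeastAtMost)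
  have gz: "g t = 0" for t
  proof (cases "t \<le> n")
    case True
    then have "t \<in> {0..n}" "0 \<in> {0..n}" by auto
    then show ?thesis using const g0 by metis
  next
    case False
    then have "I \<inter> {t..} = {}" using I by auto
    then show ?thesis by (simp add: g_def)
  qed
  have "I \<inter> {i..} = insert i (I \<inter> {Suc i..})" using i by auto
  then have "g i = c i + g (Suc i)" using fin by (simp add: g_def)
  then show ?thesis using gz by simp
qed

lemma general_position_aff_dim:
  fixes X :: "nat \<Rightarrow> 'e::euclidean_space"
  assumes gp: "general_position {0..n} X" and P: "\<And>k. k \<le> n \<Longrightarrow> P k = (\<Sum>t\<in>{1..k}. X t)"
    and I: "I \<subseteq> {0..n}" "card I \<le> Suc DIM('e)" and inj: "inj_on P {0..n}"
  shows "aff_dim (P ` I) = int (card I) - 1"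
proof -
  have fin: "finite I" using I finite_subset by blast
  have injI: "inj_on P I" using inj I inj_on_subset by blast
  have "\<not> affine_dependent (P ` I)"
  proof
    assume "affine_dependent (P ` I)"
    then obtain U where U: "sum U (P ` I) = 0" "\<exists>v\<in>P ` I. U v \<noteq> 0" "(\<Sum>v\<in>P ` I. U v *\<^sub>R v) = 0"
      using affine_dependent_explicit_finite[of "P ` I"] fin by auto
    then have "(\<Sum>i\<in>I. U (P i)) = 0" "(\<Sum>i\<in>I. U (P i) *\<^sub>R P i) = 0"
      by (simp_all add: sum.reindex[OF injI])
    then have "\<And>i. i \<in> I \<Longrightarrow> U (P i) = 0"
      using general_position_affine_independent[OF gp P I, of "\<lambda>i. U (P i)"] by blast
    then show False using U by auto
  qed
  from aff_dim_affine_independent[OF this] show ?thesis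
    by (simp add: card_image[OF injI])
qed

text \<open>A vertex lies outside the hull of the other points, from which a hyperplane separates it
  strictly. As distinctness of the points suffices, the vertex count is identified at every outcome,
  which also settles its measurability.\<close>

lemma card_extreme_points:
  fixes P :: "nat \<Rightarrow> 'e::euclidean_space"
  assumes n: "n \<ge> 1" and inj: "inj_on P {0..n}"
  shows "card {v. v extreme_point_of convex hull (P ` {0..n})} =
    card {I. I \<subseteq> {0..n} \<and> card I = Suc 0 \<and> exposed_indices P n I}"
proof -
  have key: "P i extreme_point_of convex hull (P ` {0..n}) \<longleftrightarrow> exposed_indices P n {i}" if i: "i \<in> {0..n}" for i
  proof -
    define S where "S = P ` ({0..n} - {i})"
    have finS: "finite S" by (simp add: S_def)
    have ins: "P ` {0..n} = insert (P i) S" using i by (auto simp: S_def)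
    have notin: "P i \<notin> S" using inj i by (auto simp: S_def inj_on_def)
    show ?thesis
    proof
      assume ext: "P i extreme_point_of convex hull (P ` {0..n})"
      have "P i \<notin> convex hull S"
      proof
        assume "P i \<in> convex hull S"
        then have "convex hull (insert (P i) S) = convex hull S" by (rule hull_redundant)
        then have "P i \<in> S" using ext unfolding ins by (simp add: extreme_point_of_convex_hull)
        then show False using notin by simp
      qed
      then obtain f b where f: "f \<bullet> P i < b" "\<And>x. x \<in> convex hull S \<Longrightarrow> b < f \<bullet> x"
        using separating_hyperplane_closed_point[of "convex hull S" "P i"] finS
        by (auto simp: finite_imp_compact_convex_hull compact_imp_closed)
      have lt: "f \<bullet> P i < f \<bullet> P j" if "j \<in> {0..n}" "j \<noteq> i" for j
      proof -
        have "P j \<in> convex hull S" using that by (intro hull_inc) (auto simp: S_def)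
        then show ?thesis using f by fastforce
      qed
      have "f \<noteq> 0"
      proof
        assume "f = 0"
        moreover have "\<exists>j\<in>{0..n}. j \<noteq> i" using n by (intro bexI[of _ "if i = 0 then 1 else 0"]) auto
        ultimately show False using lt by force
      qed
      then show "exposed_indices P n {i}" unfolding exposed_indices_def using lt by (intro exI[of _ f]) auto
    next
      assume "exposed_indices P n {i}"
      then obtain f where f: "\<forall>j\<in>{0..n}. j \<noteq> i \<longrightarrow> f \<bullet> P i < f \<bullet> P j"
        unfolding exposed_indices_def by blast
      have "convex hull S \<subseteq> {x. f \<bullet> x > f \<bullet> P i}"
        by (rule hull_minimal) (use f in \<open>auto simp: S_def convex_halfspace_gt\<close>)
      then have "P i \<notin> convex hull S" by auto
      then show "P i extreme_point_of convex hull (P ` {0..n})"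
        unfolding ins by (rule extreme_point_of_convex_hull_insert[OF finS])
    qed
  qed
  have V: "{v. v extreme_point_of convex hull (P ` {0..n})} = P ` {i \<in> {0..n}. exposed_indices P n {i}}"
  proof (intro equalityI subsetI)
    fix v assume v: "v \<in> {v. v extreme_point_of convex hull (P ` {0..n})}"
    then obtain i where "i \<in> {0..n}" "v = P i" using extreme_point_of_convex_hull by blast
    then show "v \<in> P ` {i \<in> {0..n}. exposed_indices P n {i}}" using key v by auto
  qed (use key in auto)
  have I: "{I. I \<subseteq> {0..n} \<and> card I = Suc 0 \<and> exposed_indices P n I} =
      (\<lambda>i. {i}) ` {i \<in> {0..n}. exposed_indices P n {i}}"
    by (auto simp: card_1_singleton_iff)
  have "inj_on P {i \<in> {0..n}. exposed_indices P n {i}}" using inj by (rule inj_on_subset) auto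
  then show ?thesis unfolding V I by (simp add: card_image)
qed

text \<open>
  No general position is assumed here, because the number of faces has to be measurable on the whole
  probability space. The case \<open>I = {0..n}\<close> occurs when the hull itself has dimension \<open>q\<close>.
\<close>

lemma bij_betw_faces:
  fixes P :: "nat \<Rightarrow> 'e::euclidean_space" and n :: nat
  defines "H \<equiv> convex hull (P ` {0..n})"
  shows "bij_betw (\<lambda>I. convex hull (P ` I))
    {I. I \<subseteq> {0..n} \<and> (I = {0..n} \<or> exposed_indices P n I) \<and> aff_dim (P ` I) = int q}
    {F. F face_of H \<and> aff_dim F = int q}"
proof -
  \<comment> \<open>The index set is recovered from the face as the set of indices whose points lie
    in it, even if some points coincide; this gives injectivity.\<close>
  have exposed: "convex hull (P ` I) face_of H \<and> I = {i \<in> {0..n}. P i \<in> convex hull (P ` I)}"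
    if I: "I \<subseteq> {0..n}" "I \<noteq> {}" "exposed_indices P n I" for I
  proof -
    obtain f where f: "\<And>i j. i \<in> I \<Longrightarrow> j \<in> I \<Longrightarrow> f \<bullet> P j = f \<bullet> P i"
      "\<And>i j. i \<in> I \<Longrightarrow> j \<in> {0..n} \<Longrightarrow> j \<notin> I \<Longrightarrow> f \<bullet> P i < f \<bullet> P j"
      using I(1,3) unfolding exposed_indices_def by blast
    obtain i0 where i0: "i0 \<in> I" using I(2) by blast
    define b where "b = f \<bullet> P i0"
    have fb: "f \<bullet> P j = b" if "j \<in> I" for j using f(1)[OF i0 that] by (simp add: b_def)
    have fb': "f \<bullet> P j > b" if "j \<in> {0..n}" "j \<notin> I" for j using f(2)[OF i0 that] by (simp add: b_def)
    have "H \<subseteq> {x. f \<bullet> x \<ge> b}"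
      unfolding H_def
    proof (rule hull_minimal)
      show "P ` {0..n} \<subseteq> {x. b \<le> f \<bullet> x}"
      proof (rule image_subsetI)
        fix j assume "j \<in> {0..n}"
        then show "P j \<in> {x. b \<le> f \<bullet> x}" using fb[of j] fb'[of j] by (cases "j \<in> I") auto
      qed
    qed (rule convex_halfspace_ge)
    then have face: "(H \<inter> {x. f \<bullet> x = b}) face_of H"
      by (intro face_of_Int_supporting_hyperplane_ge) (auto simp: H_def)
    then obtain S' where S': "S' \<subseteq> P ` {0..n}" "H \<inter> {x. f \<bullet> x = b} = convex hull S'"
      using face_of_convex_hull_subset[of "P ` {0..n}" "H \<inter> {x. f \<bullet> x = b}"]
      by (auto simp: H_def finite_imp_compact)
    have "S' \<subseteq> P ` I"
    proof
      fix v assume v: "v \<in> S'"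
      then obtain j where j: "j \<in> {0..n}" "v = P j" using S' by auto
      have "v \<in> convex hull S'" using v by (rule hull_inc)
      then have "f \<bullet> v = b" using S'(2) by blast
      then have "j \<in> I" using fb'[of j] j by force
      then show "v \<in> P ` I" using j by auto
    qed
    then have "convex hull S' \<subseteq> convex hull (P ` I)" by (rule hull_mono)
    moreover have "convex hull (P ` I) \<subseteq> H \<inter> {x. f \<bullet> x = b}"
    proof (rule hull_minimal)
      show "P ` I \<subseteq> H \<inter> {x. f \<bullet> x = b}"
        using I fb by (auto simp: H_def intro: hull_inc)
      show "convex (H \<inter> {x. f \<bullet> x = b})" by (intro convex_Int convex_hyperplane) (simp add: H_def)
    qed
    ultimately have eq: "convex hull (P ` I) = H \<inter> {x. f \<bullet> x = b}" using S' by blast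
    have "I = {i \<in> {0..n}. P i \<in> convex hull (P ` I)}"
    proof (intro equalityI subsetI)
      fix i assume "i \<in> I"
      then show "i \<in> {i \<in> {0..n}. P i \<in> convex hull (P ` I)}" using I by (auto intro: hull_inc)
    next
      fix i assume "i \<in> {i \<in> {0..n}. P i \<in> convex hull (P ` I)}"
      then have "i \<in> {0..n}" "f \<bullet> P i = b" unfolding eq by auto
      then show "i \<in> I" using fb'[of i] by force
    qed
    moreover have "convex hull (P ` I) face_of H" unfolding eq by (rule face)
    ultimately show ?thesis by blast
  qed
  have face: "convex hull (P ` I) face_of H \<and> aff_dim (convex hull (P ` I)) = int q \<and>
      I = {i \<in> {0..n}. P i \<in> convex hull (P ` I)}"
    if I: "I \<in> {I. I \<subseteq> {0..n} \<and> (I = {0..n} \<or> exposed_indices P n I) \<and> aff_dim (P ` I) = int q}" for I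
  proof -
    have d: "aff_dim (convex hull (P ` I)) = int q" using I by (simp add: aff_dim_convex_hull)
    show ?thesis
    proof (cases "I = {0..n}")
      case True
      have "convex hull (P ` I) face_of H" unfolding True H_def by (rule face_of_refl) simp
      moreover have "I = {i \<in> {0..n}. P i \<in> convex hull (P ` I)}"
        unfolding True by (auto intro: hull_inc)
      ultimately show ?thesis using d by blast
    next
      case False
      have "I \<noteq> {}" using d by auto
      then show ?thesis using False I d exposed[of I] by blast
    qed
  qed
  have surj: "\<exists>I\<in>{I. I \<subseteq> {0..n} \<and> (I = {0..n} \<or> exposed_indices P n I) \<and> aff_dim (P ` I) = int q}.
      F = convex hull (P ` I)"
    if F: "F face_of H" "aff_dim F = int q" for F
  proof (cases "F = H")
    case True
    then show ?thesis using F by (intro bexI[of _ "{0..n}"]) (auto simp: H_def aff_dim_convex_hull)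
  next
    case FH: False
    have F0: "F \<noteq> {}" using F(2) by auto
    \<comment> \<open>Every proper nonempty face of a polytope has a supporting hyperplane. The hull
      itself need not have one, hence the separate case \<open>F = H\<close>.\<close>
    have "F exposed_face_of H"
      using exposed_face_of_polyhedron[of H F] F(1) by (simp add: H_def polyhedron_convex_hull)
    then obtain a b where ab: "a \<noteq> 0" "H \<subseteq> {x. a \<bullet> x \<le> b}" "F = H \<inter> {x. a \<bullet> x = b}"
      using FH F0 unfolding exposed_face_of by blast
    define I where "I = {i \<in> {0..n}. a \<bullet> P i = b}"
    have I: "I \<subseteq> {0..n}" by (auto simp: I_def)
    obtain S' where S': "S' \<subseteq> P ` {0..n}" "F = convex hull S'"
      using face_of_convex_hull_subset[of "P ` {0..n}" F] F(1)
      by (auto simp: H_def finite_imp_compact)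
    have "S' \<subseteq> P ` I"
    proof
      fix v assume v: "v \<in> S'"
      then obtain j where j: "j \<in> {0..n}" "v = P j" using S' by auto
      have "v \<in> F" using v S'(2) by (auto intro: hull_inc)
      then show "v \<in> P ` I" using j ab(3) by (auto simp: I_def)
    qed
    then have "F \<subseteq> convex hull (P ` I)" unfolding S'(2) by (rule hull_mono)
    moreover have "convex hull (P ` I) \<subseteq> F"
    proof (rule hull_minimal)
      show "P ` I \<subseteq> F" unfolding ab(3) by (auto simp: I_def H_def intro: hull_inc)
      show "convex F" using F(1) by (rule face_of_imp_convex)
    qed
    ultimately have FI: "F = convex hull (P ` I)" by blast
    have dI: "aff_dim (P ` I) = int q" using F(2) unfolding FI by (simp add: aff_dim_convex_hull)
    have "exposed_indices P n I"
      unfolding exposed_indices_def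
    \<comment> \<open>The functional \<open>a\<close> is maximal on the face, whereas exposed
      indices are defined by a minimum.\<close>
    proof (intro exI[of _ "- a"] conjI ballI)
      show "- a \<noteq> 0" using ab by simp
      fix i j assume ij: "i \<in> I" "j \<in> {0..n}"
      have "P j \<in> H" using ij by (auto simp: H_def intro: hull_inc)
      then have "a \<bullet> P j \<le> b" using ab(2) by auto
      then show "j \<in> I \<longrightarrow> - a \<bullet> P j = - a \<bullet> P i" "j \<notin> I \<longrightarrow> - a \<bullet> P i < - a \<bullet> P j"
        using ij by (auto simp: I_def)
    qed
    then show ?thesis using I FI dI by blast
  qed
  let ?A = "{I. I \<subseteq> {0..n} \<and> (I = {0..n} \<or> exposed_indices P n I) \<and> aff_dim (P ` I) = int q}"
  let ?F = "{F. F face_of H \<and> aff_dim F = int q}"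
  show ?thesis
  proof (rule bij_betw_byWitness[where f' = "\<lambda>F. {i \<in> {0..n}. P i \<in> F}"])
    show "\<forall>I\<in>?A. {i \<in> {0..n}. P i \<in> convex hull (P ` I)} = I"
    proof
      fix I assume "I \<in> ?A"
      from face[OF this] show "{i \<in> {0..n}. P i \<in> convex hull (P ` I)} = I" by simp
    qed
    show "(\<lambda>I. convex hull (P ` I)) ` ?A \<subseteq> ?F"
    proof (rule image_subsetI)
      fix I assume "I \<in> ?A"
      from face[OF this] show "convex hull (P ` I) \<in> ?F" by simp
    qed
    have inv: "{i \<in> {0..n}. P i \<in> F} \<in> ?A \<and> convex hull (P ` {i \<in> {0..n}. P i \<in> F}) = F" if "F \<in> ?F" for F
    proof -
      from that have "F face_of H" "aff_dim F = int q" by simp_all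
      then obtain I where I: "I \<in> ?A" "F = convex hull (P ` I)" by (rule surj[THEN bexE])
      have "{i \<in> {0..n}. P i \<in> F} = I" unfolding I(2) using face[OF I(1)] by simp
      then show ?thesis using I by simp
    qed
    show "\<forall>F\<in>?F. convex hull (P ` {i \<in> {0..n}. P i \<in> F}) = F" using inv by blast
    show "(\<lambda>F. {i \<in> {0..n}. P i \<in> F}) ` ?F \<subseteq> ?A"
      by (rule image_subsetI) (rule inv[THEN conjunct1])
  qed
qed

text \<open>In general position an index set of dimension \<open>q\<close> has exactly
  \<open>Suc q\<close> elements, because any \<open>Suc (Suc q)\<close> of them would already have
  dimension \<open>Suc q\<close>. By \<open>q < n\<close> it is not the whole index set, so it has
  to be exposed.\<close>

lemma card_faces:
  fixes P :: "nat \<Rightarrow> 'e::euclidean_space"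
  assumes gp: "general_position {0..n} X" and P: "\<And>k. k \<le> n \<Longrightarrow> P k = (\<Sum>t\<in>{1..k}. X t)"
    and inj: "inj_on P {0..n}" and q: "DIM('e) = Suc q" "q < n"
  shows "card {F. F face_of convex hull (P ` {0..n}) \<and> aff_dim F = int q} =
    card {I. I \<subseteq> {0..n} \<and> card I = Suc q \<and> exposed_indices P n I}"
proof -
  have adim: "aff_dim (P ` I) = int (card I) - 1" if "I \<subseteq> {0..n}" "card I \<le> Suc (Suc q)" for I
    using general_position_aff_dim[OF gp P _ _ inj] that q by auto
  have cI: "card I = Suc q" if I: "I \<subseteq> {0..n}" and dI: "aff_dim (P ` I) = int q" for I
  proof (rule ccontr)
    assume ne: "card I \<noteq> Suc q"
    show False
    proof (cases "card I \<le> Suc q")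
      case True
      then show False using ne adim[OF I] dI by simp
    next
      case False
      then obtain I' where I': "I' \<subseteq> I" "card I' = Suc (Suc q)"
        using obtain_subset_with_card_n[of "Suc (Suc q)" I] by auto
      have "aff_dim (P ` I') = int (Suc q)" using adim[of I'] I' I by simp
      moreover have "aff_dim (P ` I') \<le> aff_dim (P ` I)" using I' by (intro aff_dim_subset image_mono)
      ultimately show False using dI by simp
    qed
  qed
  have "{I. I \<subseteq> {0..n} \<and> (I = {0..n} \<or> exposed_indices P n I) \<and> aff_dim (P ` I) = int q} =
      {I. I \<subseteq> {0..n} \<and> card I = Suc q \<and> exposed_indices P n I}"
  proof (intro Collect_cong iffI)
    fix I assume I: "I \<subseteq> {0..n} \<and> (I = {0..n} \<or> exposed_indices P n I) \<and> aff_dim (P ` I) = int q"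
    then have "card I = Suc q" using cI by blast
    moreover from this have "I \<noteq> {0..n}" using q(2) by auto
    ultimately show "I \<subseteq> {0..n} \<and> card I = Suc q \<and> exposed_indices P n I" using I by blast
  next
    fix I assume I: "I \<subseteq> {0..n} \<and> card I = Suc q \<and> exposed_indices P n I"
    then have "aff_dim (P ` I) = int q" using adim[of I] by linarith
    then show "I \<subseteq> {0..n} \<and> (I = {0..n} \<or> exposed_indices P n I) \<and> aff_dim (P ` I) = int q"
      using I by blast
  qed
  then show ?thesis using bij_betw_same_card[OF bij_betw_faces[of P n q]] by simp
qed

section \<open>Random steps\<close>

text \<open>The sample is indexed by pairs of a time and a coordinate because the scalar entries are
  the independent variables. The first component is the increment of time.\<close>

definition step_vec :: "(nat \<times> 'p::finite \<Rightarrow> real) \<Rightarrow> nat \<Rightarrow> real \<times> (real ^ 'p)" where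
  "step_vec u t = (1, \<chi> d. u (t, d))"

definition closed_steps :: "nat \<Rightarrow> (nat \<times> 'p::finite \<Rightarrow> real) \<Rightarrow> nat \<Rightarrow> real \<times> (real ^ 'p)" where
  "closed_steps n u = (step_vec u)(0 := - (\<Sum>t\<in>{1..n}. step_vec u t))"

lemma inner_step_vec: "f \<bullet> step_vec u t = fst f + (\<Sum>d\<in>UNIV. snd f $ d * u (t, d))"
  by (cases f) (simp add: step_vec_def inner_Pair inner_vec_def)

text \<open>Subtracting \<open>g 0\<close> eliminates the dependent step \<open>X 0\<close>. The
  level sets of the new coefficients are disjoint blocks, at most \<open>Suc q\<close> of them with
  a nonzero value; division by one such value puts a block sum into the span of at most
  \<open>q\<close> others.\<close>

lemma general_position_if_blocks:
  fixes X :: "nat \<Rightarrow> 'e::euclidean_space"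
  assumes X0: "X 0 = - (\<Sum>t\<in>{1..n}. X t)" and q: "DIM('e) = Suc q"
    and blocks: "\<And>B \<B>. B \<subseteq> {1..n} \<Longrightarrow> B \<noteq> {} \<Longrightarrow> \<B> \<subseteq> Pow {1..n} \<Longrightarrow> (\<And>C. C \<in> \<B> \<Longrightarrow> C \<inter> B = {}) \<Longrightarrow>
      card \<B> \<le> q \<Longrightarrow> (\<Sum>t\<in>B. X t) \<notin> span ((\<lambda>C. \<Sum>t\<in>C. X t) ` \<B>)"
  shows "general_position {0..n} X"
  unfolding general_position_def
proof (intro allI impI, rule ccontr)
  fix g assume g: "(\<Sum>t\<in>{0..n}. g t *\<^sub>R X t) = 0" and c: "card (g ` {0..n}) \<le> Suc DIM('e)"
    and nc: "\<not> card (g ` {0..n}) \<le> 1"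
  define h where "h t = g t - g 0" for t
  have "(\<Sum>t\<in>{0..n}. g t *\<^sub>R X t) = g 0 *\<^sub>R X 0 + (\<Sum>t\<in>{1..n}. g t *\<^sub>R X t)"
    by (simp add: sum.atLeast_Suc_atMost)
  also have "\<dots> = (\<Sum>t\<in>{1..n}. h t *\<^sub>R X t)"
    by (simp add: X0 h_def scaleR_sum_right sum_negf[symmetric] sum.distrib[symmetric] scaleR_diff_left)
  finally have rel: "(\<Sum>t\<in>{1..n}. h t *\<^sub>R X t) = 0" using g by simp
  define V where "V = h ` {1..n} - {0}"
  have finV: "finite V" by (simp add: V_def)
  have "h ` {0..n} = (\<lambda>y. y - g 0) ` g ` {0..n}" by (simp add: h_def image_image)
  then have ch: "card (h ` {0..n}) = card (g ` {0..n})"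
    by (simp add: card_image inj_on_def)
  have "insert 0 V \<subseteq> h ` {0..n}"
  proof -
    have "0 \<in> h ` {0..n}" by (rule image_eqI[of _ _ 0]) (auto simp: h_def)
    then show ?thesis by (auto simp: V_def)
  qed
  then have "card (insert 0 V) \<le> card (h ` {0..n})" by (intro card_mono) auto
  moreover have "card (insert 0 V) = Suc (card V)"
    using finV by (rule card_insert_disjoint) (simp add: V_def)
  ultimately have cV: "card V \<le> Suc q" using ch c q by linarith
  have "V \<noteq> {}"
  proof
    assume V: "V = {}"
    have h0: "h t = 0" if "t \<in> {0..n}" for t
    proof (cases "t = 0")
      case False
      then have "h t \<in> h ` {1..n}" using that by auto
      then show ?thesis using V by (auto simp: V_def)
    qed (simp add: h_def)
    then have "h ` {0..n} \<subseteq> {0}" by auto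
    then have "card (h ` {0..n}) \<le> 1" using card_mono[of "{0}" "h ` {0..n}"] by simp
    then show False using nc ch by simp
  qed
  then obtain v0 where v0: "v0 \<in> V" by blast
  define B where "B v = {t\<in>{1..n}. h t = v}" for v
  define S where "S C = (\<Sum>t\<in>C. X t)" for C
  have "(\<Sum>t\<in>{1..n}. h t *\<^sub>R X t) = (\<Sum>v\<in>insert 0 V. \<Sum>t\<in>B v. h t *\<^sub>R X t)"
    unfolding B_def using finV by (subst sum.group) (auto simp: V_def)
  also have "\<dots> = (\<Sum>v\<in>insert 0 V. v *\<^sub>R S (B v))"
    by (intro sum.cong refl) (auto simp: S_def B_def scaleR_sum_right)
  also have "\<dots> = v0 *\<^sub>R S (B v0) + (\<Sum>v\<in>V - {v0}. v *\<^sub>R S (B v))"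
  proof -
    have "0 \<notin> V" by (simp add: V_def)
    then show ?thesis using finV sum.remove[OF finV v0, of "\<lambda>v. v *\<^sub>R S (B v)"] by simp
  qed
  finally have "v0 *\<^sub>R S (B v0) = - (\<Sum>v\<in>V - {v0}. v *\<^sub>R S (B v))"
    using rel by (simp add: eq_neg_iff_add_eq_0)
  moreover have "v0 \<noteq> 0" using v0 by (simp add: V_def)
  ultimately have "S (B v0) = (1 / v0) *\<^sub>R - (\<Sum>v\<in>V - {v0}. v *\<^sub>R S (B v))"
    by (metis divide_self_if scaleR_one scaleR_scaleR times_divide_eq_left mult_1)
  moreover have "(1 / v0) *\<^sub>R - (\<Sum>v\<in>V - {v0}. v *\<^sub>R S (B v)) \<in> span (S ` B ` (V - {v0}))"
    by (intro span_scale span_neg span_sum span_base) auto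
  ultimately have "S (B v0) \<in> span (S ` B ` (V - {v0}))" by simp
  moreover have "S (B v0) \<notin> span (S ` B ` (V - {v0}))"
    unfolding S_def
  proof (rule blocks)
    show "B v0 \<subseteq> {1..n}" by (auto simp: B_def)
    show "B v0 \<noteq> {}" using v0 by (auto simp: B_def V_def)
    show "B ` (V - {v0}) \<subseteq> Pow {1..n}" by (auto simp: B_def)
    show "C \<inter> B v0 = {}" if "C \<in> B ` (V - {v0})" for C using that by (auto simp: B_def)
    have "card (B ` (V - {v0})) \<le> card (V - {v0})" using finV by (intro card_image_le) auto
    then show "card (B ` (V - {v0})) \<le> q" using cV v0 finV by simp
  qed
  ultimately show False by blast
qed

text \<open>An uncountable existential becomes countable: by continuity a point with value at most 0
  has points of a dense set near it with values below each 1/(m + 1), and conversely the minimum is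
  attained by compactness.\<close>

lemma measurable_exists_compact:
  fixes f :: "'c::euclidean_space \<Rightarrow> 'a \<Rightarrow> real"
  assumes S: "compact S" and cont: "\<And>u. u \<in> space M \<Longrightarrow> continuous_on S (\<lambda>c. f c u)"
    and meas: "\<And>c. c \<in> S \<Longrightarrow> f c \<in> borel_measurable M"
  shows "{u\<in>space M. \<exists>c\<in>S. f c u \<le> 0} \<in> sets M"
proof -
  obtain D where D: "countable D" "D \<subseteq> S" "S \<subseteq> closure D" using separable by blast
  have eq: "(\<exists>c\<in>S. f c u \<le> 0) \<longleftrightarrow> (\<forall>m::nat. \<exists>c\<in>D. f c u < inverse (real (Suc m)))"
    if u: "u \<in> space M" for u
  proof
    assume "\<exists>c\<in>S. f c u \<le> 0"
    then obtain c where c: "c \<in> S" "f c u \<le> 0" by blast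
    show "\<forall>m::nat. \<exists>c\<in>D. f c u < inverse (real (Suc m))"
    proof
      fix m :: nat
      obtain d where d: "d > 0" "\<And>c'. c' \<in> S \<Longrightarrow> dist c' c < d \<Longrightarrow> dist (f c' u) (f c u) < inverse (real (Suc m))"
        using cont[OF u] c(1) unfolding continuous_on_iff
        by (metis inverse_positive_iff_positive of_nat_0_less_iff zero_less_Suc)
      obtain c' where c': "c' \<in> D" "dist c' c < d"
        using c D d unfolding closure_approachable by (meson closure_approachable subsetD)
      then have "dist (f c' u) (f c u) < inverse (real (Suc m))" using d D by blast
      then have "f c' u < inverse (real (Suc m))" using c(2) by (simp add: dist_real_def)
      then show "\<exists>c\<in>D. f c u < inverse (real (Suc m))" using c' by blast
    qed
  next
    assume R: "\<forall>m::nat. \<exists>c\<in>D. f c u < inverse (real (Suc m))"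
    then have "S \<noteq> {}" using D by blast
    then obtain c0 where c0: "c0 \<in> S" "\<And>c. c \<in> S \<Longrightarrow> f c0 u \<le> f c u"
      using continuous_attains_inf[OF S _ cont[OF u]] by blast
    have "f c0 u \<le> 0"
    proof (rule ccontr)
      assume "\<not> f c0 u \<le> 0"
      then obtain m where "inverse (real (Suc m)) < f c0 u" using reals_Archimedean[of "f c0 u"] by auto
      moreover obtain c where "c \<in> D" "f c u < inverse (real (Suc m))" using R by blast
      ultimately show False using c0(2)[of c] D by force
    qed
    then show "\<exists>c\<in>S. f c u \<le> 0" using c0 by blast
  qed
  have "{u\<in>space M. \<exists>c\<in>S. f c u \<le> 0} = (\<Inter>m. \<Union>c\<in>D. {u\<in>space M. f c u < inverse (real (Suc m))})"
    using eq by auto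
  also have "\<dots> \<in> sets M"
  proof -
    have "{u \<in> space M. f c u < inverse (real (Suc m))} \<in> sets M" if "c \<in> D" for c and m :: nat
      using meas[of c] D that by (intro borel_measurable_less) auto
    then have "(\<Union>c\<in>D. {u \<in> space M. f c u < inverse (real (Suc m))}) \<in> sets M" for m :: nat
      using D by (intro sets.countable_UN'') auto
    then show ?thesis by (intro sets.countable_INT) auto
  qed
  finally show ?thesis .
qed

text \<open>A functional that vanishes on the span and is positive at \<open>s\<close> can be
  normalised and given a margin 1/(m + 1). These closed conditions hold iff a nonnegative continuous
  penalty is at most 0, which is the form that \<open>measurable_exists_compact\<close>
  handles.\<close>

lemma not_in_span_iff:
  fixes s :: "'e::euclidean_space"
  assumes fin: "finite I"
  shows "s \<notin> span (v ` I) \<longleftrightarrow> (\<exists>m::nat. \<exists>f\<in>sphere 0 1.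
    (\<Sum>i\<in>I. \<bar>f \<bullet> v i\<bar>) + max 0 (inverse (real (Suc m)) - f \<bullet> s) \<le> 0)"
proof
  assume ns: "s \<notin> span (v ` I)"
  obtain y z where yz: "y \<in> span (v ` I)" "\<And>w. w \<in> span (v ` I) \<Longrightarrow> orthogonal z w" "s = y + z"
    using orthogonal_subspace_decomp_exists by blast
  then have z: "z \<noteq> 0" using ns by auto
  define f where "f = z /\<^sub>R norm z"
  have fv: "f \<bullet> w = 0" if "w \<in> span (v ` I)" for w
    using yz(2)[OF that] by (simp add: f_def orthogonal_def)
  have "f \<bullet> s = norm z"
    using fv[OF yz(1)] z by (simp add: yz(3) inner_add_right f_def power2_norm_eq_inner[symmetric] power2_eq_square)
  then obtain m where m: "inverse (real (Suc m)) < f \<bullet> s" using reals_Archimedean[of "norm z"] z by auto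
  have "(\<Sum>i\<in>I. \<bar>f \<bullet> v i\<bar>) = 0" by (intro sum.neutral ballI) (simp add: fv span_base)
  then show "\<exists>m::nat. \<exists>f\<in>sphere 0 1.
    (\<Sum>i\<in>I. \<bar>f \<bullet> v i\<bar>) + max 0 (inverse (real (Suc m)) - f \<bullet> s) \<le> 0"
    using m z by (intro exI[of _ m] bexI[of _ f]) (auto simp: f_def)
next
  assume "\<exists>m::nat. \<exists>f\<in>sphere 0 1.
    (\<Sum>i\<in>I. \<bar>f \<bullet> v i\<bar>) + max 0 (inverse (real (Suc m)) - f \<bullet> s) \<le> 0"
  then obtain m f where le: "(\<Sum>i\<in>I. \<bar>f \<bullet> v i\<bar>) + max 0 (inverse (real (Suc m)) - f \<bullet> s) \<le> 0" by blast
  have nn: "(\<Sum>i\<in>I. \<bar>f \<bullet> v i\<bar>) \<ge> 0" by (intro sum_nonneg) auto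
  then have "(\<Sum>i\<in>I. \<bar>f \<bullet> v i\<bar>) = 0" using le by linarith
  then have z: "f \<bullet> v i = 0" if "i \<in> I" for i using fin that by (simp add: sum_nonneg_eq_0_iff)
  have "inverse (real (Suc m)) \<le> f \<bullet> s" using le nn by linarith
  moreover have "inverse (real (Suc m)) > 0" by simp
  ultimately have pos: "f \<bullet> s > 0" by linarith
  have "span (v ` I) \<subseteq> {x. f \<bullet> x = 0}" by (rule span_minimal) (auto simp: z subspace_hyperplane)
  then show "s \<notin> span (v ` I)" using pos by auto
qed

lemma measurable_in_span:
  fixes s :: "'a \<Rightarrow> 'e::euclidean_space" and v :: "'i \<Rightarrow> 'a \<Rightarrow> 'e"
  assumes fin: "finite I" and s: "s \<in> borel_measurable M" and v: "\<And>i. i \<in> I \<Longrightarrow> v i \<in> borel_measurable M"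
  shows "{u\<in>space M. s u \<in> span ((\<lambda>i. v i u) ` I)} \<in> sets M"
proof -
  define F where "F m f u = (\<Sum>i\<in>I. \<bar>f \<bullet> v i u\<bar>) + max 0 (inverse (real (Suc m)) - f \<bullet> s u)" for m :: nat and f u
  have "s u \<notin> span ((\<lambda>i. v i u) ` I) \<longleftrightarrow> (\<exists>m. \<exists>f\<in>sphere 0 1. F m f u \<le> 0)" for u
    unfolding F_def by (rule not_in_span_iff[OF fin, where v = "\<lambda>i. v i u"])
  then have "{u\<in>space M. s u \<in> span ((\<lambda>i. v i u) ` I)} =
     space M - (\<Union>m::nat. {u\<in>space M. \<exists>f\<in>sphere 0 1. F m f u \<le> 0})"
    by blast
  also have "\<dots> \<in> sets M"
  proof (intro sets.Diff sets.top sets.countable_UN image_subsetI measurable_exists_compact)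
    show "continuous_on (sphere 0 1) (\<lambda>f. F m f u)" for m u
      unfolding F_def by (intro continuous_intros)
    show "F m f \<in> borel_measurable M" for m f
      unfolding F_def using s v by measurable
  qed auto
  finally show ?thesis .
qed

text \<open>Vectors are added one by one; the dimension grows exactly when the new one is outside
  the span of the previous ones, which is a measurable event.\<close>

lemma measurable_dim:
  fixes v :: "'i \<Rightarrow> 'a \<Rightarrow> 'e::euclidean_space"
  assumes "finite I" "\<And>i. i \<in> I \<Longrightarrow> v i \<in> borel_measurable M"
  shows "(\<lambda>u. dim ((\<lambda>i. v i u) ` I)) \<in> measurable M (count_space UNIV)"
  using assms
proof (induction I rule: finite_induct)
  case empty
  then show ?case by simp
next
  case (insert i I)
  have "{u\<in>space M. v i u \<in> span ((\<lambda>i. v i u) ` I)} \<in> sets M"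
    using insert by (intro measurable_in_span) auto
  moreover have "(\<lambda>u. dim ((\<lambda>i. v i u) ` I)) \<in> measurable M (count_space UNIV)"
    using insert by simp
  ultimately have "(\<lambda>u. if v i u \<in> span ((\<lambda>i. v i u) ` I) then dim ((\<lambda>i. v i u) ` I)
      else dim ((\<lambda>i. v i u) ` I) + 1) \<in> measurable M (count_space UNIV)"
    by (intro measurable_If) auto
  then show ?case by (simp only: image_insert dim_insert)
qed

lemma measurable_aff_dim:
  fixes P :: "'a \<Rightarrow> nat \<Rightarrow> 'e::euclidean_space"
  assumes I: "I \<subseteq> {0..n}" and P: "\<And>i. i \<le> n \<Longrightarrow> (\<lambda>u. P u i) \<in> borel_measurable M"
  shows "{u\<in>space M. aff_dim (P u ` I) = k} \<in> sets M"
proof (cases "I = {}")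
  case True
  then show ?thesis by simp
next
  case False
  then obtain i0 where i0: "i0 \<in> I" by blast
  have "aff_dim (P u ` I) = int (dim ((\<lambda>i. P u i - P u i0) ` I))" for u
  proof -
    have "aff_dim (P u ` I) = int (dim ((+) (- P u i0) ` P u ` I))"
      using i0 by (intro aff_dim_eq_dim hull_inc) auto
    also have "(+) (- P u i0) ` P u ` I = (\<lambda>i. P u i - P u i0) ` I" by (simp add: image_image)
    finally show ?thesis .
  qed
  moreover have "(\<lambda>u. dim ((\<lambda>i. P u i - P u i0) ` I)) \<in> measurable M (count_space UNIV)"
  proof (rule measurable_dim)
    show "finite I" using I finite_subset by blast
    have "i \<le> n" if "i \<in> I" for i using that I by auto
    then show "(\<lambda>u. P u i - P u i0) \<in> borel_measurable M" if "i \<in> I" for i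
      using that i0 by (intro borel_measurable_diff P)
  qed
  ultimately show ?thesis by simp
qed

text \<open>The penalty of \<open>not_in_span_iff\<close> again, now for equality on
  \<open>I\<close> and a margin off \<open>I\<close>. There are finitely many gaps, so a margin that
  works for all of them exists.\<close>

lemma exposed_indices_iff_compact:
  fixes P :: "nat \<Rightarrow> 'e::euclidean_space"
  assumes I: "I \<subseteq> {0..n}"
  shows "exposed_indices P n I \<longleftrightarrow> (\<exists>m::nat. \<exists>f\<in>sphere 0 1.
     (\<Sum>i\<in>I \<inter> {0..n}. \<Sum>j\<in>{0..n}. if j \<in> I then \<bar>f \<bullet> P j - f \<bullet> P i\<bar>
        else max 0 (inverse (real (Suc m)) - (f \<bullet> P j - f \<bullet> P i))) \<le> 0)"
    (is "?L \<longleftrightarrow> ?R")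
proof -
  define G where "G m f i j = (if j \<in> I then \<bar>f \<bullet> P j - f \<bullet> P i\<bar>
        else max 0 (inverse (real (Suc m)) - (f \<bullet> P j - f \<bullet> P i)))" for m :: nat and f i j
  have G0: "G m f i j \<ge> 0" for m f i j by (simp add: G_def)
  have fin: "finite I" using I finite_subset by blast
  have II: "I \<inter> {0..n} = I" using I by auto
  have "?R" if "?L"
  proof -
    from that obtain f where f: "f \<noteq> 0" "\<And>i j. i \<in> I \<Longrightarrow> j \<in> {0..n} \<Longrightarrow> j \<in> I \<Longrightarrow> f \<bullet> P j = f \<bullet> P i"
      "\<And>i j. i \<in> I \<Longrightarrow> j \<in> {0..n} \<Longrightarrow> j \<notin> I \<Longrightarrow> f \<bullet> P i < f \<bullet> P j"
      unfolding exposed_indices_def by blast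
    define r where "r = f /\<^sub>R norm f"
    define D where "D = (\<lambda>(i, j). r \<bullet> P j - r \<bullet> P i) ` (I \<times> ({0..n} - I))"
    have npos: "norm f > 0" using f(1) by simp
    \<comment> \<open>The added 1 keeps the minimum meaningful when there are no gaps.\<close>
    have Dpos: "\<forall>d\<in>insert 1 D. d > 0"
      using f(3) npos by (auto simp: D_def r_def divide_strict_right_mono field_simps)
    have finD: "finite (insert 1 D)" using fin by (simp add: D_def)
    then have "Min (insert 1 D) > 0" using Dpos Min_in[OF finD] by blast
    then obtain m where m: "inverse (real (Suc m)) < Min (insert 1 D)" using reals_Archimedean by blast
    have "G m r i j = 0" if ij: "i \<in> I" "j \<in> {0..n}" for i j
    proof (cases "j \<in> I")
      case True
      then show ?thesis using f(2)[OF ij True] by (simp add: G_def r_def)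
    next
      case False
      then have "r \<bullet> P j - r \<bullet> P i \<in> insert 1 D" using ij by (auto simp: D_def)
      then have "inverse (real (Suc m)) < r \<bullet> P j - r \<bullet> P i" using m Min_le[OF finD] by fastforce
      then show ?thesis using False by (simp add: G_def)
    qed
    then have "(\<Sum>i\<in>I. \<Sum>j\<in>{0..n}. G m r i j) = 0" by (intro sum.neutral ballI) auto
    moreover have "r \<in> sphere 0 1" using f(1) by (simp add: r_def)
    ultimately show ?thesis
      unfolding II G_def by (intro exI[of _ m] bexI[of _ r]) auto
  qed
  moreover have "?L" if "?R"
  proof -
    from that obtain m f where f: "f \<in> sphere 0 1" and le: "(\<Sum>i\<in>I. \<Sum>j\<in>{0..n}. G m f i j) \<le> 0"
      unfolding II G_def by blast
    then have "(\<Sum>i\<in>I. \<Sum>j\<in>{0..n}. G m f i j) = 0" using G0 by (intro antisym sum_nonneg) auto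
    then have "\<forall>i\<in>I. (\<Sum>j\<in>{0..n}. G m f i j) = 0"
      using fin G0 by (subst (asm) sum_nonneg_eq_0_iff) (auto intro: sum_nonneg)
    then have z: "G m f i j = 0" if "i \<in> I" "j \<in> {0..n}" for i j
      using that G0 sum_nonneg_eq_0_iff[of "{0..n}" "G m f i"] by auto
    have "f \<bullet> P j = f \<bullet> P i" if "i \<in> I" "j \<in> {0..n}" "j \<in> I" for i j
      using z[OF that(1,2)] that(3) by (simp add: G_def)
    moreover have "f \<bullet> P i < f \<bullet> P j" if "i \<in> I" "j \<in> {0..n}" "j \<notin> I" for i j
    proof -
      have "inverse (real (Suc m)) - (f \<bullet> P j - f \<bullet> P i) \<le> 0" using z[OF that(1,2)] that(3) by (simp add: G_def max_def split: if_splits)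
      moreover have "inverse (real (Suc m)) > 0" by simp
      ultimately show ?thesis by linarith
    qed
    moreover have "f \<noteq> 0" using f by auto
    ultimately show ?thesis unfolding exposed_indices_def by blast
  qed
  ultimately show ?thesis by blast
qed

lemma measurable_exposed_indices:
  fixes P :: "'a \<Rightarrow> nat \<Rightarrow> 'e::euclidean_space"
  assumes I: "I \<subseteq> {0..n}" and P: "\<And>i. i \<le> n \<Longrightarrow> (\<lambda>u. P u i) \<in> borel_measurable M"
  shows "{u\<in>space M. exposed_indices (P u) n I} \<in> sets M"
proof -
  define F where "F m f u = (\<Sum>i\<in>I \<inter> {0..n}. \<Sum>j\<in>{0..n}. if j \<in> I then \<bar>f \<bullet> P u j - f \<bullet> P u i\<bar>
        else max 0 (inverse (real (Suc m)) - (f \<bullet> P u j - f \<bullet> P u i)))" for m :: nat and f u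
  have "{u\<in>space M. exposed_indices (P u) n I} = (\<Union>m::nat. {u\<in>space M. \<exists>f\<in>sphere 0 1. F m f u \<le> 0})"
    unfolding exposed_indices_iff_compact[OF I] F_def by auto
  also have "\<dots> \<in> sets M"
  proof (intro sets.countable_UN image_subsetI measurable_exists_compact)
    show "continuous_on (sphere 0 1) (\<lambda>f. F m f u)" for m u
    proof -
      have "continuous_on (sphere 0 1) (\<lambda>f. if j \<in> I then \<bar>f \<bullet> P u j - f \<bullet> P u i\<bar>
        else max 0 (inverse (real (Suc m)) - (f \<bullet> P u j - f \<bullet> P u i)))" for i j
        by (cases "j \<in> I") (auto intro!: continuous_intros)
      then show ?thesis unfolding F_def by (intro continuous_on_sum)
    qed
    show "F m f \<in> borel_measurable M" for m f
      unfolding F_def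
    proof (intro borel_measurable_sum)
      fix i j assume "i \<in> I \<inter> {0..n}" "j \<in> {0..n}"
      then have "(\<lambda>u. P u i) \<in> borel_measurable M" "(\<lambda>u. P u j) \<in> borel_measurable M" using P by auto
      then show "(\<lambda>u. if j \<in> I then \<bar>f \<bullet> P u j - f \<bullet> P u i\<bar>
        else max 0 (inverse (real (Suc m)) - (f \<bullet> P u j - f \<bullet> P u i))) \<in> borel_measurable M"
        by (cases "j \<in> I") auto
    qed
  qed auto
  finally show ?thesis .
qed

section \<open>Laws without atoms and almost sure general position\<close>

locale diffuse_law = prob_space \<mu> for \<mu> :: "real measure" +
  assumes sets_eq [measurable_cong, simp]: "sets \<mu> = sets borel"
    and atomless: "emeasure \<mu> {a} = 0"
begin

text \<open>With the other coordinates fixed, the equation leaves a single value for coordinate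
  \<open>j0\<close>, which has measure 0; Fubini concludes.\<close>

lemma emeasure_affine_zero:
  fixes J :: "'j set"
  assumes J: "finite J" and j0: "j0 \<in> J" "a j0 \<noteq> 0"
  shows "emeasure (PiM J (\<lambda>_. \<mu>)) {y\<in>space (PiM J (\<lambda>_. \<mu>)). b + (\<Sum>j\<in>J. a j * y j) = 0} = 0"
proof -
  interpret P: product_prob_space "\<lambda>_::'j. \<mu>" by standard
  define J' where "J' = J - {j0}"
  have J': "finite J'" "j0 \<notin> J'" "J = insert j0 J'" using J j0 by (auto simp: J'_def)
  define A where "A = {y\<in>space (PiM J (\<lambda>_. \<mu>)). b + (\<Sum>j\<in>J. a j * y j) = 0}"
  have A: "A \<in> sets (PiM J (\<lambda>_. \<mu>))"
    unfolding A_def by measurable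
  have "emeasure (PiM J (\<lambda>_. \<mu>)) A = (\<integral>\<^sup>+y. indicator A y \<partial>PiM (insert j0 J') (\<lambda>_. \<mu>))"
    using A J' by simp
  also have "\<dots> = (\<integral>\<^sup>+x. (\<integral>\<^sup>+y. indicator A (x(j0 := y)) \<partial>\<mu>) \<partial>PiM J' (\<lambda>_. \<mu>))"
    using A J' by (intro P.product_nn_integral_insert) auto
  also have "\<dots> = (\<integral>\<^sup>+x. 0 \<partial>PiM J' (\<lambda>_. \<mu>))"
  proof (rule nn_integral_cong)
    fix x
    let ?c = "- (b + (\<Sum>j\<in>J'. a j * x j)) / a j0"
    have "indicator A (x(j0 := y)) \<le> (indicator {?c} y :: ennreal)" for y
    proof (cases "x(j0 := y) \<in> A")
      case True
      have "(\<Sum>j\<in>J'. a j * (x(j0 := y)) j) = (\<Sum>j\<in>J'. a j * x j)"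
        using J' by (intro sum.cong) auto
      then have "b + (a j0 * y + (\<Sum>j\<in>J'. a j * x j)) = 0"
        using True J' by (simp add: A_def)
      then have "y = ?c" using j0(2) by (simp add: field_simps)
      then show ?thesis by (simp add: indicator_def)
    qed simp
    then have "(\<integral>\<^sup>+y. indicator A (x(j0 := y)) \<partial>\<mu>) \<le> (\<integral>\<^sup>+y. indicator {?c} y \<partial>\<mu>)"
      by (intro nn_integral_mono)
    then show "(\<integral>\<^sup>+y. indicator A (x(j0 := y)) \<partial>\<mu>) = 0" using atomless by simp
  qed
  finally show ?thesis by (simp add: A_def)
qed

lemma measurable_step_vec:
  assumes "t \<in> {1..n}"
  shows "(\<lambda>u. step_vec u t) \<in> borel_measurable (PiM ({1..n} \<times> (UNIV::'p::finite set)) (\<lambda>_. \<mu>))"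
proof -
  have "(\<lambda>u. step_vec u t \<bullet> f) \<in> borel_measurable (PiM ({1..n} \<times> (UNIV::'p set)) (\<lambda>_. \<mu>))" for f
  proof -
    have "(\<lambda>u. u (t, d)) \<in> borel_measurable (PiM ({1..n} \<times> (UNIV::'p set)) (\<lambda>_. \<mu>))" for d
      using assms measurable_component_singleton[of "(t, d)" "{1..n} \<times> UNIV" "\<lambda>_. \<mu>"]
      by (simp add: measurable_cong_sets[OF refl sets_eq])
    then show ?thesis unfolding inner_commute[of _ f] inner_step_vec by (intro borel_measurable_add borel_measurable_sum borel_measurable_times) auto
  qed
  then show ?thesis by (subst borel_measurable_euclidean_space) blast
qed

text \<open>A time \<open>t0\<close> in \<open>B\<close> occurs in no other block. Given all steps
  except this one, the other block sums lie in a hyperplane with normal \<open>f\<close>, and the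
  bad event forces an affine equation for the coordinates of step \<open>t0\<close>. Its solutions
  are null if \<open>f\<close> sees these coordinates; if \<open>f\<close> sees only time, there are
  none.\<close>

lemma AE_block_not_in_span:
  fixes B :: "nat set" and \<B> :: "nat set set"
  assumes B: "B \<subseteq> {1..n}" "B \<noteq> {}" and \<B>: "\<B> \<subseteq> Pow {1..n}" "\<And>C. C \<in> \<B> \<Longrightarrow> C \<inter> B = {}"
    and card: "card \<B> \<le> CARD('p::finite)"
  shows "AE u in PiM ({1..n} \<times> (UNIV::'p set)) (\<lambda>_. \<mu>).
    (\<Sum>t\<in>B. step_vec u t) \<notin> span ((\<lambda>C. \<Sum>t\<in>C. step_vec u t) ` \<B>)"
proof -
  interpret P: product_prob_space "\<lambda>_::nat \<times> 'p. \<mu>" by standard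
  define J where "J = {1..n} \<times> (UNIV::'p set)"
  define K where "K = PiM J (\<lambda>_. \<mu>)"
  have finB: "finite \<B>" "finite B" using \<B> B finite_subset by (blast intro: finite_subset[OF \<B>(1)] finite_subset[OF B(1)])+
  obtain t0 where t0: "t0 \<in> B" using B by blast
  define J0 where "J0 = {t0} \<times> (UNIV::'p set)"
  define J1 where "J1 = ({1..n} - {t0}) \<times> (UNIV::'p set)"
  have J: "J = J1 \<union> J0" "J1 \<inter> J0 = {}" "finite J0" "finite J1"
    using t0 B by (auto simp: J_def J0_def J1_def)
  define bad where "bad = {u\<in>space K. (\<Sum>t\<in>B. step_vec u t) \<in> span ((\<lambda>C. \<Sum>t\<in>C. step_vec u t) ` \<B>)}"
  have bad: "bad \<in> sets K"
    unfolding bad_def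
  proof (rule measurable_in_span[OF finB(1)])
    show "(\<lambda>u. \<Sum>t\<in>B. step_vec u t) \<in> borel_measurable K"
      unfolding K_def J_def using B by (intro borel_measurable_sum measurable_step_vec) auto
    show "(\<lambda>u. \<Sum>t\<in>C. step_vec u t) \<in> borel_measurable K" if "C \<in> \<B>" for C
      unfolding K_def J_def using \<B>(1) that by (intro borel_measurable_sum measurable_step_vec) blast
  qed
  have "emeasure K bad = (\<integral>\<^sup>+u. indicator bad u \<partial>K)" using bad by simp
  also have "\<dots> = (\<integral>\<^sup>+z. (\<integral>\<^sup>+y. indicator bad (merge J1 J0 (z, y)) \<partial>PiM J0 (\<lambda>_. \<mu>)) \<partial>PiM J1 (\<lambda>_. \<mu>))"
    unfolding K_def J(1) using J bad by (intro P.product_nn_integral_fold) (auto simp: K_def)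
  also have "\<dots> = (\<integral>\<^sup>+z. 0 \<partial>PiM J1 (\<lambda>_. \<mu>))"
  proof (rule nn_integral_cong)
    \<comment> \<open>The normal \<open>f\<close> depends on \<open>z\<close>, but the inner
      integral vanishes for each \<open>z\<close> separately, so its choice need not be
      measurable.\<close>
    fix z :: "nat \<times> 'p \<Rightarrow> real"
    define v where "v C = (\<Sum>t\<in>C. step_vec z t)" for C
    have "dim (v ` \<B>) \<le> card \<B>"
      using dim_le_card'[of "v ` \<B>"] card_image_le[OF finB(1), of v] finB by simp
    also have "\<dots> < DIM(real \<times> (real ^ 'p))" using card by simp
    finally obtain f where f: "f \<noteq> 0" "\<And>x. x \<in> span (v ` \<B>) \<Longrightarrow> orthogonal f x"
      using orthogonal_to_subspace_exists by blast
    have step1: "step_vec (merge J1 J0 (z, y)) t = step_vec z t" if "t \<in> {1..n} - {t0}" for t y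
    proof -
      have "merge J1 J0 (z, y) (t, d) = z (t, d)" for d using that by (simp add: merge_def J1_def)
      then show ?thesis by (simp add: step_vec_def)
    qed
    have step0: "step_vec (merge J1 J0 (z, y)) t0 = step_vec y t0" for y
    proof -
      have "merge J1 J0 (z, y) (t0, d) = y (t0, d)" for d by (simp add: merge_def J1_def J0_def)
      then show ?thesis by (simp add: step_vec_def)
    qed
    have vC: "(\<lambda>C. \<Sum>t\<in>C. step_vec (merge J1 J0 (z, y)) t) ` \<B> = v ` \<B>" for y
    proof (rule image_cong[OF refl])
      fix C assume "C \<in> \<B>"
      then have "C \<subseteq> {1..n} - {t0}" using \<B> t0 by blast
      then show "(\<Sum>t\<in>C. step_vec (merge J1 J0 (z, y)) t) = v C"
        unfolding v_def by (intro sum.cong refl step1) auto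
    qed
    have vB: "(\<Sum>t\<in>B. step_vec (merge J1 J0 (z, y)) t) = step_vec y t0 + v (B - {t0})" for y
    proof -
      have "(\<Sum>t\<in>B - {t0}. step_vec (merge J1 J0 (z, y)) t) = v (B - {t0})"
        unfolding v_def using B by (intro sum.cong refl step1) auto
      then show ?thesis using sum.remove[OF finB(2) t0, of "step_vec (merge J1 J0 (z, y))"] step0 by simp
    qed
    define b where "b = fst f + f \<bullet> v (B - {t0})"
    define a where "a = (\<lambda>(t::nat, d). snd f $ d)"
    have suma: "(\<Sum>j\<in>J0. a j * y j) = (\<Sum>d\<in>UNIV. snd f $ d * y (t0, d))" for y
    proof -
      have "J0 = Pair t0 ` UNIV" by (auto simp: J0_def)
      then show ?thesis by (simp add: sum.reindex inj_on_def a_def)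
    qed
    have in_bad: "b + (\<Sum>j\<in>J0. a j * y j) = 0" if "merge J1 J0 (z, y) \<in> bad" for y
    proof -
      have "(\<Sum>t\<in>B. step_vec (merge J1 J0 (z, y)) t) \<in>
          span ((\<lambda>C. \<Sum>t\<in>C. step_vec (merge J1 J0 (z, y)) t) ` \<B>)"
        using that unfolding bad_def by blast
      then have "step_vec y t0 + v (B - {t0}) \<in> span (v ` \<B>)" unfolding vC vB .
      then have "f \<bullet> step_vec y t0 + f \<bullet> v (B - {t0}) = 0"
        using f(2)[unfolded orthogonal_def] by (simp only: inner_add_right[symmetric])
      then show ?thesis by (simp add: inner_step_vec b_def suma)
    qed
    have "(\<integral>\<^sup>+y. indicator bad (merge J1 J0 (z, y)) \<partial>PiM J0 (\<lambda>_. \<mu>)) \<le>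
        (\<integral>\<^sup>+y. indicator {y\<in>space (PiM J0 (\<lambda>_. \<mu>)). b + (\<Sum>j\<in>J0. a j * y j) = 0} y \<partial>PiM J0 (\<lambda>_. \<mu>))"
      by (intro nn_integral_mono) (auto simp: indicator_def in_bad)
    also have "\<dots> = emeasure (PiM J0 (\<lambda>_. \<mu>)) {y\<in>space (PiM J0 (\<lambda>_. \<mu>)). b + (\<Sum>j\<in>J0. a j * y j) = 0}"
    proof (rule nn_integral_indicator)
      show "{y\<in>space (PiM J0 (\<lambda>_. \<mu>)). b + (\<Sum>j\<in>J0. a j * y j) = 0} \<in> sets (PiM J0 (\<lambda>_. \<mu>))"
        by measurable
    qed
    also have "\<dots> = 0"
    proof (cases "snd f = 0")
      case False
      then obtain d where "snd f $ d \<noteq> 0" by (auto simp: vec_eq_iff)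
      then show ?thesis
        by (intro emeasure_affine_zero[of J0 "(t0, d)"]) (auto simp: J(3) J0_def a_def)
    next
      case True
      then have f0: "fst f \<noteq> 0" using f(1) by (metis prod.collapse zero_prod_def)
      have "f \<bullet> v C = fst f * real (card C)" for C
        using True by (simp add: v_def inner_sum_right inner_step_vec)
      \<comment> \<open>Each step advances time by 1, so the equation reads \<open>fst f\<close>
        times the number of elements of \<open>B\<close> equals 0.\<close>
      then have "b = fst f * (1 + real (card (B - {t0})))" by (simp add: b_def algebra_simps)
      moreover have "1 + real (card (B - {t0})) \<noteq> 0" by (simp add: add_eq_0_iff)
      ultimately have "b \<noteq> 0" using f0 by simp
      moreover have "(\<Sum>j\<in>J0. a j * y j) = 0" for y using True by (intro sum.neutral) (auto simp: a_def)
      ultimately have "{y\<in>space (PiM J0 (\<lambda>_. \<mu>)). b + (\<Sum>j\<in>J0. a j * y j) = 0} = {}" by simp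
      then show ?thesis by (simp only: emeasure_empty)
    qed
    finally show "(\<integral>\<^sup>+y. indicator bad (merge J1 J0 (z, y)) \<partial>PiM J0 (\<lambda>_. \<mu>)) = 0" by simp
  qed
  finally have "emeasure K bad = 0" by simp
  then have "AE u in K. \<not> (\<Sum>t\<in>B. step_vec u t) \<in> span ((\<lambda>C. \<Sum>t\<in>C. step_vec u t) ` \<B>)"
    using bad by (intro AE_I[of _ _ bad]) (auto simp: bad_def)
  then show ?thesis unfolding K_def J_def .
qed

text \<open>Only finitely many families of blocks occur in
  \<open>general_position_if_blocks\<close>, so their exceptional null sets can be united.\<close>

lemma AE_general_position:
  "AE u in PiM ({1..n} \<times> (UNIV::'p::finite set)) (\<lambda>_. \<mu>). general_position {0..n} (closed_steps n u)"
proof -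
  define T where "T = {(B, \<B>). B \<subseteq> {1..n} \<and> B \<noteq> {} \<and> \<B> \<subseteq> Pow {1..n} \<and> (\<forall>C\<in>\<B>. C \<inter> B = {}) \<and> card \<B> \<le> CARD('p)}"
  have "finite T" by (rule finite_subset[of _ "Pow {1..n} \<times> Pow (Pow {1..n})"]) (auto simp: T_def)
  then have "AE u in PiM ({1..n} \<times> (UNIV::'p set)) (\<lambda>_. \<mu>). \<forall>p\<in>T.
      (\<Sum>t\<in>fst p. step_vec u t) \<notin> span ((\<lambda>C. \<Sum>t\<in>C. step_vec u t) ` snd p)"
  proof (rule AE_finite_allI)
    fix p assume "p \<in> T"
    moreover obtain B \<B> where "p = (B, \<B>)" by force
    ultimately have p: "p = (B, \<B>)" "B \<subseteq> {1..n}" "B \<noteq> {}" "\<B> \<subseteq> Pow {1..n}" "\<And>C. C \<in> \<B> \<Longrightarrow> C \<inter> B = {}"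
       "card \<B> \<le> CARD('p)" by (simp_all add: T_def)
    show "AE u in PiM ({1..n} \<times> (UNIV::'p set)) (\<lambda>_. \<mu>).
      (\<Sum>t\<in>fst p. step_vec u t) \<notin> span ((\<lambda>C. \<Sum>t\<in>C. step_vec u t) ` snd p)"
      unfolding p(1) fst_conv snd_conv by (rule AE_block_not_in_span[OF p(2-6)])
  qed
  then show ?thesis
  proof (rule AE_mp, intro AE_I2 impI)
    fix u :: "nat \<times> 'p \<Rightarrow> real"
    assume u: "\<forall>p\<in>T. (\<Sum>t\<in>fst p. step_vec u t) \<notin> span ((\<lambda>C. \<Sum>t\<in>C. step_vec u t) ` snd p)"
    have cs: "(\<Sum>t\<in>C. closed_steps n u t) = (\<Sum>t\<in>C. step_vec u t)" if "C \<subseteq> {1..n}" for C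
      using that by (intro sum.cong) (auto simp: closed_steps_def)
    show "general_position {0..n} (closed_steps n u)"
    proof (rule general_position_if_blocks[where q = "CARD('p)"])
      show "closed_steps n u 0 = - (\<Sum>t\<in>{1..n}. closed_steps n u t)"
        using cs[of "{1..n}"] by (simp add: closed_steps_def)
      show "DIM(real \<times> (real ^ 'p)) = Suc CARD('p)" by simp
      fix B \<B> assume B: "B \<subseteq> {1..n}" "B \<noteq> {}" "\<B> \<subseteq> Pow {1..n}" "\<And>C. C \<in> \<B> \<Longrightarrow> C \<inter> B = {}"
        "card \<B> \<le> CARD('p)"
      have "(\<lambda>C. \<Sum>t\<in>C. closed_steps n u t) ` \<B> = (\<lambda>C. \<Sum>t\<in>C. step_vec u t) ` \<B>"
        using B(3) by (intro image_cong refl cs) auto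
      moreover have "(B, \<B>) \<in> T" using B by (auto simp: T_def)
      ultimately show "(\<Sum>t\<in>B. closed_steps n u t) \<notin> span ((\<lambda>C. \<Sum>t\<in>C. closed_steps n u t) ` \<B>)"
        using u B(1) cs by force
    qed
  qed
qed

section \<open>Exchangeability and expected counts\<close>

lemma measurable_walk:
  assumes w: "w \<in> permutations_of_set {1..n}"
  shows "(\<lambda>u. walk (closed_steps n u) w k) \<in> borel_measurable (PiM ({1..n} \<times> (UNIV::'p::finite set)) (\<lambda>_. \<mu>))"
proof -
  have sub: "set (take k w) \<subseteq> {1..n}" using w by (auto dest: permutations_of_setD in_set_takeD)
  have "distinct (take k w)" using w by (auto dest: permutations_of_setD)
  then have "walk (closed_steps n u) w k = (\<Sum>t\<in>set (take k w). step_vec u t)" for u :: "nat \<times> 'p \<Rightarrow> real"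
    using sub by (auto simp: walk_def sum_list_distinct_conv_sum_set closed_steps_def intro!: sum.cong)
  then show ?thesis
    by (simp only:, intro borel_measurable_sum measurable_step_vec) (use sub in blast)
qed

lemma measurable_exposed_walk:
  assumes w: "w \<in> permutations_of_set {1..n}" and I: "I \<subseteq> {0..n}"
  shows "{u\<in>space (PiM ({1..n} \<times> (UNIV::'p::finite set)) (\<lambda>_. \<mu>)).
    exposed_indices (walk (closed_steps n u) w) n I} \<in> sets (PiM ({1..n} \<times> (UNIV::'p set)) (\<lambda>_. \<mu>))"
  using measurable_exposed_indices[OF I measurable_walk[OF w]] .

definition exposed_count :: "nat \<Rightarrow> nat \<Rightarrow> nat list \<Rightarrow> (nat \<times> 'p::finite \<Rightarrow> real) \<Rightarrow> real" where
  "exposed_count n q w u = real (card {I. I \<subseteq> {0..n} \<and> card I = Suc q \<and>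
     exposed_indices (walk (closed_steps n u) w) n I})"

lemma exposed_count_eq_sum:
  assumes "u \<in> space K"
  shows "exposed_count n q w u = (\<Sum>I\<in>{I. I \<subseteq> {0..n} \<and> card I = Suc q}.
     indicator {u\<in>space K. exposed_indices (walk (closed_steps n u) w) n I} u)"
proof -
  let ?T = "{I. I \<subseteq> {0..n} \<and> card I = Suc q}"
  have fin: "finite ?T" by (rule finite_subset[of _ "Pow {0..n}"]) auto
  have "(\<Sum>I\<in>?T. indicator {u\<in>space K. exposed_indices (walk (closed_steps n u) w) n I} u) =
    (\<Sum>I\<in>?T. if exposed_indices (walk (closed_steps n u) w) n I then 1 else (0::real))"
    using assms by (intro sum.cong) auto
  also have "\<dots> = real (card {I \<in> ?T. exposed_indices (walk (closed_steps n u) w) n I})"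
    using fin by (simp add: sum.If_cases Int_def)
  finally show ?thesis by (simp add: exposed_count_def conj_assoc)
qed

lemma integrable_exposed_count:
  assumes w: "w \<in> permutations_of_set {1..n}"
  shows "integrable (PiM ({1..n} \<times> (UNIV::'p::finite set)) (\<lambda>_. \<mu>)) (exposed_count n q w)"
proof -
  interpret P: product_prob_space "\<lambda>_::nat \<times> 'p. \<mu>" by standard
  let ?K = "PiM ({1..n} \<times> (UNIV::'p set)) (\<lambda>_. \<mu>)"
  interpret K: prob_space ?K by (rule prob_space_PiM) (rule prob_space_axioms)
  have "integrable ?K (\<lambda>u. \<Sum>I\<in>{I. I \<subseteq> {0..n} \<and> card I = Suc q}.
     indicator {u\<in>space ?K. exposed_indices (walk (closed_steps n u) w) n I} u :: real)"
    using measurable_exposed_walk[OF w]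
    by (intro Bochner_Integration.integrable_sum integrable_real_indicator) (auto simp: K.emeasure_eq_measure simp del: One_nat_def)
  then show ?thesis
    by (subst Bochner_Integration.integrable_cong[OF refl exposed_count_eq_sum]) auto
qed

text \<open>Reading the steps in the order \<open>w\<close> amounts to reindexing the sample by an
  injection of its index set into itself, and a product of equal measures is invariant under
  that.\<close>

lemma integral_exposed_count_permute:
  assumes w: "w \<in> permutations_of_set {1..n}"
  shows "(\<integral>u. exposed_count n q w u \<partial>PiM ({1..n} \<times> (UNIV::'p::finite set)) (\<lambda>_. \<mu>)) =
    (\<integral>u. exposed_count n q [1..<Suc n] u \<partial>PiM ({1..n} \<times> (UNIV::'p set)) (\<lambda>_. \<mu>))"
proof -
  let ?J = "{1..n} \<times> (UNIV::'p set)"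
  let ?K = "PiM ?J (\<lambda>_. \<mu>)"
  have wl: "length w = n" "set w = {1..n}" "distinct w"
    using w length_finite_permutations_of_set[OF w] by (auto dest: permutations_of_setD)
  \<comment> \<open>Times start at 1 and list positions at 0, hence \<open>t - 1\<close>.\<close>
  define \<pi> where "\<pi> = (\<lambda>(t::nat, d::'p). (w ! (t - 1), d))"
  have \<pi>: "inj_on \<pi> ?J" "\<pi> \<in> ?J \<rightarrow> ?J"
  proof -
    show "inj_on \<pi> ?J"
      using wl by (auto simp: inj_on_def \<pi>_def nth_eq_iff_index_eq)
    have "w ! (t - 1) \<in> {1..n}" if "t \<in> {1..n}" for t
      unfolding wl(2)[symmetric] using that wl(1) by (intro nth_mem) auto
    then show "\<pi> \<in> ?J \<rightarrow> ?J" by (auto simp: \<pi>_def)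
  qed
  have K: "distr ?K ?K (\<lambda>u. \<lambda>i\<in>?J. u (\<pi> i)) = ?K"
    using distr_PiM_reindex[OF _ \<pi>, of "\<lambda>_. \<mu>"] by (simp add: prob_space_axioms)
  have meas: "(\<lambda>u. \<lambda>i\<in>?J. u (\<pi> i)) \<in> measurable ?K ?K"
    using \<pi>(2) by (intro measurable_restrict measurable_component_singleton) auto
  have w0: "[1..<Suc n] \<in> permutations_of_set {1..n}"
    by (intro permutations_of_setI) (auto simp del: upt_Suc)
  have "(\<integral>u. exposed_count n q [1..<Suc n] u \<partial>?K) =
      (\<integral>u. exposed_count n q [1..<Suc n] u \<partial>distr ?K ?K (\<lambda>u. \<lambda>i\<in>?J. u (\<pi> i)))"
    by (simp only: K)
  also have "\<dots> = (\<integral>u. exposed_count n q [1..<Suc n] (\<lambda>i\<in>?J. u (\<pi> i)) \<partial>?K)"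
    by (rule integral_distr[OF meas borel_measurable_integrable[OF integrable_exposed_count[OF w0]]])
  also have "\<dots> = (\<integral>u. exposed_count n q w u \<partial>?K)"
  proof (intro Bochner_Integration.integral_cong refl)
    fix u :: "nat \<times> 'p \<Rightarrow> real"
    have "walk (closed_steps n (\<lambda>i\<in>?J. u (\<pi> i))) [1..<Suc n] k = walk (closed_steps n u) w k" for k
    proof -
      have "map (closed_steps n (\<lambda>i\<in>?J. u (\<pi> i))) [1..<Suc n] = map (closed_steps n u) w"
      proof (rule nth_equalityI)
        show "length (map (closed_steps n (\<lambda>i\<in>?J. u (\<pi> i))) [1..<Suc n]) = length (map (closed_steps n u) w)"
          using wl by simp
        fix i assume "i < length (map (closed_steps n (\<lambda>i\<in>?J. u (\<pi> i))) [1..<Suc n])"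
        then have i: "i < n" by (simp del: upt_Suc)
        have "w ! i \<in> {1..n}" unfolding wl(2)[symmetric] using i wl(1) by (intro nth_mem) auto
        then show "map (closed_steps n (\<lambda>i\<in>?J. u (\<pi> i))) [1..<Suc n] ! i = map (closed_steps n u) w ! i"
          using i wl(1) by (simp add: closed_steps_def step_vec_def \<pi>_def del: upt_Suc)
      qed
      then show ?thesis by (simp only: walk_def take_map[symmetric])
    qed
    then have "walk (closed_steps n (\<lambda>i\<in>?J. u (\<pi> i))) [1..<Suc n] = walk (closed_steps n u) w" by blast
    then show "exposed_count n q [1..<Suc n] (\<lambda>i\<in>?J. u (\<pi> i)) = exposed_count n q w u"
      unfolding exposed_count_def by (simp only:)
  qed
  finally show ?thesis by simp
qed

text \<open>All words have the same expected count, there are n! of them, and their counts add up to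
  \<open>c\<close> almost surely.\<close>

lemma expected_exposed_count:
  assumes c: "\<And>u :: nat \<times> 'p::finite \<Rightarrow> real. general_position {0..n} (closed_steps n u) \<Longrightarrow>
     card {(w, I) \<in> cut_words n q. exposed_indices (walk (closed_steps n u) w) n I} = c"
  shows "(\<integral>u. exposed_count n q [1..<Suc n] u \<partial>PiM ({1..n} \<times> (UNIV::'p set)) (\<lambda>_. \<mu>)) = real c / fact n"
proof -
  interpret P: product_prob_space "\<lambda>_::nat \<times> 'p. \<mu>" by standard
  let ?K = "PiM ({1..n} \<times> (UNIV::'p set)) (\<lambda>_. \<mu>)"
  interpret K: prob_space ?K by (rule prob_space_PiM) (rule prob_space_axioms)
  let ?W = "permutations_of_set {1..n}"
  have total: "(\<Sum>w\<in>?W. exposed_count n q w u) = real c"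
    if "general_position {0..n} (closed_steps n u)" for u :: "nat \<times> 'p \<Rightarrow> real"
  proof -
    have "{(w, I) \<in> cut_words n q. exposed_indices (walk (closed_steps n u) w) n I} =
      (SIGMA w:?W. {I. I \<subseteq> {0..n} \<and> card I = Suc q \<and> exposed_indices (walk (closed_steps n u) w) n I})"
      by (auto simp: cut_words_def)
    then have "c = (\<Sum>w\<in>?W. card {I. I \<subseteq> {0..n} \<and> card I = Suc q \<and> exposed_indices (walk (closed_steps n u) w) n I})"
      unfolding c[OF that, symmetric]
      by (simp add: card_SigmaI finite_subset[of _ "Pow {0..n}"])
    then show ?thesis by (simp add: exposed_count_def)
  qed
  have "(\<Sum>w\<in>?W. \<integral>u. exposed_count n q w u \<partial>?K) = (\<integral>u. (\<Sum>w\<in>?W. exposed_count n q w u) \<partial>?K)"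
    by (intro Bochner_Integration.integral_sum[symmetric] integrable_exposed_count)
  also have "\<dots> = (\<integral>u. real c \<partial>?K)"
  proof (rule integral_cong_AE)
    show "AE u in ?K. (\<Sum>w\<in>?W. exposed_count n q w u) = real c"
      using AE_general_position[where 'p = 'p, of n] by eventually_elim (rule total)
    show "(\<lambda>u. \<Sum>w\<in>?W. exposed_count n q w u) \<in> borel_measurable ?K"
      by (intro borel_measurable_sum borel_measurable_integrable integrable_exposed_count)
  qed simp
  also have "\<dots> = real c" by (simp add: K.prob_space del: One_nat_def)
  finally have "(\<Sum>w\<in>?W. \<integral>u. exposed_count n q [1..<Suc n] u \<partial>?K) = real c"
    using integral_exposed_count_permute[where 'p = 'p] by simp
  then show ?thesis by (simp add: field_simps)
qed

end

section \<open>The random path as a walk, and the two expectations\<close>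

lemma walk_closed_steps:
  assumes "k \<le> n"
  shows "walk (closed_steps n u) [1..<Suc n] k = (\<Sum>t\<in>{1..k}. step_vec u t)"
proof -
  have "take k [1..<Suc n] = [1..<Suc k]" using assms by (simp add: take_upt del: upt_Suc)
  then have "walk (closed_steps n u) [1..<Suc n] k = (\<Sum>t\<in>{1..k}. closed_steps n u t)"
    by (simp add: walk_def sum_list_distinct_conv_sum_set atLeastLessThanSuc_atLeastAtMost del: upt_Suc)
  also have "\<dots> = (\<Sum>t\<in>{1..k}. step_vec u t)"
    by (intro sum.cong) (auto simp: closed_steps_def)
  finally show ?thesis .
qed

lemma fst_walk_closed_steps: "k \<le> n \<Longrightarrow> fst (walk (closed_steps n u) [1..<Suc n] k) = real k"
  by (simp only: walk_closed_steps fst_sum) (simp add: step_vec_def)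

text \<open>The first coordinate of a point is its time, so the points are distinct for every
  sample.\<close>

lemma inj_on_walk_closed_steps: "inj_on (walk (closed_steps n u) [1..<Suc n]) {0..n}"
  by (rule inj_on_inverseI[where g = "\<lambda>v. nat \<lfloor>fst v\<rfloor>"])
    (simp only: fst_walk_closed_steps atLeastAtMost_iff, simp)

lemma path_point_eq_walk:
  assumes "k \<le> N"
  shows "path_point x \<omega> k = walk (closed_steps N (\<lambda>i\<in>{1..N} \<times> UNIV. x (fst i) \<omega> $ snd i)) [1..<Suc N] k"
proof -
  let ?u = "\<lambda>i\<in>{1..N} \<times> UNIV. x (fst i) \<omega> $ snd i"
  have "step_vec ?u t = (1, x t \<omega>)" if "t \<in> {1..k}" for t
    using that assms by (simp add: step_vec_def vec_eq_iff)
  then have "(\<Sum>t\<in>{1..k}. step_vec ?u t) = (\<Sum>t\<in>{1..k}. (1, x t \<omega>))" by (intro sum.cong) auto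
  also have "\<dots> = path_point x \<omega> k" by (simp add: path_point_def sum_prod)
  finally show ?thesis by (simp only: walk_closed_steps[OF assms])
qed

lemma path_hull_eq_walk:
  "path_hull x (Suc N) \<omega> =
    convex hull (walk (closed_steps N (\<lambda>i\<in>{1..N} \<times> UNIV. x (fst i) \<omega> $ snd i)) [1..<Suc N] ` {0..N})"
  unfolding path_hull_def using path_point_eq_walk[of _ N x \<omega>]
  by (intro arg_cong[where f = "(hull) convex"] image_cong) auto

theorem theorem6:
  fixes M :: "'a measure"
    and x :: "nat \<Rightarrow> 'a \<Rightarrow> real ^ 'p::finite"
    and \<mu> :: "real measure"
    and n :: nat
  assumes "prob_space M"
    and independent: "prob_space.indep_vars M (\<lambda>_. borel) (\<lambda>(\<tau>, d) \<omega>. x \<tau> \<omega> $ d) ({1..} \<times> UNIV)"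
    and identically_distributed:
      "\<And>\<tau> d. 1 \<le> \<tau> \<Longrightarrow> distr M borel (\<lambda>\<omega>. x \<tau> \<omega> $ d) = \<mu>"
    and continuous_distribution: "continuous_on UNIV (cdf \<mu>)"
    and "2 \<le> n"
  shows "(n \<noteq> CARD('p) + 1 \<longrightarrow>
           prob_space.expectation M (\<lambda>\<omega>. real (num_faces x n \<omega>)) =
             2 * fact CARD('p) / fact (n - 1) * real (stirling n (CARD('p) + 1))) \<and>
         prob_space.expectation M (\<lambda>\<omega>. real (num_vertices x n \<omega>)) =
           2 / fact (n - 1) *
             (\<Sum>l. if 2 * l \<le> CARD('p) + 1 then real (stirling n (CARD('p) + 1 - 2 * l)) else 0)"
proof -
  interpret M: prob_space M by fact
  define N where "N = n - 1"
  have n: "n = Suc N" and N: "N \<ge> 1" using \<open>2 \<le> n\<close> by (auto simp: N_def)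
  define Y where "Y = (\<lambda>(\<tau>, d) \<omega>. x \<tau> \<omega> $ d)"
  define J where "J = {1..N} \<times> (UNIV :: 'p set)"
  define U where "U \<omega> = (\<lambda>i\<in>J. Y i \<omega>)" for \<omega>
  have indJ: "M.indep_vars (\<lambda>_. borel) Y J"
    using independent unfolding Y_def[symmetric] by (rule M.indep_vars_subset) (auto simp: J_def)
  have rv: "M.random_variable borel (Y i)" if "i \<in> J" for i
    using indJ that unfolding M.indep_vars_def by auto
  have law: "distr M borel (Y i) = \<mu>" if "i \<in> J" for i
    using that identically_distributed by (auto simp: J_def Y_def)
  define i0 :: "nat \<times> 'p" where "i0 = (1, undefined)"
  have i0: "i0 \<in> J" using N by (simp add: J_def i0_def)
  \<comment> \<open>That \<open>\<mu>\<close> is a probability measure is read off from one entry,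
    which exists because \<open>N \<ge> 1\<close>.\<close>
  interpret rd: real_distribution \<mu>
    using M.real_distribution_distr[OF rv[OF i0]] law[OF i0] by simp
  interpret diffuse_law \<mu>
  proof
    fix a :: real
    \<comment> \<open>A distribution function without jumps belongs to a law without atoms.\<close>
    have "isCont (cdf \<mu>) a"
      using continuous_distribution by (simp add: continuous_on_eq_continuous_at)
    then have "measure \<mu> {a} = 0" by (simp only: rd.isCont_cdf)
    then show "emeasure \<mu> {a} = 0" by (simp add: rd.emeasure_eq_measure)
  qed simp
  let ?K = "PiM J (\<lambda>_. \<mu>)"
  have sets_K: "sets ?K = sets (PiM J (\<lambda>_. borel))" by (intro sets_PiM_cong) auto
  have U_meas: "U \<in> measurable M ?K"
    unfolding U_def measurable_cong_sets[OF refl sets_K] by (intro measurable_restrict rv)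
  \<comment> \<open>By independence the joint law of the entries is a product, so the expectations
    can be computed on \<open>?K\<close>.\<close>
  have "distr M (PiM J (\<lambda>_. borel)) U = PiM J (\<lambda>i. distr M borel (Y i))"
    using M.indep_vars_iff_distr_eq_PiM'[where I = J and M' = "\<lambda>_. borel" and X = Y] i0 rv indJ unfolding U_def by blast
  also have "\<dots> = ?K" using law by (intro PiM_cong) auto
  finally have distr_U: "distr M ?K U = ?K"
    using distr_cong[OF refl sets_K, of M U U] by simp
  have U_eq: "U \<omega> = (\<lambda>i\<in>{1..N} \<times> UNIV. x (fst i) \<omega> $ snd i)" for \<omega>
    by (auto simp: U_def J_def Y_def)
  have w0: "[1..<Suc N] \<in> permutations_of_set {1..N}"
    by (intro permutations_of_setI) (auto simp del: upt_Suc)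
  have cmeas: "exposed_count N q [1..<Suc N] \<in> borel_measurable ?K" for q
    unfolding J_def by (intro borel_measurable_integrable integrable_exposed_count w0)
  have transfer: "M.expectation (\<lambda>\<omega>. exposed_count N q [1..<Suc N] (U \<omega>)) =
      (\<integral>u. exposed_count N q [1..<Suc N] u \<partial>?K)" for q
    using integral_distr[OF U_meas cmeas, of q] by (simp only: distr_U)
  have X0: "closed_steps N u 0 = - (\<Sum>t\<in>{1..N}. closed_steps N u t)" for u :: "nat \<times> 'p \<Rightarrow> real"
    by (simp add: closed_steps_def)
  have vertices: "real (num_vertices x n \<omega>) = exposed_count N 0 [1..<Suc N] (U \<omega>)" for \<omega>
    unfolding num_vertices_def n path_hull_eq_walk exposed_count_def U_eq
    by (simp only: card_extreme_points[OF N inj_on_walk_closed_steps])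
  have "M.expectation (\<lambda>\<omega>. real (num_vertices x n \<omega>)) = real (2 * alt_stirling (Suc N) (Suc CARD('p))) / fact N"
    unfolding vertices transfer J_def
  proof (rule expected_exposed_count)
    fix u :: "nat \<times> 'p \<Rightarrow> real" assume "general_position {0..N} (closed_steps N u)"
    from card_exposed_points[OF X0 this N]
    show "card {(w, I) \<in> cut_words N 0. exposed_indices (walk (closed_steps N u) w) N I} =
        2 * alt_stirling (Suc N) (Suc CARD('p))" by simp
  qed
  moreover have "(\<Sum>l. if 2 * l \<le> CARD('p) + 1 then real (stirling n (CARD('p) + 1 - 2 * l)) else 0) =
      real (alt_stirling (Suc N) (Suc CARD('p)))"
    using sums_unique[OF alt_stirling_sums[of "Suc CARD('p)" "Suc N"], symmetric]
    by (simp only: n Suc_eq_plus1)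
  \<comment> \<open>For \<open>n = CARD('p) + 1\<close> every arc is a single letter, so both signs
    of \<open>f\<close> describe the same set of points and a doubled count would be wrong.\<close>
  moreover have "M.expectation (\<lambda>\<omega>. real (num_faces x n \<omega>)) =
             2 * fact CARD('p) / fact (n - 1) * real (stirling n (CARD('p) + 1))" if ne: "n \<noteq> CARD('p) + 1"
  proof (cases "CARD('p) < N")
    case False
    then have small: "N < CARD('p)" using ne n by simp
    \<comment> \<open>The hull of \<open>Suc N\<close> points has dimension at most
      \<open>N\<close>, so no face is large enough; the Stirling number is 0 as well.\<close>
    have "num_faces x n \<omega> = 0" for \<omega>
    proof -
      have "aff_dim F < int CARD('p)" if "F face_of path_hull x n \<omega>" for F
      proof -
        have "aff_dim F \<le> aff_dim (path_hull x n \<omega>)"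
          using that by (intro aff_dim_subset face_of_imp_subset)
        also have "\<dots> \<le> int (card (path_point x \<omega> ` {0..N})) - 1"
          unfolding path_hull_def aff_dim_convex_hull n diff_Suc_1 by (intro aff_dim_le_card) simp
        also have "\<dots> \<le> int N" using card_image_le[of "{0..N}" "path_point x \<omega>"] by simp
        finally show ?thesis using small by simp
      qed
      then have "{F. F face_of path_hull x n \<omega> \<and> aff_dim F = int CARD('p)} = {}" by force
      then show ?thesis by (simp only: num_faces_def card.empty)
    qed
    then show ?thesis using small n by simp
  next
    case True
    have gpU: "AE \<omega> in M. general_position {0..N} (closed_steps N (U \<omega>))"
    proof -
      have "AE u in distr M ?K U. general_position {0..N} (closed_steps N u)"
        unfolding distr_U unfolding J_def by (rule AE_general_position)
      then show ?thesis by (rule AE_distrD[OF U_meas])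
    qed
    have faces: "real (num_faces x n \<omega>) = exposed_count N CARD('p) [1..<Suc N] (U \<omega>)"
      if "general_position {0..N} (closed_steps N (U \<omega>))" for \<omega>
      unfolding num_faces_def n path_hull_eq_walk exposed_count_def U_eq[symmetric]
    proof (subst card_faces[OF that])
      fix k assume "k \<le> N"
      then show "walk (closed_steps N (U \<omega>)) [1..<Suc N] k = (\<Sum>t\<in>{1..k}. closed_steps N (U \<omega>) t)"
        by (simp only: walk_closed_steps) (auto simp: closed_steps_def intro!: sum.cong)
    qed (use True in \<open>simp_all add: inj_on_walk_closed_steps del: upt_Suc One_nat_def\<close>)
    have "M.expectation (\<lambda>\<omega>. real (num_faces x n \<omega>)) =
        M.expectation (\<lambda>\<omega>. exposed_count N CARD('p) [1..<Suc N] (U \<omega>))"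
    proof (rule integral_cong_AE)
      \<comment> \<open>The number of faces equals the exposed count only almost surely, so its
        measurability needs an argument at every outcome: \<open>bij_betw_faces\<close> writes it as
        a finite sum of indicators of measurable events.\<close>
      let ?E = "\<lambda>u I. I \<subseteq> {0..N} \<and>
        (I = {0..N} \<or> exposed_indices (walk (closed_steps N u) [1..<Suc N]) N I) \<and>
        aff_dim (walk (closed_steps N u) [1..<Suc N] ` I) = int CARD('p)"
      have ev: "{u \<in> space ?K. ?E u I} \<in> sets ?K" if "I \<subseteq> {0..N}" for I
      proof -
        have "{u \<in> space ?K. aff_dim (walk (closed_steps N u) [1..<Suc N] ` I) = int CARD('p)} \<in> sets ?K"
          unfolding J_def by (intro measurable_aff_dim[OF that] measurable_walk w0)
        moreover have "{u \<in> space ?K. exposed_indices (walk (closed_steps N u) [1..<Suc N]) N I} \<in> sets ?K"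
          unfolding J_def by (rule measurable_exposed_walk[OF w0 that])
        ultimately show ?thesis using that by (intro sets.sets_Collect_conj sets.sets_Collect_disj) auto
      qed
      have "(\<lambda>u. \<Sum>I\<in>Pow {0..N}. if ?E u I then 1 else 0 :: real) \<in> borel_measurable ?K"
        by (intro borel_measurable_sum measurable_If ev) auto
      then have "(\<lambda>\<omega>. \<Sum>I\<in>Pow {0..N}. if ?E (U \<omega>) I then 1 else 0 :: real) \<in> borel_measurable M"
        by (rule measurable_compose[OF U_meas])
      moreover have "real (num_faces x n \<omega>) = (\<Sum>I\<in>Pow {0..N}. if ?E (U \<omega>) I then 1 else 0)" for \<omega>
      proof -
        have "num_faces x n \<omega> = card {I. ?E (U \<omega>) I}"
          unfolding num_faces_def n path_hull_eq_walk U_eq[symmetric]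
          by (rule bij_betw_same_card[OF bij_betw_faces, symmetric])
        moreover have "Pow {0..N} \<inter> {I. ?E (U \<omega>) I} = {I. ?E (U \<omega>) I}" by blast
        moreover have "(\<Sum>I\<in>Pow {0..N}. if Q I then 1 else 0) = real (card (Pow {0..N} \<inter> {I. Q I}))"
          for Q by (simp add: sum.If_cases)
        ultimately show ?thesis by (simp only:)
      qed
      ultimately show "(\<lambda>\<omega>. real (num_faces x n \<omega>)) \<in> borel_measurable M" by simp
      show "(\<lambda>\<omega>. exposed_count N CARD('p) [1..<Suc N] (U \<omega>)) \<in> borel_measurable M"
        by (rule measurable_compose[OF U_meas cmeas])
      show "AE \<omega> in M. real (num_faces x n \<omega>) = exposed_count N CARD('p) [1..<Suc N] (U \<omega>)"
        using gpU by eventually_elim (rule faces)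
    qed
    also have "\<dots> = real (2 * (fact CARD('p) * stirling (Suc N) (Suc CARD('p)))) / fact N"
      unfolding transfer J_def
    proof (rule expected_exposed_count)
      fix u :: "nat \<times> 'p \<Rightarrow> real" assume "general_position {0..N} (closed_steps N u)"
      from card_exposed_facets[OF X0 this _ True]
      show "card {(w, I) \<in> cut_words N CARD('p). exposed_indices (walk (closed_steps N u) w) N I} =
          2 * (fact CARD('p) * stirling (Suc N) (Suc CARD('p)))" by simp
    qed
    finally show ?thesis by (simp add: n)
  qed
  ultimately show ?thesis by (simp add: n)
qed

end
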